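(* Let $\mathbb{F}\in\{\mathbb{R},\mathbb{C}\}$ and let $r\geq1$ be an integer. (a) Let $n\geq3$, let $\alpha=\bigl(\frac{n-2}{2n-2}\bigr)^{1/2}$ and $\beta=\bigl(\frac{n}{2n-2}\bigr)^{1/2}$, let $(B_i)_{i=1}^{n-1}$ be unitary matrices in $\mathbb{F}^{r\times r}$ such that $B_i^*B_j+B_j^*B_i=-\frac{2}{n-2}I$ for all distinct $i,j\in\{1,\dots,n-1\}$, and consider the $\mathrm{EITFF}_{\mathbb{F}}(2r,r,n)$ for $\mathbb{F}^{2r}$ whose subspaces are the images of the isometries $$\Phi_i=\begin{bmatrix}\alpha I\\ \beta B_i\end{bmatrix}\ (i=1,\dots,n-1),\qquad \Phi_n=\begin{bmatrix}I\\0\end{bmatrix}.$$ If each $B_i$ is skew-Hermitian, that is, $B_i^*=-B_i$ for all $i$, then this EITFF is totally symmetric. (b) Let $n\geq 3$. There exists a $\rho$-simplex $(B_i)_{i=1}^{n-1}$ in $\mathbb{F}^{r\times r}$ all of whose members are skew-Hermitian if and only if $n\leq\rho_{\mathbb{F}}(r)+1$, where, writing $r=(2a+1)2^{4b+c}$ with nonnegative integers $a,b,c$ and $c\leq3$, $\rho_{\mathbb{R}}(r)=8b+2^c$ and $\rho_{\mathbb{C}}(r)=8b+2c+2$. (c) For every $n\geq2$, any $\mathrm{EITFF}_{\mathbb{F}}(2r,r,n)$ has alternating or total symmetry.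
   Context: For $\mathbb{F}=\mathbb{R}$, "unitary" means orthogonal; $^*$ denotes the adjoint (conjugate transpose). EITFFs. Let $(\mathcal{U}_i)_{i=1}^n$, $n\geq 2$, be $r$-dimensional subspaces of a $d$-dimensional Hilbert space $\mathcal{E}$ over $\mathbb{F}$, with orthogonal projections $\Pi_i$. The sequence is an $\mathrm{EITFF}_{\mathbb{F}}(d,r,n)$ (equi-isoclinic tight fusion frame) if it is equi-isoclinic, meaning there is $\sigma\geq0$ with $\Pi_i\Pi_j\Pi_i=\sigma^2\Pi_i$ for all $i\neq j$, and is a tight fusion frame for $\mathcal{E}$, meaning $\sum_{i=1}^n\Pi_i=aI$ for some $a>0$. Isometries of the sequence are linear maps $\Phi_i:\mathbb{F}^r\to\mathcal{E}$ with $\Phi_i^*\Phi_i=I$ and image $\mathcal{U}_i$. The matrices $\Phi_i$ in (a) are known to be isometries of an $\mathrm{EITFF}_{\mathbb{F}}(2r,r,n)$. Symmetry. A permutation $\sigma$ of $\{1,\dots,n\}$ is a symmetry of $(\mathcal{U}_i)_{i=1}^n$ if there is a unitary $\Upsilon_\sigma:\mathcal{E}\to\mathcal{E}$ such that $\Pi_{\sigma(i)}=\Upsilon_\sigma\Pi_i\Upsilon_\sigma^*$ for all $i$ (equivalently $\mathcal{U}_{\sigma(i)}=\Upsilon_\sigma(\mathcal{U}_i)$ for all $i$). The symmetries form a subgroup of the symmetric group $S_n$. The sequence has total symmetry (is totally symmetric) if this group equals $S_n$, and has alternating symmetry if it equals the alternating group $A_n$. Radon–Hurwitz notions. A $\rho$-simplex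 in $\mathbb{F}^{r\times r}$ is a sequence $(B_i)_{i=1}^{n-1}$ ($n\geq3$) of unitary matrices in $\mathbb{F}^{r\times r}$ with $B_i^*B_j+B_j^*B_i=-\frac{2}{n-2}I$ for all $i\neq j$. The Radon–Hurwitz number $\rho_{\mathbb{F}}(r)$ is the maximum dimension of a real subspace of $\mathbb{F}^{r\times r}$ whose every member is a scalar multiple of a unitary; equivalently, the maximum $m$ for which there are unitaries $C_1,\dots,C_m\in\mathbb{F}^{r\times r}$ with $C_i^*C_j+C_j^*C_i=0$ for all $i\neq j$. Its value is given, by classical results of Radon, Hurwitz, Adams and others, by the formula in (b). *)

theory Defs
  imports "HOL-Analysis.Analysis" "Jordan_Normal_Form.Conjugate"
begin

text \<open>
  The scalars range over types of sort \<open>{real_normed_field, conjugatable_ordered_field}\<close>;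
  the instances of interest are \<^typ>\<open>real\<close>, where \<^const>\<open>conjugate\<close> is the identity, and
  \<^typ>\<open>complex\<close>, where it is \<^const>\<open>cnj\<close> and \<open>0 \<le> z\<close> means that \<open>z\<close> is real and nonnegative.
\<close>

section \<open>Finite-dimensional Hilbert spaces\<close>

text \<open>The inner product is conjugate-linear in its first and linear in its second argument.\<close>

locale fd_hilbert_space = vector_space scale
  for scale :: "'a::{real_normed_field, conjugatable_ordered_field} \<Rightarrow> 'e::ab_group_add \<Rightarrow> 'e" +
  fixes ip :: "'e \<Rightarrow> 'e \<Rightarrow> 'a"
  assumes ip_add: "ip x (y + z) = ip x y + ip x z"
    and ip_scale: "ip x (scale c y) = c * ip x y"
    and ip_commute: "ip y x = conjugate (ip x y)"
    and ip_nonneg: "0 \<le> ip x x"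
    and ip_definite: "ip x x = 0 \<Longrightarrow> x = 0"
    and finite_dimensional: "\<exists>B. finite B \<and> span B = UNIV"
begin

text \<open>The orthogonal projection of \<open>v\<close> onto a subspace \<open>U\<close>.\<close>

definition orth_proj :: "'e set \<Rightarrow> 'e \<Rightarrow> 'e" where
  "orth_proj U v = (THE u. u \<in> U \<and> (\<forall>w\<in>U. ip w (v - u) = 0))"

definition adj :: "('e \<Rightarrow> 'e) \<Rightarrow> 'e \<Rightarrow> 'e" where
  "adj T = (THE S. \<forall>x y. ip (T x) y = ip x (S y))"

definition unitary_op :: "('e \<Rightarrow> 'e) \<Rightarrow> bool" where
  "unitary_op T \<longleftrightarrow> Vector_Spaces.linear scale scale T \<and> adj T \<circ> T = id \<and> T \<circ> adj T = id"

text \<open>A sequence \<open>U\<^sub>1, \<dots>, U\<^sub>n\<close> is a function on \<^typ>\<open>nat\<close> of which only the values on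
  \<open>{1..n}\<close> matter.\<close>

definition equi_isoclinic :: "nat \<Rightarrow> (nat \<Rightarrow> 'e set) \<Rightarrow> bool" where
  "equi_isoclinic n U \<longleftrightarrow> (\<exists>\<sigma>::real. 0 \<le> \<sigma> \<and>
     (\<forall>i\<in>{1..n}. \<forall>j\<in>{1..n}. i \<noteq> j \<longrightarrow>
        orth_proj (U i) \<circ> orth_proj (U j) \<circ> orth_proj (U i) =
          (\<lambda>v. scale (of_real (\<sigma>\<^sup>2)) (orth_proj (U i) v))))"

definition tight_fusion_frame :: "nat \<Rightarrow> (nat \<Rightarrow> 'e set) \<Rightarrow> bool" where
  "tight_fusion_frame n U \<longleftrightarrow> (\<exists>a::real. 0 < a \<and>
     (\<forall>v. (\<Sum>i=1..n. orth_proj (U i) v) = scale (of_real a) v))"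

definition eitff :: "nat \<Rightarrow> nat \<Rightarrow> nat \<Rightarrow> (nat \<Rightarrow> 'e set) \<Rightarrow> bool" where
  "eitff d r n U \<longleftrightarrow> 2 \<le> n \<and> dim (UNIV :: 'e set) = d \<and>
     (\<forall>i\<in>{1..n}. subspace (U i) \<and> dim (U i) = r) \<and>
     equi_isoclinic n U \<and> tight_fusion_frame n U"

definition symmetries :: "nat \<Rightarrow> (nat \<Rightarrow> 'e set) \<Rightarrow> (nat \<Rightarrow> nat) set" where
  "symmetries n U = {\<sigma>. \<sigma> permutes {1..n} \<and>
     (\<exists>\<Upsilon>. unitary_op \<Upsilon> \<and> (\<forall>i\<in>{1..n}. orth_proj (U (\<sigma> i)) = \<Upsilon> \<circ> orth_proj (U i) \<circ> adj \<Upsilon>))}"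

definition total_symmetry :: "nat \<Rightarrow> (nat \<Rightarrow> 'e set) \<Rightarrow> bool" where
  "total_symmetry n U \<longleftrightarrow> symmetries n U = {\<sigma>. \<sigma> permutes {1..n}}"

definition alternating_symmetry :: "nat \<Rightarrow> (nat \<Rightarrow> 'e set) \<Rightarrow> bool" where
  "alternating_symmetry n U \<longleftrightarrow> symmetries n U = {\<sigma>. \<sigma> permutes {1..n} \<and> evenperm \<sigma>}"

end

definition std_ip :: "'a::{semiring_1, conjugate}^'m \<Rightarrow> 'a^'m \<Rightarrow> 'a" where
  "std_ip x y = (\<Sum>k\<in>UNIV. conjugate (x $ k) * y $ k)"

lemma fd_hilbert_space_std:
  "fd_hilbert_space ((*s) :: 'a::{real_normed_field, conjugatable_ordered_field} \<Rightarrow> 'a^'m \<Rightarrow> 'a^'m)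
     std_ip"
proof
  fix x y z :: "'a^'m" and c :: 'a
  show "std_ip x (y + z) = std_ip x y + std_ip x z"
    by (simp add: std_ip_def algebra_simps sum.distrib)
  show "std_ip x (c *s y) = c * std_ip x y"
    by (simp add: std_ip_def algebra_simps sum_distrib_left)
  show "std_ip y x = conjugate (std_ip x y)"
    by (simp add: std_ip_def sum_conjugate conjugate_dist_mul mult.commute)
  have nonneg: "0 \<le> conjugate (x $ k) * x $ k" for k
    using conjugate_square_positive[of "x $ k"] by (simp add: mult.commute)
  show "0 \<le> std_ip x x"
    unfolding std_ip_def by (intro sum_nonneg nonneg)
  show "x = 0" if "std_ip x x = 0"
  proof -
    have "\<forall>k. conjugate (x $ k) * x $ k = 0"
      using that sum_nonneg_eq_0_iff[OF finite_class.finite_UNIV, of "\<lambda>k. conjugate (x $ k) * x $ k"] nonneg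
      unfolding std_ip_def by simp
    then show ?thesis by (simp add: vec_eq_iff)
  qed
  show "\<exists>B :: ('a^'m) set. finite B \<and> vec.span B = UNIV"
    using finite_cart_basis span_cart_basis by blast
qed

section \<open>Matrices\<close>

definition cadjoint :: "'a::conjugate^'n^'m \<Rightarrow> 'a^'m^'n" where
  "cadjoint A = (\<chi> i j. conjugate (A $ j $ i))"

definition unitary_mat :: "'a::{semiring_1, conjugate}^'n^'n \<Rightarrow> bool" where
  "unitary_mat A \<longleftrightarrow> cadjoint A ** A = mat 1 \<and> A ** cadjoint A = mat 1"

definition skew_hermitian :: "'a::{uminus, conjugate}^'n^'n \<Rightarrow> bool" where
  "skew_hermitian A \<longleftrightarrow> cadjoint A = - A"

definition rho_simplex ::
    "nat \<Rightarrow> (nat \<Rightarrow> 'a::{real_normed_field, conjugatable_ordered_field}^'r^'r) \<Rightarrow> bool" where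
  "rho_simplex n B \<longleftrightarrow> 3 \<le> n \<and> (\<forall>i\<in>{1..n-1}. unitary_mat (B i)) \<and>
     (\<forall>i\<in>{1..n-1}. \<forall>j\<in>{1..n-1}. i \<noteq> j \<longrightarrow>
        cadjoint (B i) ** B j + cadjoint (B j) ** B i = - (2 / (real n - 2)) *\<^sub>R mat 1)"

text \<open>\<^const>\<open>subspace\<close> and \<^const>\<open>dim\<close> refer to the real vector space structure, also over
  the complex numbers. The type arguments carry the scalar field and the index type, so that
  \<open>radon_hurwitz TYPE('a) TYPE('r)\<close> is the Radon-Hurwitz number of \<open>CARD('r)\<close> over \<open>'a\<close>.\<close>

definition radon_hurwitz ::
    "'a::{real_normed_field, conjugatable_ordered_field} itself \<Rightarrow> 'r::finite itself \<Rightarrow> nat" where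
  "radon_hurwitz _ _ =
     Max {dim S | S :: ('a^'r^'r) set. subspace S \<and>
       (\<forall>A\<in>S. \<exists>c V. unitary_mat V \<and> A = (\<chi> i j. c * V $ i $ j))}"

definition block_column :: "'a^'r^'m \<Rightarrow> 'a^'r^'k \<Rightarrow> 'a^'r^('m + 'k)" where
  "block_column A C = (\<chi> p. case p of Inl k \<Rightarrow> A $ k | Inr k \<Rightarrow> C $ k)"

definition simplex_isometry ::
    "nat \<Rightarrow> (nat \<Rightarrow> 'a::{real_normed_field, conjugatable_ordered_field}^'r^'r) \<Rightarrow>
      nat \<Rightarrow> 'a^'r^('r + 'r)" where
  "simplex_isometry n B i =
     (let \<alpha> = sqrt ((real n - 2) / (2 * real n - 2));
          \<beta> = sqrt (real n / (2 * real n - 2))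
      in if i = n then block_column (mat 1) 0
         else block_column (\<alpha> *\<^sub>R mat 1) (\<beta> *\<^sub>R B i))"

definition simplex_eitff ::
    "nat \<Rightarrow> (nat \<Rightarrow> 'a::{real_normed_field, conjugatable_ordered_field}^'r^'r) \<Rightarrow>
      nat \<Rightarrow> ('a^('r + 'r)) set" where
  "simplex_eitff n B i = range (\<lambda>x. simplex_isometry n B i *v x)"

end

theory Submission
  imports Defs
begin

text \<open>
  \<^emph>\<open>Symmetry.\<close> The reflections \<open>R i = 2 \<Pi> i - 1\<close> of an EITFF with \<open>d = 2 r\<close> have scalar anticommutators
  \<open>c < 2\<close> that do not depend on the pair, so they behave like the vertices of a regular simplex among the vectors
  of a Clifford algebra: conjugation by the unitary multiple of \<open>R a - R b\<close> exchanges \<open>R a\<close> and \<open>R b\<close> and negates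
  all the \<open>R i\<close>. Hence every even permutation is a symmetry, and an odd permutation is a symmetry as soon
  as some unitary anticommutes with all \<open>R i\<close>. For skew-Hermitian \<open>B i\<close>, swapping the two blocks is such a unitary.

  \<^emph>\<open>Radon-Hurwitz.\<close> Both the skew-Hermitian simplices with \<open>n - 1\<close> members and the \<open>(n - 1)\<close>-dimensional spaces of
  multiples of unitaries amount to \<open>n - 2\<close> anticommuting skew-Hermitian unitaries. An upper bound on the number of those
  comes from traces: multiplying projections \<open>(1 + T) / 2\<close> for commuting Hermitian involutions \<open>T\<close>, which are words
  in the given matrices, halves the trace each time, and the trace of a Hermitian idempotent is a natural
  number (an even one, or a multiple of 4, if it commutes with a complex or quaternionic structure). The lower bound
  comes from monomial matrices built by tensor products from the quaternions and octonions.
\<close>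

section \<open>Hilbert spaces over the real or complex numbers\<close>

text \<open>Why d = 2r makes the anticommutators scalar: if s = \<sigma>^2 is not 1, two of the
  subspaces meet only in 0, so every vector is a sum of one vector from each, and on both summands
  (P - Q)^2 acts as 1 - s. The anticommutator of the two reflections is 2 - 4 (P - Q)^2, whence c =
  4 s - 2. For s = 1 the operator \<open>R a - R b\<close> cannot be normalised, but then all
  subspaces coincide and every permutation is a symmetry.

  The obstacle in the trace bound is that each halving needs two words: a Hermitian involution
  commuting with everything that must survive, and a witness that anticommutes with it yet commutes
  with the current projection. Therefore the trace statements are about arbitrary Hermitian
  idempotents commuting with the generators, and only at the end is the identity inserted. Over the
  reals eight generators are consumed for a factor 16, which is the period of the formula; over the
  complex numbers the scalar i turns a product of two generators into a Hermitian involution, so two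
  generators already give a factor 2.\<close>

class rc_field = real_normed_field + conjugatable_ordered_field + euclidean_space +
  \<comment> \<open>Both axioms hold for the real and the complex numbers and let one proof serve
    both. The first says that \<open>x \<bullet> y\<close> is the real part of
    \<open>conjugate x * y\<close>, the second that nonnegative scalars are real.\<close>
  assumes conjugate_mult_add: "conjugate x * y + conjugate y * x = scaleR (2 * (x \<bullet> y)) 1"
    and nonneg_eq_norm: "0 \<le> x \<Longrightarrow> x = scaleR (norm x) 1"

instance real :: rc_field
  by standard auto

instance complex :: rc_field
  by standard (auto simp: complex_eq_iff less_eq_complex_def cmod_def inner_complex_def algebra_simps)

lemma conjugate_of_real [simp]: "conjugate (of_real t :: 'a::rc_field) = of_real t"
proof -
  have "conjugate (1::'a) = 1"
    by (metis conjugate_dist_mul conjugate_id mult.right_neutral mult_1)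
  moreover have "(of_real t :: 'a) \<bullet> 1 = t"
    by (metis inner_scaleR_left mult.right_neutral norm_eq_1 norm_one of_real_def)
  ultimately have "conjugate (of_real t :: 'a) + of_real t = of_real (2 * t)"
    using conjugate_mult_add[of "of_real t :: 'a" 1] by (simp only: mult_1_left mult_1_right flip: of_real_def)
  then show ?thesis by (simp only: mult_2 of_real_add add_right_cancel)
qed

lemma conjugate_one [simp]: "conjugate (1 :: 'a::rc_field) = 1"
  using conjugate_of_real[of 1, where 'a='a] by simp

lemma conjugate_minus [simp]: "conjugate (- x :: 'a::rc_field) = - conjugate x"
  by (rule conjugate_neg)

lemma conjugate_scaleR [simp]: "conjugate (t *\<^sub>R x :: 'a::rc_field) = t *\<^sub>R conjugate x"
  by (simp add: scaleR_conv_of_real conjugate_dist_mul)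

lemma conjugate_mult_self: "conjugate x * (x :: 'a::rc_field) = of_real ((norm x)\<^sup>2)"
proof -
  have "conjugate x * x + conjugate x * x = of_real ((norm x)\<^sup>2) + of_real ((norm x)\<^sup>2)"
    unfolding conjugate_mult_add[of x x] by (simp add: power2_norm_eq_inner of_real_def flip: scaleR_add_left)
  then have "2 * (conjugate x * x) = 2 * (of_real ((norm x)\<^sup>2) :: 'a)" by (simp only: mult_2)
  then show ?thesis by simp
qed

lemma nonneg_of_real_iff [simp]: "0 \<le> (of_real t :: 'a::rc_field) \<longleftrightarrow> 0 \<le> t"
proof
  assume "0 \<le> (of_real t :: 'a)"
  from nonneg_eq_norm[OF this] have "of_real t = (of_real \<bar>t\<bar> :: 'a)"
    by (simp add: of_real_def)
  then show "0 \<le> t" by simp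
next
  assume "0 \<le> t"
  have "0 \<le> (of_real (sqrt t) :: 'a) * conjugate (of_real (sqrt t))"
    by (rule conjugate_square_positive)
  with \<open>0 \<le> t\<close> show "0 \<le> (of_real t :: 'a)" by (simp flip: of_real_mult)
qed

locale rc_hilbert_space = fd_hilbert_space scale ip
  for scale :: "'a::rc_field \<Rightarrow> 'e::ab_group_add \<Rightarrow> 'e" and ip
begin

lemma ip_add_left: "ip (x + y) z = ip x z + ip y z"
  by (metis ip_add ip_commute conjugate_dist_add)

lemma ip_scale_left: "ip (scale c x) y = conjugate c * ip x y"
  by (metis ip_scale ip_commute conjugate_dist_mul)

lemma ip_zero [simp]: "ip x 0 = 0" "ip 0 x = 0"
  using ip_add[of x 0 0] ip_add_left[of 0 0 x] by auto

lemma ip_minus: "ip x (- y) = - ip x y" "ip (- x) y = - ip x y"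
  using ip_add[of x y "-y"] ip_add_left[of x "-x" y] by (auto simp: eq_neg_iff_add_eq_0 add.commute)

lemma ip_diff: "ip x (y - z) = ip x y - ip x z" "ip (x - y) z = ip x z - ip y z"
  using ip_add[of x y "-z"] ip_add_left[of x "-y" z] by (auto simp: ip_minus)

lemma ip_sum: "ip x (sum f A) = (\<Sum>a\<in>A. ip x (f a))" "ip (sum f A) x = (\<Sum>a\<in>A. ip (f a) x)"
  by (induction A rule: infinite_finite_induct) (auto simp: ip_add ip_add_left)

lemma ip_eqI: "(\<And>w. ip w x = ip w y) \<Longrightarrow> x = y"
  using ip_definite[of "x - y"] by (simp add: ip_diff)

lemma ip_eq_0_commute: "ip x y = 0 \<longleftrightarrow> ip y x = 0"
  by (metis ip_commute conjugate_zero conjugate_id)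

lemma orthogonal_span:
  assumes "w \<in> span C" "\<And>c. c \<in> C \<Longrightarrow> ip c z = 0" shows "ip w z = 0"
  using assms(1) by (induction rule: span_induct_alt) (auto simp: ip_add_left ip_scale_left assms(2))

lemma subtract_components_orthogonal:
  assumes "finite C" "pairwise (\<lambda>x y. ip x y = 0) C" "0 \<notin> C" "c \<in> C"
  shows "ip c (b - (\<Sum>d\<in>C. scale (ip d b / ip d d) d)) = 0"
proof -
  have "(\<Sum>d\<in>C. (ip d b / ip d d) * ip c d) = (\<Sum>d\<in>C. if d = c then ip c b else 0)"
  proof (rule sum.cong, goal_cases)
    case (2 d)
    show ?case
    proof (cases "d = c")
      case True
      have "ip c c \<noteq> 0" using assms(3,4) ip_definite by metis
      then show ?thesis using True by simp
    next
      case False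
      then show ?thesis using assms(2,4) 2 by (auto simp: pairwise_def)
    qed
  qed simp
  also have "\<dots> = ip c b" using assms(1,4) by simp
  finally show ?thesis by (simp add: ip_diff ip_sum ip_scale)
qed

text \<open>Gram-Schmidt without normalisation: dividing by \<open>ip d d\<close> avoids square
  roots of scalars. A vector that already lies in the span of its predecessors is dropped, which
  keeps 0 out of the basis.\<close>

lemma orthogonal_basis:
  assumes "finite B"
  obtains C where "finite C" "pairwise (\<lambda>x y. ip x y = 0) C" "0 \<notin> C" "span C = span B"
  using assms
proof (induction B arbitrary: thesis)
  case empty
  then show ?case by (metis empty_iff finite.emptyI pairwise_empty)
next
  case (insert b B)
  obtain C where C: "finite C" "pairwise (\<lambda>x y. ip x y = 0) C" "0 \<notin> C" "span C = span B"
    using insert.IH by blast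
  define s where "s = (\<Sum>d\<in>C. scale (ip d b / ip d d) d)"
  have orth: "ip c (b - s) = 0" if "c \<in> C" for c
    using subtract_components_orthogonal[OF C(1-3) that] by (simp add: s_def)
  have s: "s \<in> span C"
    unfolding s_def by (intro span_sum span_scale span_base)
  have span_b: "span (insert b C) = span (insert b B)"
    using C(4) by (simp add: span_insert)
  show ?case
  proof (cases "b = s")
    case True
    then have "span (insert b C) = span C" using s by (simp add: span_redundant)
    then show ?thesis using insert.prems C span_b by metis
  next
    case False
    have "span (insert (b - s) C) = span (insert b C)"
      by (rule eq_span_insert_eq) (use span_neg[OF s] in simp)
    moreover have "pairwise (\<lambda>x y. ip x y = 0) (insert (b - s) C)"
      unfolding pairwise_insert using C(2) orth orth[THEN ip_eq_0_commute[THEN iffD1]] by blast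
    moreover have "0 \<notin> insert (b - s) C" using C(3) False by simp
    ultimately show ?thesis
      using insert.prems[of "insert (b - s) C"] C(1) span_b by simp
  qed
qed

lemma subspace_orthogonal_basis:
  assumes "subspace U"
  obtains C where "finite C" "pairwise (\<lambda>x y. ip x y = 0) C" "0 \<notin> C" "span C = U"
proof -
  obtain B where B: "B \<subseteq> U" "independent B" "U \<subseteq> span B"
    using basis_exists[of U] by metis
  obtain B0 where B0: "finite B0" "span B0 = UNIV" using finite_dimensional by blast
  have "finite B" using independent_span_bound[OF B0(1) B(2)] B0(2) by simp
  moreover have "span B = U" using B(1,3) assms span_minimal by (metis subset_antisym)
  ultimately show thesis using orthogonal_basis that by metis
qed

lemma orth_proj_eqI:
  assumes "subspace U" "u \<in> U" "\<And>w. w \<in> U \<Longrightarrow> ip w (v - u) = 0"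
  shows "orth_proj U v = u"
  unfolding orth_proj_def
proof (rule the_equality)
  fix u' assume u': "u' \<in> U \<and> (\<forall>w\<in>U. ip w (v - u') = 0)"
  have "u - u' \<in> U" using u' assms subspace_diff by blast
  then have "ip (u - u') (v - u') = 0" "ip (u - u') (v - u) = 0" using u' assms by auto
  then have "ip (u - u') (u - u') = 0" by (simp add: ip_diff)
  then show "u' = u" using ip_definite[of "u - u'"] by simp
qed (use assms in auto)

lemma
  assumes "subspace U"
  shows orth_proj_mem [simp, intro]: "orth_proj U v \<in> U"
    and orth_proj_orthogonal: "w \<in> U \<Longrightarrow> ip w (v - orth_proj U v) = 0"
proof -
  obtain C where C: "finite C" "pairwise (\<lambda>x y. ip x y = 0) C" "0 \<notin> C" "span C = U"
    using subspace_orthogonal_basis[OF assms] by metis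
  define s where "s = (\<Sum>d\<in>C. scale (ip d v / ip d d) d)"
  have s: "s \<in> U"
    unfolding s_def C(4)[symmetric] by (intro span_sum span_scale span_base)
  have orth: "ip w (v - s) = 0" if "w \<in> U" for w
    using orthogonal_span[of w C "v - s"] subtract_components_orthogonal[OF C(1-3)] that C(4)
    by (simp add: s_def)
  have "orth_proj U v = s" by (rule orth_proj_eqI[OF assms s orth])
  then show "orth_proj U v \<in> U" "w \<in> U \<Longrightarrow> ip w (v - orth_proj U v) = 0"
    using s orth by auto
qed

lemma orth_proj_id: "subspace U \<Longrightarrow> v \<in> U \<Longrightarrow> orth_proj U v = v"
  by (rule orth_proj_eqI) auto

lemma orth_proj_add:
  assumes "subspace U" shows "orth_proj U (v + w) = orth_proj U v + orth_proj U w"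
proof (rule orth_proj_eqI[OF assms])
  fix x assume "x \<in> U"
  then show "ip x (v + w - (orth_proj U v + orth_proj U w)) = 0"
    using orth_proj_orthogonal[OF assms] by (metis add_diff_add ip_add add_0)
qed (use assms subspace_add in auto)

lemma orth_proj_scale:
  assumes "subspace U" shows "orth_proj U (scale c v) = scale c (orth_proj U v)"
proof (rule orth_proj_eqI[OF assms])
  fix x assume "x \<in> U"
  then show "ip x (scale c v - scale c (orth_proj U v)) = 0"
    using orth_proj_orthogonal[OF assms] by (metis scale_right_diff_distrib ip_scale mult_zero_right)
qed (use assms subspace_scale in auto)

lemma orth_proj_ip: assumes "subspace U" shows "ip (orth_proj U x) y = ip x (orth_proj U y)"
proof -
  have *: "ip (orth_proj U x) y = ip (orth_proj U x) (orth_proj U y)" for x y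
    using orth_proj_orthogonal[OF assms, of "orth_proj U x" y] assms by (simp add: ip_diff)
  show ?thesis by (metis * ip_commute)
qed

lemma linearI:
  "(\<And>x y. T (x + y) = T x + T y) \<Longrightarrow> (\<And>c x. T (scale c x) = scale c (T x)) \<Longrightarrow>
    Vector_Spaces.linear scale scale T"
  by unfold_locales auto

lemma adjoint_eqI:
  assumes "\<And>x y. ip (T x) y = ip x (S y)" shows "adj T = S"
  unfolding adj_def
proof (rule the_equality)
  fix S' assume S': "\<forall>x y. ip (T x) y = ip x (S' y)"
  show "S' = S"
    by (rule ext, rule ip_eqI) (use S' assms in metis)
qed (use assms in blast)

lemma adjoint_works:
  assumes "Vector_Spaces.linear scale scale T" shows "ip (T x) y = ip x (adj T y)"
proof -
  interpret T: Vector_Spaces.linear scale scale T by fact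
  obtain C where C: "finite C" "pairwise (\<lambda>x y. ip x y = 0) C" "0 \<notin> C" "span C = UNIV"
    using subspace_orthogonal_basis[OF subspace_UNIV] by metis
  have expand: "x = (\<Sum>c\<in>C. scale (ip c x / ip c c) c)" for x
  proof -
    let ?z = "x - (\<Sum>c\<in>C. scale (ip c x / ip c c) c)"
    have "ip ?z ?z = 0"
      by (rule orthogonal_span[of _ C]) (simp_all only: C(4) UNIV_I subtract_components_orthogonal[OF C(1-3)])
    then show ?thesis using ip_definite[of ?z] by simp
  qed
  \<comment> \<open>Forced by expanding x in the orthogonal basis C and moving the coefficients to
    the other side; this is the existence proof behind the definite description in
    \<open>adj\<close>.\<close>
  define S where "S y = (\<Sum>c\<in>C. scale (ip (T c) y / ip c c) c)" for y
  have real: "conjugate (ip c c) = ip c c" for c by (metis ip_commute)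
  have conj_div: "conjugate (a / b) = conjugate a / conjugate b" for a b :: 'a
    by (metis (no_types, lifting) conjugate_dist_mul conjugate_zero conjugate_zero_iff div_by_0
        nonzero_eq_divide_eq)
  have adj: "ip (T x) y = ip x (S y)" for x y
  proof -
    have "ip (T x) y = ip (T (\<Sum>c\<in>C. scale (ip c x / ip c c) c)) y"
      by (subst expand[of x]) (rule refl)
    also have "\<dots> = (\<Sum>c\<in>C. conjugate (ip c x / ip c c) * ip (T c) y)"
      by (simp only: T.sum T.scale ip_sum ip_scale_left)
    also have "\<dots> = (\<Sum>c\<in>C. ip (T c) y / ip c c * ip x c)"
      by (simp add: conj_div real mult.commute flip: ip_commute[of x])
    also have "\<dots> = ip x (S y)"
      by (simp only: S_def ip_sum ip_scale)
    finally show ?thesis .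
  qed
  then show ?thesis using adjoint_eqI[of T S] by simp
qed

end

section \<open>Symmetries of equi-isoclinic subspaces\<close>

context rc_hilbert_space
begin

text \<open>Carrying the inverse as a second operator keeps the definite description
  \<open>adj\<close> out of all compositions and inverses below.\<close>

definition unitary_pair :: "('e \<Rightarrow> 'e) \<Rightarrow> ('e \<Rightarrow> 'e) \<Rightarrow> bool" where
  "unitary_pair T S \<longleftrightarrow> Vector_Spaces.linear scale scale T \<and> Vector_Spaces.linear scale scale S \<and>
     (\<forall>x y. ip (T x) y = ip x (S y)) \<and> (\<forall>x. S (T x) = x) \<and> (\<forall>x. T (S x) = x)"

lemma unitary_pair_imp: "unitary_pair T S \<Longrightarrow> unitary_op T \<and> adj T = S"
  using adjoint_eqI[of T S] by (auto simp: unitary_pair_def unitary_op_def)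

lemma unitary_op_imp_pair: assumes "unitary_op T" shows "unitary_pair T (adj T)"
proof -
  have T: "Vector_Spaces.linear scale scale T" "\<And>x. adj T (T x) = x" "\<And>x. T (adj T x) = x"
    using assms by (auto simp: unitary_op_def fun_eq_iff)
  have adj: "ip (T x) y = ip x (adj T y)" for x y by (rule adjoint_works[OF T(1)])
  have "Vector_Spaces.linear scale scale (adj T)"
  proof (rule linearI)
    fix x y c
    show "adj T (x + y) = adj T x + adj T y"
      by (rule ip_eqI) (simp add: ip_add flip: adj)
    show "adj T (scale c x) = scale c (adj T x)"
      by (rule ip_eqI) (simp add: ip_scale flip: adj)
  qed
  then show ?thesis using T adj by (simp add: unitary_pair_def)
qed

lemma unitary_pair_comp:
  assumes "unitary_pair T S" "unitary_pair T' S'"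
  shows "unitary_pair (\<lambda>x. T (T' x)) (\<lambda>x. S' (S x))"
proof -
  have *: "Vector_Spaces.linear scale scale (\<lambda>x. f (g x))"
    if "Vector_Spaces.linear scale scale f" "Vector_Spaces.linear scale scale g" for f g
    using Vector_Spaces.linear_compose[OF that(2,1)] by (simp add: o_def)
  have "Vector_Spaces.linear scale scale (\<lambda>x. T (T' x))" "Vector_Spaces.linear scale scale (\<lambda>x. S' (S x))"
    using assms by (auto simp: unitary_pair_def intro: *)
  with assms show ?thesis by (simp add: unitary_pair_def)
qed

lemma unitary_pair_id: "unitary_pair (\<lambda>x. x) (\<lambda>x. x)"
  by (auto simp: unitary_pair_def intro: linearI)

lemma unitary_pair_sym: assumes "unitary_pair T S" shows "unitary_pair S T"
proof -
  have "ip (S x) y = ip x (T y)" for x y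
    using assms unfolding unitary_pair_def by metis
  then show ?thesis using assms by (simp add: unitary_pair_def)
qed

lemma symmetries_iff:
  "p \<in> symmetries n U \<longleftrightarrow> p permutes {1..n} \<and>
    (\<exists>T S. unitary_pair T S \<and> (\<forall>i\<in>{1..n}. \<forall>x. orth_proj (U (p i)) x = T (orth_proj (U i) (S x))))"
proof -
  have "(\<exists>T. unitary_op T \<and> (\<forall>i\<in>{1..n}. orth_proj (U (p i)) = T \<circ> orth_proj (U i) \<circ> adj T)) \<longleftrightarrow>
     (\<exists>T S. unitary_pair T S \<and> (\<forall>i\<in>{1..n}. \<forall>x. orth_proj (U (p i)) x = T (orth_proj (U i) (S x))))"
    (is "?L \<longleftrightarrow> ?R")
  proof
    show "?L \<Longrightarrow> ?R" using unitary_op_imp_pair by (metis comp_apply)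
    assume ?R
    then obtain T S where T: "unitary_pair T S"
      "\<forall>i\<in>{1..n}. \<forall>x. orth_proj (U (p i)) x = T (orth_proj (U i) (S x))" by blast
    from T show ?L by (intro exI[of _ T]) (simp add: unitary_pair_imp fun_eq_iff)
  qed
  then show ?thesis by (simp add: symmetries_def)
qed

definition reflection :: "'e set \<Rightarrow> 'e \<Rightarrow> 'e" where
  "reflection U x = orth_proj U x + orth_proj U x - x"

lemma reflection_linear: assumes "subspace U" shows "Vector_Spaces.linear scale scale (reflection U)"
  by (rule linearI)
    (simp_all add: reflection_def assms orth_proj_add orth_proj_scale scale_right_distrib scale_right_diff_distrib)

lemma reflection_involution: assumes "subspace U" shows "reflection U (reflection U x) = x"
proof -
  interpret R: Vector_Spaces.linear scale scale "reflection U" by (rule reflection_linear[OF assms])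
  have "reflection U (orth_proj U x) = orth_proj U x"
    by (simp add: reflection_def orth_proj_id assms)
  then have "reflection U (orth_proj U x + orth_proj U x - x) = orth_proj U x + orth_proj U x - reflection U x"
    by (simp add: R.add R.diff)
  then show ?thesis by (simp add: reflection_def[of U x])
qed

lemma reflection_ip: assumes "subspace U" shows "ip (reflection U x) y = ip x (reflection U y)"
  by (simp add: reflection_def ip_add ip_add_left ip_diff orth_proj_ip assms)

lemma double: "x + x = scale 2 x"
  by (metis one_add_one scale_left_distrib scale_one)

lemma double_cancel: "x + x = y + y \<Longrightarrow> x = (y :: 'e)"
  by (simp add: double)

text \<open>As T S = 1, conjugating 2 P - 1 gives 2 T P S - 1, and the factor 2 cancels. With the
  converse below, symmetries can be checked on reflections.\<close>

lemma reflection_conjugate: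
  assumes "unitary_pair T S" and "\<And>x. T (reflection U (S x)) = reflection V x"
  shows "orth_proj V x = T (orth_proj U (S x))"
proof -
  interpret T: Vector_Spaces.linear scale scale T using assms(1) by (simp add: unitary_pair_def)
  have "T (S x) = x" using assms(1) by (simp add: unitary_pair_def)
  then have "orth_proj V x + orth_proj V x = T (orth_proj U (S x)) + T (orth_proj U (S x))"
    using assms(2)[of x] by (simp add: reflection_def T.add T.diff)
  then show ?thesis by (rule double_cancel)
qed

lemma reflection_conjugateD:
  assumes "unitary_pair T S" and "\<And>x. orth_proj V x = T (orth_proj U (S x))"
  shows "T (reflection U (S x)) = reflection V x"
proof -
  interpret T: Vector_Spaces.linear scale scale T using assms(1) by (simp add: unitary_pair_def)
  have "T (S x) = x" using assms(1) by (simp add: unitary_pair_def)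
  then show ?thesis
    by (simp add: reflection_def T.add T.diff assms(2))
qed

end

text \<open>Keeps only the algebra of the reflections. The square of \<open>R a - R b\<close> is 2 -
  c, so \<open>c_less\<close> is what makes this difference a nonzero multiple of a unitary.\<close>

locale clifford_family = rc_hilbert_space scale ip
  for scale :: "'a::rc_field \<Rightarrow> 'e::ab_group_add \<Rightarrow> 'e" and ip +
  fixes I :: "'i set" and R :: "'i \<Rightarrow> 'e \<Rightarrow> 'e" and c :: real
  assumes finite_I: "finite I"
    and R_linear: "i \<in> I \<Longrightarrow> Vector_Spaces.linear scale scale (R i)"
    and R_selfadjoint: "i \<in> I \<Longrightarrow> ip (R i x) y = ip x (R i y)"
    and R_involution: "i \<in> I \<Longrightarrow> R i (R i x) = x"
    and R_anticomm: "i \<in> I \<Longrightarrow> j \<in> I \<Longrightarrow> i \<noteq> j \<Longrightarrow> R i (R j x) + R j (R i x) = scale (of_real c) x"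
    and c_less: "c < 2"
begin

lemma
  assumes "i \<in> I"
  shows R_diff: "R i (x - y) = R i x - R i y"
    and R_scale: "R i (scale k x) = scale k (R i x)"
    and R_neg: "R i (- x) = - R i x"
proof -
  interpret Ri: Vector_Spaces.linear scale scale "R i" by (rule R_linear[OF assms])
  show "R i (x - y) = R i x - R i y" "R i (scale k x) = scale k (R i x)" "R i (- x) = - R i x"
    by (rule Ri.diff Ri.scale Ri.neg)+
qed

text \<open>The operators \<open>R a\<close> span a quadratic space, and conjugation by \<open>R a - R b\<close> is minus the reflection
  exchanging \<open>R a\<close> and \<open>R b\<close>.\<close>

lemma transposition_unitary:
  assumes ab: "a \<in> I" "b \<in> I" "a \<noteq> b"
  shows "\<exists>T. unitary_pair T T \<and> (\<forall>i\<in>I. \<forall>x. T (R i (T x)) = - R (Transposition.transpose a b i) x)"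
proof -
  \<comment> \<open>Normalisation: q (R a - R b) squares to q^2 (2 - c) = 1.\<close>
  define q :: 'a where "q = of_real (1 / sqrt (2 - c))"
  have qq: "q * q * (2 - of_real c) = 1"
  proof -
    have "q * q * (2 - of_real c) = of_real (1 / sqrt (2 - c) * (1 / sqrt (2 - c)) * (2 - c))"
      by (simp only: q_def of_real_mult of_real_diff of_real_numeral)
    also have "1 / sqrt (2 - c) * (1 / sqrt (2 - c)) * (2 - c) = 1"
      using c_less by simp
    finally show ?thesis by simp
  qed
  define D where "D x = R a x - R b x" for x
  define T where "T x = scale q (D x)" for x
  have RbRa: "R b (R a x) = scale (of_real c) x - R a (R b x)" for x
    using R_anticomm[OF ab, of x] by (simp add: eq_diff_eq add.commute)
  have D_scale: "D (scale k x) = scale k (D x)" for k x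
    by (simp add: D_def R_scale ab scale_right_diff_distrib)
  have DD: "D (D x) = scale (2 - of_real c) x" for x
  proof -
    have "D (D x) = x + x - scale (of_real c) x"
      by (simp add: D_def R_diff ab R_involution RbRa)
    also have "x + x = scale 2 x" by (rule double)
    finally show ?thesis by (simp add: scale_left_diff_distrib)
  qed
  have TT: "T (T x) = x" for x
    using qq by (simp add: T_def D_scale DD mult.assoc)
  have lin: "Vector_Spaces.linear scale scale T"
  proof (rule linearI)
    fix x y k
    have "R i (x + y) = R i x + R i y" if "i \<in> I" for i
      using R_diff[OF that, of x "- y"] R_neg[OF that, of y] by simp
    then show "T (x + y) = T x + T y" using ab by (simp add: T_def D_def flip: scale_right_distrib)
    show "T (scale k x) = scale k (T x)" by (simp add: T_def D_scale mult.commute)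
  qed
  have conj_q: "conjugate q = q" by (simp add: q_def del: of_real_divide)
  have "ip (T x) y = ip x (T y)" for x y
    by (simp add: T_def D_def ip_scale ip_scale_left ip_diff R_selfadjoint ab conj_q)
  with lin TT have "unitary_pair T T" by (simp add: unitary_pair_def)
  moreover have "T (R i (T x)) = - R (Transposition.transpose a b i) x" if i: "i \<in> I" for i x
  proof -
    have "D (R i (D x)) = - scale (2 - of_real c) (R (Transposition.transpose a b i) x)"
    proof -
      consider "i = a" | "i = b" | "i \<noteq> a" "i \<noteq> b" by blast
      then show ?thesis
      proof cases
        case 1
        have "D (R a (D x)) = R a x - R b x - (R b x - R b (R a (R b x)))"
          by (simp add: D_def R_diff ab R_involution)
        also have "\<dots> = - (R b x + R b x - scale (of_real c) (R b x))"
          by (simp add: RbRa R_involution ab)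
        also have "R b x + R b x = scale 2 (R b x)" by (rule double)
        finally show ?thesis using 1 by (simp add: scale_left_diff_distrib)
      next
        case 2
        have RaRb: "R a (R b x) = scale (of_real c) x - R b (R a x)" for x
          by (simp add: RbRa)
        have "D (R b (D x)) = R a (R b (R a x)) - R a x - (R a x - R b x)"
          by (simp add: D_def R_diff ab R_involution)
        also have "\<dots> = - (R a x + R a x - scale (of_real c) (R a x))"
          by (simp only: RaRb R_involution ab) simp
        also have "R a x + R a x = scale 2 (R a x)" by (rule double)
        finally show ?thesis using 2 by (simp add: scale_left_diff_distrib)
      next
        \<comment> \<open>The constants c of the two anticommutators cancel in the difference, so D
          anticommutes with \<open>R i\<close>.\<close>
        case 3
        have ac: "R a (R i x) = scale (of_real c) x - R i (R a x)"
          "R b (R i x) = scale (of_real c) x - R i (R b x)" for x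
          using R_anticomm[of a i x] R_anticomm[of b i x] 3 i ab by (simp_all add: eq_diff_eq)
        have "D (R i y) = - R i (D y)" for y
          by (simp add: D_def ac R_diff i)
        then have "D (R i (D x)) = - R i (D (D x))" by simp
        then show ?thesis using 3 i by (simp add: DD R_scale)
      qed
    qed
    then have "T (R i (T x)) = - scale (q * q * (2 - of_real c)) (R (Transposition.transpose a b i) x)"
      by (simp add: T_def R_scale i D_scale mult.assoc)
    then show ?thesis using qq by simp
  qed
  ultimately show ?thesis by blast
qed

text \<open>Each transposition in a factorisation of p contributes one factor -1, so the total sign
  is the sign of p. For odd p the unitary therefore carries the subspaces to the orthogonal
  complements of the permuted ones when \<open>R\<close> consists of reflections.\<close>

lemma permutation_unitary:
  assumes "p permutes I"
  shows "\<exists>T S. unitary_pair T S \<and>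
    (\<forall>i\<in>I. \<forall>x. T (R i (S x)) = (if evenperm p then R (p i) x else - R (p i) x))"
  using assms finite_I
proof (induction rule: permutes_induct)
  case id
  then show ?case using unitary_pair_id by fastforce
next
  case (swap a b p)
  obtain T S where T: "unitary_pair T S"
    "\<And>i x. i \<in> I \<Longrightarrow> T (R i (S x)) = (if evenperm p then R (p i) x else - R (p i) x)"
    using swap.IH by blast
  obtain V where V: "unitary_pair V V"
      "\<And>i x. i \<in> I \<Longrightarrow> V (R i (V x)) = - R (Transposition.transpose a b i) x"
    using transposition_unitary[of a b] swap by blast
  interpret V: Vector_Spaces.linear scale scale V using V(1) by (simp add: unitary_pair_def)
  have perm: "permutation p" using swap finite_I permutation_permutes by blast
  have "V (T (R i (S (V x)))) =
     (if evenperm (Transposition.transpose a b \<circ> p) then R ((Transposition.transpose a b \<circ> p) i) x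
      else - R ((Transposition.transpose a b \<circ> p) i) x)" if "i \<in> I" for i x
    using T(2)[OF that, of "V x"] V(2)[of "p i" x] permutes_in_image[of p I i] that perm swap
    by (simp add: evenperm_comp permutation_swap_id evenperm_swap V.neg)
  then show ?case using unitary_pair_comp[OF V(1) T(1)] by blast
qed

end

section \<open>Symmetry groups of subspaces whose reflections form a Clifford family\<close>

context rc_hilbert_space
begin

lemma even_permutation_symmetry:
  assumes cl: "clifford_family scale ip {1..n} (\<lambda>i. reflection (U i)) c"
    and p: "p permutes {1..n}" "evenperm p"
  shows "p \<in> symmetries n U"
proof -
  interpret clifford_family scale ip "{1..n}" "\<lambda>i. reflection (U i)" c by fact
  obtain T S where T: "unitary_pair T S"
    "\<And>i x. i \<in> {1..n} \<Longrightarrow> T (reflection (U i) (S x)) = reflection (U (p i)) x"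
    using permutation_unitary[OF p(1)] p(2) by auto
  show ?thesis unfolding symmetries_iff using p(1) T reflection_conjugate[OF T(1)] by blast
qed

text \<open>For odd p the unitary of \<open>permutation_unitary\<close> has the wrong sign, and
  composing it with K repairs this.\<close>

lemma total_symmetryI:
  assumes cl: "clifford_family scale ip {1..n} (\<lambda>i. reflection (U i)) c"
    and K: "unitary_pair K K'" "\<And>i x. i \<in> {1..n} \<Longrightarrow> K (reflection (U i) (K' x)) = - reflection (U i) x"
  shows "total_symmetry n U"
proof -
  interpret clifford_family scale ip "{1..n}" "\<lambda>i. reflection (U i)" c by fact
  interpret K: Vector_Spaces.linear scale scale K using K(1) by (simp add: unitary_pair_def)
  have "p \<in> symmetries n U" if p: "p permutes {1..n}" for p
  proof (cases "evenperm p")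
    case True
    then show ?thesis using even_permutation_symmetry[OF cl p] by blast
  next
    case False
    obtain T S where T: "unitary_pair T S"
      "\<And>i x. i \<in> {1..n} \<Longrightarrow> T (reflection (U i) (S x)) = - reflection (U (p i)) x"
      using permutation_unitary[OF p(1)] False by auto
    have "K (T (reflection (U i) (S (K' x)))) = reflection (U (p i)) x" if "i \<in> {1..n}" for i x
      using T(2)[OF that] K(2)[of "p i" x] permutes_in_image[OF p, of i] that by (simp add: K.neg)
    then show ?thesis unfolding symmetries_iff
      using p unitary_pair_comp[OF K(1) T(1)] reflection_conjugate[OF unitary_pair_comp[OF K(1) T(1)]]
      by blast
  qed
  then show ?thesis by (auto simp: total_symmetry_def symmetries_def)
qed

text \<open>An odd symmetry p has two unitaries: V, which permutes the reflections, and T, which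
  permutes and negates them. The inverse of T after V fixes the indices and negates every
  reflection, which is the K required by \<open>total_symmetryI\<close>.\<close>

lemma alternating_or_total:
  assumes cl: "clifford_family scale ip {1..n} (\<lambda>i. reflection (U i)) c"
  shows "alternating_symmetry n U \<or> total_symmetry n U"
proof (cases "\<exists>p\<in>symmetries n U. \<not> evenperm p")
  case False
  moreover have "symmetries n U \<subseteq> {p. p permutes {1..n}}" by (auto simp: symmetries_def)
  ultimately have "symmetries n U = {p. p permutes {1..n} \<and> evenperm p}"
    using even_permutation_symmetry[OF cl] by blast
  then show ?thesis by (simp add: alternating_symmetry_def)
next
  case True
  interpret clifford_family scale ip "{1..n}" "\<lambda>i. reflection (U i)" c by fact
  obtain p where p: "p permutes {1..n}" "\<not> evenperm p" "p \<in> symmetries n U"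
    using True by (auto simp: symmetries_def)
  obtain V W where V: "unitary_pair V W"
    "\<And>i x. i \<in> {1..n} \<Longrightarrow> orth_proj (U (p i)) x = V (orth_proj (U i) (W x))"
    using p(3) unfolding symmetries_iff by blast
  obtain T S where T: "unitary_pair T S"
      "\<And>i x. i \<in> {1..n} \<Longrightarrow> T (reflection (U i) (S x)) = - reflection (U (p i)) x"
    using permutation_unitary[OF p(1)] p(2) by auto
  interpret S: Vector_Spaces.linear scale scale S using T(1) by (simp add: unitary_pair_def)
  have "S (V (reflection (U i) (W (T x)))) = - reflection (U i) x" if i: "i \<in> {1..n}" for i x
  proof -
    have "V (reflection (U i) (W (T x))) = reflection (U (p i)) (T x)"
      using reflection_conjugateD[OF V] i by blast
    also have "\<dots> = - T (reflection (U i) x)"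
      using T(2)[OF i, of "T x"] T(1) by (simp add: unitary_pair_def)
    finally show ?thesis using T(1) by (simp add: S.neg unitary_pair_def)
  qed
  then show ?thesis
    using total_symmetryI[OF cl unitary_pair_comp[OF unitary_pair_sym[OF T(1)] V(1)]] by blast
qed

end

section \<open>Equi-isoclinic subspaces of half the dimension\<close>

context rc_hilbert_space
begin

text \<open>Pythagoras, with the squared length of the projection of x to W read off from P Q P = s
  P. Its two uses: s = 1 forces V = W, and positivity forces s to be at most 1.\<close>

lemma isoclinic_distance:
  assumes V: "subspace V" and W: "subspace W"
    and PQP: "\<And>x. orth_proj V (orth_proj W (orth_proj V x)) = scale (of_real s) (orth_proj V x)"
    and x: "x \<in> V"
  shows "ip (x - orth_proj W x) (x - orth_proj W x) = of_real (1 - s) * ip x x"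
proof -
  have Px: "orth_proj V x = x" by (rule orth_proj_id[OF V x])
  have "ip (x - orth_proj W x) (x - orth_proj W x) = ip x x - ip x (orth_proj W x)"
    using orth_proj_orthogonal[OF W orth_proj_mem[OF W], of x x] by (simp add: ip_diff)
  also have "ip x (orth_proj W x) = ip x (orth_proj V (orth_proj W (orth_proj V x)))"
    using orth_proj_ip[OF V, of x "orth_proj W x"] by (simp add: Px)
  also have "\<dots> = of_real s * ip x x" using PQP[of x] by (simp add: Px ip_scale)
  finally show ?thesis by (simp add: left_diff_distrib)
qed

lemma isoclinic_projections_eq:
  assumes V: "subspace V" and W: "subspace W"
    and "\<And>x. orth_proj V (orth_proj W (orth_proj V x)) = orth_proj V x"
    and "\<And>x. orth_proj W (orth_proj V (orth_proj W x)) = orth_proj W x"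
  shows "V = W"
proof -
  have "x \<in> W" if "subspace V" "subspace W"
      "\<And>x. orth_proj V (orth_proj W (orth_proj V x)) = orth_proj V x" "x \<in> V" for V W x
  proof -
    have "ip (x - orth_proj W x) (x - orth_proj W x) = 0"
      using isoclinic_distance[of V W 1 x] that by simp
    then have "x - orth_proj W x = 0" by (rule ip_definite)
    then show ?thesis using orth_proj_mem[OF that(2), of x] by simp
  qed
  then show ?thesis using assms by blast
qed

lemma isoclinic_le_one:
  assumes V: "subspace V" and W: "subspace W"
    and PQP: "\<And>x. orth_proj V (orth_proj W (orth_proj V x)) = scale (of_real s) (orth_proj V x)"
    and x: "x \<in> V" "x \<noteq> 0"
  shows "s \<le> 1"
proof -
  define t where "t = norm (ip x x)"
  have t: "ip x x = of_real t" using nonneg_eq_norm[OF ip_nonneg] by (simp add: t_def of_real_def)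
  have "t > 0" using x(2) ip_definite by (auto simp: t_def)
  have "0 \<le> ip (x - orth_proj W x) (x - orth_proj W x)" by (rule ip_nonneg)
  also have "\<dots> = of_real ((1 - s) * t)"
    unfolding isoclinic_distance[OF V W PQP x(1)] t by simp
  finally have "0 \<le> (1 - s) * t" by (simp del: of_real_mult)
  with \<open>t > 0\<close> show ?thesis by (simp add: zero_le_mult_iff)
qed

lemma complementary_dim:
  assumes V: "subspace V" and W: "subspace W" and int: "V \<inter> W = {0}"
    and dims: "dim V + dim W = dim (UNIV :: 'e set)"
  shows "\<exists>v\<in>V. \<exists>w\<in>W. x = v + w"
proof -
  obtain B where B: "independent B" "UNIV \<subseteq> span B"
    using basis_exists[of UNIV] by metis
  obtain B0 where B0: "finite B0" "span B0 = UNIV" using finite_dimensional by blast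
  have "finite B" using independent_span_bound[OF B0(1) B(1)] B0(2) by simp
  then interpret finite_dimensional_vector_space scale B
    by unfold_locales (use B in auto)
  have "dim (V \<inter> W) = 0" unfolding int using dim_eq_0 by blast
  then have "dim {v + w |v w. v \<in> V \<and> w \<in> W} = dim (UNIV :: 'e set)"
    using dim_sums_Int[OF V W] dims by linarith
  then have "{v + w |v w. v \<in> V \<and> w \<in> W} = UNIV"
    using subspace_dim_equal[OF subspace_sums[OF V W] subspace_UNIV] by simp
  then show ?thesis by blast
qed

text \<open>Write P, Q for the projections. For v in V, (P - Q)^2 v = v + Q v - P Q v - Q v, and P Q
  v = s v, which leaves (1 - s) v; the same holds on W. As s differs from 1, V and W meet in 0 and,
  by dimension, span the space. The anticommutator is 2 - 4 (P - Q)^2.\<close>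

lemma isoclinic_clifford:
  assumes V: "subspace V" and W: "subspace W"
    and PQP: "\<And>x. orth_proj V (orth_proj W (orth_proj V x)) = scale (of_real s) (orth_proj V x)"
    and QPQ: "\<And>x. orth_proj W (orth_proj V (orth_proj W x)) = scale (of_real s) (orth_proj W x)"
    and dims: "dim V + dim W = dim (UNIV :: 'e set)" and s: "s \<noteq> 1"
  shows "reflection V (reflection W x) + reflection W (reflection V x) = scale (of_real (4 * s - 2)) x"
proof -
  let ?P = "orth_proj V" and ?Q = "orth_proj W"
  note add = orth_proj_add[OF V] orth_proj_add[OF W]
  note id = orth_proj_id[OF V] orth_proj_id[OF W]
  note idem = id(1)[OF orth_proj_mem[OF V]] id(2)[OF orth_proj_mem[OF W]]
  have "v = 0" if v: "v \<in> V \<inter> W" for v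
  proof -
    have "v = scale (of_real s) v" using PQP[of v] v id by simp
    then have "scale (of_real s) v = scale 1 v" by simp
    moreover have "of_real s \<noteq> (1::'a)" using s by simp
    ultimately show ?thesis using scale_right_imp_eq by blast
  qed
  then have int: "V \<inter> W = {0}" using subspace_0[OF V] subspace_0[OF W] by blast
  obtain v w where vw: "v \<in> V" "w \<in> W" "x = v + w"
    using complementary_dim[OF V W int dims] by blast
  have v: "?P v + ?Q v - ?P (?Q v) - ?Q (?P v) = scale (of_real (1 - s)) v"
    using PQP[of v] vw(1) id by (simp add: scale_left_diff_distrib)
  have w: "?P w + ?Q w - ?P (?Q w) - ?Q (?P w) = scale (of_real (1 - s)) w"
    using QPQ[of w] vw(2) id by (simp add: scale_left_diff_distrib)
  \<comment> \<open>This is (P - Q)^2 x multiplied out.\<close>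
  define y where "y = ?P x + ?Q x - ?P (?Q x) - ?Q (?P x)"
  have y: "y = scale (of_real (1 - s)) x"
    unfolding vw(3) y_def scale_right_distrib v[symmetric] w[symmetric] by (simp add: add)
  have diff: "?P (a - b) = ?P a - ?P b" "?Q (a - b) = ?Q a - ?Q b" for a b
    using add(1)[of "a - b" b] add(2)[of "a - b" b] by (simp_all add: eq_diff_eq)
  have "reflection V (reflection W x) + reflection W (reflection V x) = (x + x) - ((y + y) + (y + y))"
    by (simp add: reflection_def add diff y_def)
  also have "\<dots> = scale 2 x - scale (2 * 2) y"
    by (simp only: double flip: scale_scale)
  also have "\<dots> = scale (2 - 2 * 2 * of_real (1 - s)) x"
    by (simp only: y scale_scale scale_left_diff_distrib)
  also have "2 - 2 * 2 * of_real (1 - s) = (of_real (4 * s - 2) :: 'a)"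
    by simp
  finally show ?thesis .
qed

lemma constant_total_symmetry:
  assumes "\<And>i j. i \<in> {1..n} \<Longrightarrow> j \<in> {1..n} \<Longrightarrow> U i = U j"
  shows "total_symmetry n U"
proof -
  have "p \<in> symmetries n U" if "p permutes {1..n}" for p
    unfolding symmetries_iff using that unitary_pair_id permutes_in_image[OF that] assms by metis
  then show ?thesis by (auto simp: total_symmetry_def symmetries_def)
qed

lemma eitff_cases:
  assumes eitff: "eitff (2 * r) r n U" and r: "0 < r"
  obtains c where "clifford_family scale ip {1..n} (\<lambda>i. reflection (U i)) c"
  | "\<And>i j. i \<in> {1..n} \<Longrightarrow> j \<in> {1..n} \<Longrightarrow> U i = U j"
proof -
  have n: "2 \<le> n" and dimE: "dim (UNIV :: 'e set) = 2 * r"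
    and U: "\<And>i. i \<in> {1..n} \<Longrightarrow> subspace (U i)" and dimU: "\<And>i. i \<in> {1..n} \<Longrightarrow> dim (U i) = r"
    using eitff by (auto simp: eitff_def)
  obtain \<sigma> where \<sigma>: "\<And>i j x. i \<in> {1..n} \<Longrightarrow> j \<in> {1..n} \<Longrightarrow> i \<noteq> j \<Longrightarrow>
      orth_proj (U i) (orth_proj (U j) (orth_proj (U i) x)) = scale (of_real (\<sigma>\<^sup>2)) (orth_proj (U i) x)"
    using eitff unfolding eitff_def equi_isoclinic_def by (metis comp_apply)
  show thesis
  proof (cases "\<sigma>\<^sup>2 = 1")
    case True
    have "U i = U j" if "i \<in> {1..n}" "j \<in> {1..n}" for i j
      using isoclinic_projections_eq[of "U i" "U j"] \<sigma>[of i j] \<sigma>[of j i] U that True by fastforce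
    then show thesis by (rule that(2))
  next
    case False
    show thesis
    proof (rule that(1), intro clifford_family.intro rc_hilbert_space_axioms clifford_family_axioms.intro)
      fix i j x assume ij: "i \<in> {1..n}" "j \<in> {1..n}" "i \<noteq> j"
      show "reflection (U i) (reflection (U j) x) + reflection (U j) (reflection (U i) x) =
          scale (of_real (4 * \<sigma>\<^sup>2 - 2)) x"
        using \<sigma>[OF ij] \<sigma>[of j i] ij dimU dimE False by (intro isoclinic_clifford U) auto
    next
      have 1: "1 \<in> {1..n}" and 2: "2 \<in> {1..n}" using n by auto
      \<comment> \<open>The bound c < 2 needs \<sigma>^2 at most 1, which comes from a nonzero
        vector of \<open>U 1\<close> and its distance to \<open>U 2\<close>.\<close>
      have "\<not> U 1 \<subseteq> {0}"
      proof
        assume "U 1 \<subseteq> {0}"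
        then have "dim (U 1) \<le> card ({} :: 'e set)" by (intro dim_le_card) auto
        then show False using dimU[OF 1] r by simp
      qed
      then obtain x where "x \<in> U 1" "x \<noteq> 0" by auto
      then have "\<sigma>\<^sup>2 \<le> 1" using isoclinic_le_one[OF U[OF 1] U[OF 2] \<sigma>[OF 1 2]] by simp
      with False show "4 * \<sigma>\<^sup>2 - 2 < 2" by simp
    qed (simp_all add: U reflection_linear reflection_ip reflection_involution)
  qed
qed

lemma eitff_symmetry:
  assumes "eitff (2 * r) r n U" and "0 < r"
  shows "alternating_symmetry n U \<or> total_symmetry n U"
proof (rule eitff_cases[OF assms])
  show ?thesis if "clifford_family scale ip {1..n} (\<lambda>i. reflection (U i)) c" for c
    by (rule alternating_or_total[OF that])
  show ?thesis if "\<And>i j. i \<in> {1..n} \<Longrightarrow> j \<in> {1..n} \<Longrightarrow> U i = U j"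
    using constant_total_symmetry[of n U] that by blast
qed

end

section \<open>Matrices\<close>

lemma matrix_add_rdistrib: "((B + C) ** A) = (B ** A) + (C ** (A :: 'a::semiring_1^'p^'n))"
  by (vector matrix_matrix_mult_def sum.distrib[symmetric] distrib_right)

lemma matrix_scaleR_left: "(k *\<^sub>R A) ** B = k *\<^sub>R (A ** B)"
  and matrix_scaleR_right: "A ** (k *\<^sub>R B) = k *\<^sub>R (A ** B)" for A :: "'a::real_algebra_1^'n^'m"
  by (simp_all add: matrix_matrix_mult_def vec_eq_iff scaleR_sum_right)

lemma matrix_minus_left: "(- A) ** B = - (A ** B)"
  and matrix_minus_right: "A ** (- B) = - (A ** B)" for A :: "'a::ring_1^'n^'m"
  by (simp_all add: matrix_matrix_mult_def vec_eq_iff sum_negf)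

lemma matrix_diff_left: "(A - A') ** B = A ** B - A' ** B"
  and matrix_diff_right: "A ** (B - B') = A ** B - A ** B'" for A :: "'a::ring_1^'n^'m"
  by (simp_all add: matrix_matrix_mult_def vec_eq_iff sum_subtractf left_diff_distrib right_diff_distrib)

lemma matrix_sum_left: "(\<Sum>i\<in>S. f i) ** B = (\<Sum>i\<in>S. f i ** B)"
  and matrix_sum_right: "C ** (\<Sum>i\<in>S. f i) = (\<Sum>i\<in>S. C ** f i)" for f :: "_ \<Rightarrow> 'a::ring_1^'n^'m"
  by (induction S rule: infinite_finite_induct) (auto simp: matrix_add_ldistrib matrix_add_rdistrib)

lemma matrix_vector_sum_left: "(\<Sum>i\<in>S. A i) *v z = (\<Sum>i\<in>S. A i *v z)"
  by (induction S rule: infinite_finite_induct) (auto simp: matrix_vector_mult_add_rdistrib)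

lemma matrix_vector_minus_left: "(- A) *v w = - (A *v w)"
  and matrix_vector_minus_right: "A *v (- w) = - (A *v w)" for A :: "'a::ring_1^'n^'m"
  by (simp_all add: matrix_vector_mult_def vec_eq_iff sum_negf)

lemmas matrix_ring = matrix_add_ldistrib matrix_add_rdistrib matrix_scaleR_left matrix_scaleR_right
  matrix_minus_left matrix_minus_right matrix_diff_left matrix_diff_right

lemma scaleR_matrix_vector: "(k *\<^sub>R A) *v v = k *\<^sub>R (A *v v)"
  and matrix_vector_scaleR: "A *v (k *\<^sub>R v) = k *\<^sub>R (A *v v)" for A :: "'a::real_algebra_1^'n^'m"
  by (simp_all add: matrix_vector_mult_def vec_eq_iff scaleR_sum_right)

lemma vec_scaleR_conv: "k *\<^sub>R v = of_real k *s (v :: 'a::real_algebra_1^'n)"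
  by (simp add: vec_eq_iff scaleR_conv_of_real[where 'a='a])

lemma cadjoint_nth [simp]: "cadjoint A $ i $ j = conjugate (A $ j $ i)"
  by (simp add: cadjoint_def)

context
  fixes A B :: "'a::rc_field^'n^'m"
begin

lemma cadjoint_add: "cadjoint (A + B) = cadjoint A + cadjoint B"
  and cadjoint_minus: "cadjoint (- A) = - cadjoint A"
  and cadjoint_scaleR: "cadjoint (k *\<^sub>R A) = k *\<^sub>R cadjoint A"
  and cadjoint_cadjoint [simp]: "cadjoint (cadjoint A) = A"
  by (simp_all add: vec_eq_iff conjugate_dist_add)

lemma cadjoint_zero [simp]: "cadjoint (0 :: 'a^'n^'m) = 0"
  by (simp add: vec_eq_iff)

lemma cadjoint_mult: "cadjoint (A ** C) = cadjoint C ** cadjoint A"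
  by (simp add: vec_eq_iff matrix_matrix_mult_def sum_conjugate conjugate_dist_mul mult.commute)

end

lemma cadjoint_diff: "cadjoint (A - B) = cadjoint A - cadjoint (B :: 'a::rc_field^'n^'m)"
  by (simp only: diff_conv_add_uminus cadjoint_add cadjoint_minus)

lemma cadjoint_mat_1 [simp]: "cadjoint (mat 1 :: 'a::rc_field^'n^'n) = mat 1"
  by (simp add: vec_eq_iff mat_def)

lemma cadjoint_sum: "cadjoint (\<Sum>i\<in>S. f i) = (\<Sum>i\<in>S. cadjoint (f i :: 'a::rc_field^'n^'m))"
  by (induction S rule: infinite_finite_induct) (auto simp: cadjoint_add)

lemmas cadjoint_simps = cadjoint_add cadjoint_minus cadjoint_diff cadjoint_scaleR cadjoint_mult cadjoint_sum

lemma std_ip_adjoint: "std_ip (A *v x) y = std_ip x (cadjoint (A :: 'a::rc_field^'n^'m) *v y)"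
proof -
  have "std_ip (A *v x) y = (\<Sum>k\<in>UNIV. \<Sum>j\<in>UNIV. conjugate (x $ j) * (conjugate (A $ k $ j) * y $ k))"
    by (simp add: std_ip_def matrix_vector_mult_def sum_conjugate conjugate_dist_mul sum_distrib_right
        sum_distrib_left ac_simps)
  also have "\<dots> = std_ip x (cadjoint A *v y)"
    by (subst sum.swap) (simp add: std_ip_def matrix_vector_mult_def sum_distrib_left)
  finally show ?thesis .
qed

interpretation std: rc_hilbert_space "(*s) :: 'a::rc_field \<Rightarrow> 'a^'m \<Rightarrow> 'a^'m" std_ip
  by (intro rc_hilbert_space.intro fd_hilbert_space_std)

lemma cadjoint_mult_self_eq_0:
  assumes "cadjoint A ** (A :: 'a::rc_field^'n^'m) = 0" shows "A = 0"
proof -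
  have "A *v x = 0" for x
  proof (rule std.ip_definite)
    show "std_ip (A *v x) (A *v x) = 0" by (simp add: std_ip_adjoint matrix_vector_mul_assoc assms)
  qed
  then show ?thesis by (simp add: matrix_eq)
qed

text \<open>The adjoint of M is a left inverse of M, so it annihilates v - M (adjoint M) v; this
  makes the residual orthogonal to the range, and also gives injectivity and hence the
  dimension.\<close>

lemma orth_proj_isometry:
  fixes M :: "'a::rc_field^'n^'m"
  assumes "cadjoint M ** M = mat 1"
  shows "std.orth_proj (range ((*v) M)) = (*v) (M ** cadjoint M)"
    and "vec.subspace (range ((*v) M))" and "vec.dim (range ((*v) M)) = CARD('n)"
proof -
  show sub: "vec.subspace (range ((*v) M))"
    by (rule vec.linear_subspace_image[OF matrix_vector_mul_linear_gen vec.subspace_UNIV])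
  show "std.orth_proj (range ((*v) M)) = (*v) (M ** cadjoint M)"
  proof
    fix v
    show "std.orth_proj (range ((*v) M)) v = (M ** cadjoint M) *v v"
    proof (rule std.orth_proj_eqI[OF sub])
      show "(M ** cadjoint M) *v v \<in> range ((*v) M)" by (simp flip: matrix_vector_mul_assoc)
      fix w assume "w \<in> range ((*v) M)"
      then obtain x where w: "w = M *v x" by blast
      have "cadjoint M *v ((M ** cadjoint M) *v v) = cadjoint M *v v"
        by (simp add: matrix_vector_mul_assoc matrix_mul_assoc assms)
      then show "std_ip w (v - (M ** cadjoint M) *v v) = 0"
        by (simp add: w std_ip_adjoint std.ip_diff)
    qed
  qed
  have "inj ((*v) M)"
    by (rule inj_on_inverseI[of _ "(*v) (cadjoint M)"]) (simp add: matrix_vector_mul_assoc assms)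
  then show "vec.dim (range ((*v) M)) = CARD('n)"
    by (subst vec.dim_image_eq) (simp_all only: vec.span_UNIV vec_dim_card matrix_vector_mul_linear_gen)
qed

lemma block_column_adjoint_mult:
  fixes A :: "'a::rc_field^'r^'m" and C :: "'a^'r^'k"
  shows "cadjoint (block_column A C) ** block_column A' C' = cadjoint A ** A' + cadjoint C ** C'"
  by (simp add: vec_eq_iff matrix_matrix_mult_def block_column_def sum.Plus flip: UNIV_Plus_UNIV)

definition block_vec :: "'a^'m \<Rightarrow> 'a^'k \<Rightarrow> 'a^('m + 'k)" where
  "block_vec x y = (\<chi> p. case p of Inl k \<Rightarrow> x $ k | Inr k \<Rightarrow> y $ k)"

lemma block_vec_cases: obtains x y where "v = block_vec x y"
proof
  show "v = block_vec (\<chi> k. v $ Inl k) (\<chi> k. v $ Inr k)"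
    by (simp add: block_vec_def vec_eq_iff split: sum.splits)
qed

lemma block_vec_eq_iff [simp]: "block_vec x y = block_vec x' y' \<longleftrightarrow> x = x' \<and> y = y'"
  by (auto simp: block_vec_def vec_eq_iff split: sum.splits)

lemma block_vec_add: "block_vec x y + block_vec x' y' = block_vec (x + x') (y + y')"
  and block_vec_minus: "- block_vec u v = block_vec (- u) (- v :: 'b::ab_group_add^_)"
  and block_vec_diff: "block_vec u v - block_vec u' v' = block_vec (u - u') (v - v' :: 'b::ab_group_add^_)"
  and block_vec_scaleR: "k *\<^sub>R block_vec p q = block_vec (k *\<^sub>R p) (k *\<^sub>R q :: 'c::real_vector^_)"
  and block_vec_smult: "c *s block_vec s t = block_vec (c *s s) (c *s t)"
  by (simp_all add: block_vec_def vec_eq_iff split: sum.splits)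

lemma block_vec_sum: "(\<Sum>i\<in>S. block_vec (f i) (g i :: 'b::ab_group_add^_)) = block_vec (\<Sum>i\<in>S. f i) (\<Sum>i\<in>S. g i)"
  by (induction S rule: infinite_finite_induct) (simp_all add: block_vec_add, simp_all add: block_vec_def vec_eq_iff split: sum.splits)

lemma std_ip_block_vec: "std_ip (block_vec x y) (block_vec x' y') = std_ip x x' + std_ip y (y' :: 'a::rc_field^_)"
  by (simp add: std_ip_def block_vec_def sum.Plus flip: UNIV_Plus_UNIV)

lemma block_column_mult_vec: "block_column A C *v x = block_vec (A *v x) (C *v x)"
  by (simp add: vec_eq_iff block_column_def block_vec_def matrix_vector_mult_def split: sum.splits)

lemma cadjoint_block_column_mult_vec:
  "cadjoint (block_column A C) *v block_vec x y = cadjoint A *v x + cadjoint C *v (y :: 'a::rc_field^_)"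
  by (simp add: vec_eq_iff block_column_def block_vec_def matrix_vector_mult_def sum.Plus flip: UNIV_Plus_UNIV)

section \<open>The frame of a simplex\<close>

locale unitary_simplex =
  fixes n :: nat and B :: "nat \<Rightarrow> 'a::rc_field^'r^'r"
  assumes simplex: "rho_simplex n B"
begin

abbreviation M :: "nat \<Rightarrow> 'a^'r^('r + 'r)" where "M \<equiv> simplex_isometry n B"

definition \<alpha> :: real where "\<alpha> = sqrt ((real n - 2) / (2 * real n - 2))"
definition \<beta> :: real where "\<beta> = sqrt (real n / (2 * real n - 2))"

lemma n_ge_3: "3 \<le> n"
  using simplex by (simp add: rho_simplex_def)

lemma \<alpha>_square: "\<alpha> * \<alpha> = (real n - 2) / (2 * real n - 2)" and \<beta>_square: "\<beta> * \<beta> = real n / (2 * real n - 2)"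
  using n_ge_3 by (simp_all add: \<alpha>_def \<beta>_def)

lemma \<alpha>_\<beta>_square: "\<alpha> * \<alpha> + \<beta> * \<beta> = 1"
  unfolding \<alpha>_square \<beta>_square using n_ge_3 by (simp add: add_divide_distrib[symmetric])

lemma B_unitary: assumes "i \<in> {1..n-1}" shows "cadjoint (B i) ** B i = mat 1" "B i ** cadjoint (B i) = mat 1"
  using assms simplex by (auto simp: rho_simplex_def unitary_mat_def)

lemma B_anticomm: "i \<in> {1..n-1} \<Longrightarrow> j \<in> {1..n-1} \<Longrightarrow> i \<noteq> j \<Longrightarrow>
    cadjoint (B i) ** B j + cadjoint (B j) ** B i = - (2 / (real n - 2)) *\<^sub>R mat 1"
  using simplex by (auto simp: rho_simplex_def)

text \<open>The vertices of a regular simplex sum to zero: in the doubled Gram sum each row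
  contributes 2 from the diagonal and (n - 2) (-2 / (n - 2)) from the other entries. It removes the
  off-diagonal blocks in the tightness computation.\<close>

lemma B_sum: "(\<Sum>i=1..n-1. B i) = 0"
proof (rule cadjoint_mult_self_eq_0)
  define S where "S = cadjoint (\<Sum>i=1..n-1. B i) ** (\<Sum>i=1..n-1. B i)"
  have S: "S = (\<Sum>i=1..n-1. \<Sum>j=1..n-1. cadjoint (B i) ** B j)"
    unfolding S_def cadjoint_sum matrix_sum_left by (simp only: matrix_sum_right)
  have "S + S = (\<Sum>i=1..n-1. \<Sum>j=1..n-1. cadjoint (B i) ** B j) +
      (\<Sum>i=1..n-1. \<Sum>j=1..n-1. cadjoint (B j) ** B i)"
    by (subst (2) sum.swap) (simp only: S)
  then have "S + S = (\<Sum>i=1..n-1. \<Sum>j=1..n-1. cadjoint (B i) ** B j + cadjoint (B j) ** B i)"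
    by (simp only: sum.distrib)
  also have "\<dots> = (\<Sum>i=1..n-1. 0)"
  proof (rule sum.cong)
    fix i assume i: "i \<in> {1..n-1}"
    have "(\<Sum>j=1..n-1. cadjoint (B i) ** B j + cadjoint (B j) ** B i) =
        2 *\<^sub>R mat 1 + (\<Sum>j\<in>{1..n-1}-{i}. cadjoint (B i) ** B j + cadjoint (B j) ** B i)"
      using i by (subst sum.remove[of _ i]) (simp_all add: B_unitary scaleR_2)
    also have "(\<Sum>j\<in>{1..n-1}-{i}. cadjoint (B i) ** B j + cadjoint (B j) ** B i) =
        (\<Sum>j\<in>{1..n-1}-{i}. - (2 / (real n - 2)) *\<^sub>R mat 1)"
      by (rule sum.cong) (use i B_anticomm in auto)
    also have "\<dots> = (real (n - 2) * - (2 / (real n - 2))) *\<^sub>R mat 1"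
    proof -
      have "card ({1..n-1}-{i}) = n - 2" using i by simp
      then show ?thesis by (simp only: sum_constant_scaleR scaleR_scaleR)
    qed
    also have "real (n - 2) * - (2 / (real n - 2)) = - 2"
      using n_ge_3 by (simp add: of_nat_diff field_simps)
    finally show "(\<Sum>j=1..n-1. cadjoint (B i) ** B j + cadjoint (B j) ** B i) = 0" by simp
  qed simp
  finally have "2 *\<^sub>R S = 0" by (simp add: scaleR_2)
  then show "cadjoint (\<Sum>i=1..n-1. B i) ** (\<Sum>i=1..n-1. B i) = 0" by (simp add: S_def)
qed

lemma M_last: "M n = block_column (mat 1) 0"
  by (simp add: simplex_isometry_def)

lemma M_other: "i \<in> {1..n-1} \<Longrightarrow> M i = block_column (\<alpha> *\<^sub>R mat 1) (\<beta> *\<^sub>R B i)"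
  using n_ge_3 by (auto simp: simplex_isometry_def \<alpha>_def \<beta>_def Let_def)

lemma index_cases: assumes "i \<in> {1..n}" obtains "i = n" | "i \<in> {1..n-1}"
  using assms by force

lemma M_isometry: assumes "i \<in> {1..n}" shows "cadjoint (M i) ** M i = mat 1"
  using assms
proof (cases rule: index_cases)
  case 1
  then show ?thesis by (simp add: M_last block_column_adjoint_mult)
next
  case 2
  then show ?thesis using \<alpha>_\<beta>_square
    by (simp add: M_other block_column_adjoint_mult cadjoint_simps matrix_ring B_unitary flip: scaleR_add_left)
qed

text \<open>For i, j < n the cross Gram matrix is \<alpha>^2 + \<beta>^2 X with X Y = 1 and X + Y
  scalar, so its product with its adjoint is scalar. The values of \<alpha> and \<beta> make this
  scalar agree with \<alpha>^2, the value for pairs involving n; hence the isoclinic parameter is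
  \<alpha>.\<close>

lemma M_gram_square:
  assumes "i \<in> {1..n}" "j \<in> {1..n}" "i \<noteq> j"
  shows "(cadjoint (M i) ** M j) ** (cadjoint (M j) ** M i) = \<alpha>\<^sup>2 *\<^sub>R mat 1"
proof (cases "i = n \<or> j = n")
  case True
  then have "cadjoint (M i) ** M j = \<alpha> *\<^sub>R mat 1 \<and> cadjoint (M j) ** M i = \<alpha> *\<^sub>R mat 1"
    using assms by (auto simp: M_last M_other block_column_adjoint_mult cadjoint_simps matrix_ring)
  then show ?thesis by (simp add: matrix_ring power2_eq_square)
next
  case False
  then have ij: "i \<in> {1..n-1}" "j \<in> {1..n-1}" using assms by auto
  define X where "X = cadjoint (B i) ** B j"
  define Y where "Y = cadjoint (B j) ** B i"
  have XY: "X ** Y = mat 1"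
  proof -
    have "X ** Y = cadjoint (B i) ** (B j ** cadjoint (B j)) ** B i"
      by (simp add: X_def Y_def matrix_mul_assoc)
    then show ?thesis using B_unitary(1)[OF ij(1)] B_unitary(2)[OF ij(2)] by simp
  qed
  have sum: "X + Y = - (2 / (real n - 2)) *\<^sub>R mat 1"
    using B_anticomm[OF ij assms(3)] by (simp add: X_def Y_def)
  have "cadjoint (M i) ** M j = (\<alpha> * \<alpha>) *\<^sub>R mat 1 + (\<beta> * \<beta>) *\<^sub>R X"
    "cadjoint (M j) ** M i = (\<alpha> * \<alpha>) *\<^sub>R mat 1 + (\<beta> * \<beta>) *\<^sub>R Y"
    using ij by (simp_all add: M_other block_column_adjoint_mult cadjoint_simps matrix_ring X_def Y_def)
  then have "(cadjoint (M i) ** M j) ** (cadjoint (M j) ** M i) =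
      ((\<alpha> * \<alpha>) * (\<alpha> * \<alpha>) + (\<beta> * \<beta>) * (\<beta> * \<beta>)) *\<^sub>R mat 1 + ((\<alpha> * \<alpha>) * (\<beta> * \<beta>)) *\<^sub>R (X + Y)"
    by (simp add: matrix_ring XY scaleR_add_right scaleR_add_left)
  also have "\<dots> = ((\<alpha> * \<alpha>) * (\<alpha> * \<alpha>) + (\<beta> * \<beta>) * (\<beta> * \<beta>) - (\<alpha> * \<alpha>) * (\<beta> * \<beta>) * (2 / (real n - 2))) *\<^sub>R mat 1"
    unfolding sum by (simp add: scaleR_diff_left)
  also have "(\<alpha> * \<alpha>) * (\<alpha> * \<alpha>) + (\<beta> * \<beta>) * (\<beta> * \<beta>) - (\<alpha> * \<alpha>) * (\<beta> * \<beta>) * (2 / (real n - 2)) = \<alpha>\<^sup>2"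
  proof -
    define x where "x = real n - 2"
    have x: "x > 0" "real n = x + 2" using n_ge_3 by (auto simp: x_def)
    show ?thesis unfolding power2_eq_square \<alpha>_square \<beta>_square x(2) using x(1)
      by (simp add: divide_simps) algebra
  qed
  finally show ?thesis .
qed

lemma simplex_eitff_range: "simplex_eitff n B i = range ((*v) (M i))"
  by (simp add: simplex_eitff_def)

lemma proj:
  assumes "i \<in> {1..n}"
  shows "std.orth_proj (simplex_eitff n B i) = (*v) (M i ** cadjoint (M i))"
  unfolding simplex_eitff_range by (rule orth_proj_isometry[OF M_isometry[OF assms]])

lemma proj_block_vec:
  "i \<in> {1..n-1} \<Longrightarrow> std.orth_proj (simplex_eitff n B i) (block_vec x y) =
     block_vec ((\<alpha> * \<alpha>) *\<^sub>R x + (\<alpha> * \<beta>) *\<^sub>R (cadjoint (B i) *v y)) ((\<alpha> * \<beta>) *\<^sub>R (B i *v x) + (\<beta> * \<beta>) *\<^sub>R y)"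
  "std.orth_proj (simplex_eitff n B n) (block_vec x y) = block_vec x 0"
proof -
  show "std.orth_proj (simplex_eitff n B n) (block_vec x y) = block_vec x 0"
    using n_ge_3
    by (simp add: proj M_last block_column_mult_vec cadjoint_block_column_mult_vec flip: matrix_vector_mul_assoc)
  assume i: "i \<in> {1..n-1}"
  then have i': "i \<in> {1..n}" by auto
  have "B i *v (cadjoint (B i) *v y) = y" using B_unitary[OF i] by (simp add: matrix_vector_mul_assoc)
  then show "std.orth_proj (simplex_eitff n B i) (block_vec x y) =
     block_vec ((\<alpha> * \<alpha>) *\<^sub>R x + (\<alpha> * \<beta>) *\<^sub>R (cadjoint (B i) *v y)) ((\<alpha> * \<beta>) *\<^sub>R (B i *v x) + (\<beta> * \<beta>) *\<^sub>R y)"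
    unfolding proj[OF i'] using i
    by (simp add: M_other block_column_mult_vec cadjoint_block_column_mult_vec cadjoint_simps
        scaleR_matrix_vector matrix_vector_scaleR block_vec_scaleR block_vec_add
        matrix_vector_right_distrib scaleR_add_right mult.commute flip: matrix_vector_mul_assoc)
qed

lemma eitff_simplex: "std.eitff (2 * CARD('r)) CARD('r) n (simplex_eitff n B)"
  unfolding std.eitff_def
proof (intro conjI ballI)
  show "2 \<le> n" using n_ge_3 by simp
  show "vec.dim (UNIV :: ('a^('r + 'r)) set) = 2 * CARD('r)"
    unfolding vec_dim_card by simp
  fix i assume "i \<in> {1..n}"
  from M_isometry[OF this] show "vec.subspace (simplex_eitff n B i)" "vec.dim (simplex_eitff n B i) = CARD('r)"
    unfolding simplex_eitff_range by (rule orth_proj_isometry)+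
next
  have "std.orth_proj (simplex_eitff n B i) (std.orth_proj (simplex_eitff n B j) (std.orth_proj (simplex_eitff n B i) v)) =
      of_real (\<alpha>\<^sup>2) *s std.orth_proj (simplex_eitff n B i) v"
    if "i \<in> {1..n}" "j \<in> {1..n}" "i \<noteq> j" for i j v
  proof -
    have "(M i ** cadjoint (M i)) ** (M j ** cadjoint (M j)) ** (M i ** cadjoint (M i)) =
        M i ** ((cadjoint (M i) ** M j) ** (cadjoint (M j) ** M i)) ** cadjoint (M i)"
      by (simp add: matrix_mul_assoc)
    also have "\<dots> = \<alpha>\<^sup>2 *\<^sub>R (M i ** cadjoint (M i))"
      unfolding M_gram_square[OF that] by (simp add: matrix_ring)
    finally have "std.orth_proj (simplex_eitff n B i) (std.orth_proj (simplex_eitff n B j)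
        (std.orth_proj (simplex_eitff n B i) v)) = (\<alpha>\<^sup>2 *\<^sub>R (M i ** cadjoint (M i))) *v v"
      using that by (simp add: proj matrix_vector_mul_assoc matrix_mul_assoc)
    also have "\<dots> = of_real (\<alpha>\<^sup>2) *s ((M i ** cadjoint (M i)) *v v)"
      by (subst scaleR_matrix_vector) (rule vec_scaleR_conv)
    finally show ?thesis by (simp only: proj[OF that(1)])
  qed
  moreover have "0 \<le> \<alpha>" using n_ge_3 by (simp add: \<alpha>_def)
  ultimately show "std.equi_isoclinic n (simplex_eitff n B)"
    unfolding std.equi_isoclinic_def fun_eq_iff comp_apply by blast
  show "std.tight_fusion_frame n (simplex_eitff n B)"
    unfolding std.tight_fusion_frame_def
  proof (intro exI[of _ "real n / 2"] conjI allI)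
    show "0 < real n / 2" using n_ge_3 by simp
    fix v :: "'a^('r + 'r)"
    obtain x y where v: "v = block_vec x y" by (rule block_vec_cases)
    have sumB: "(\<Sum>i=1..n-1. cadjoint (B i) *v y) = 0" "(\<Sum>i=1..n-1. B i *v x) = 0"
      unfolding matrix_vector_sum_left[symmetric] cadjoint_sum[symmetric] B_sum by simp_all
    \<comment> \<open>Both diagonal blocks of the sum of the projections equal n / 2, the frame
      constant; the extra 1 comes from the last subspace.\<close>
    have \<alpha>: "real (n - 1) * (\<alpha> * \<alpha>) + 1 = real n / 2" and \<beta>: "real (n - 1) * (\<beta> * \<beta>) = real n / 2"
      unfolding \<alpha>_square \<beta>_square using n_ge_3 by (simp_all add: of_nat_diff field_simps)
    have "{1..n} = insert n {1..n-1}" "n \<notin> {1..n-1}" using n_ge_3 by auto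
    then have "(\<Sum>i=1..n. std.orth_proj (simplex_eitff n B i) v) =
       block_vec x 0 + (\<Sum>i=1..n-1. std.orth_proj (simplex_eitff n B i) v)"
      by (simp add: v proj_block_vec)
    also have "(\<Sum>i=1..n-1. std.orth_proj (simplex_eitff n B i) v) =
      (\<Sum>i=1..n-1. block_vec ((\<alpha> * \<alpha>) *\<^sub>R x + (\<alpha> * \<beta>) *\<^sub>R (cadjoint (B i) *v y)) ((\<alpha> * \<beta>) *\<^sub>R (B i *v x) + (\<beta> * \<beta>) *\<^sub>R y))"
      unfolding v by (rule sum.cong) (simp_all add: proj_block_vec)
    also have "\<dots> = block_vec ((real (n - 1) * (\<alpha> * \<alpha>)) *\<^sub>R x) ((real (n - 1) * (\<beta> * \<beta>)) *\<^sub>R y)"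
      unfolding block_vec_sum sum.distrib scaleR_sum_right[symmetric] sumB by (simp add: sum_constant_scaleR del: sum_constant)
    also have "block_vec x 0 + \<dots> = block_vec ((real (n - 1) * (\<alpha> * \<alpha>) + 1) *\<^sub>R x) ((real (n - 1) * (\<beta> * \<beta>)) *\<^sub>R y)"
      by (simp add: block_vec_add scaleR_add_left add.commute)
    also have "\<dots> = of_real (real n / 2) *s v"
      unfolding \<alpha> \<beta> v block_vec_smult by (simp only: vec_scaleR_conv)
    finally show "(\<Sum>i=1..n. std.orth_proj (simplex_eitff n B i) v) = of_real (real n / 2) *s v" .
  qed
qed

text \<open>If all \<open>B i\<close> are skew-Hermitian, then swapping the two blocks maps every subspace to its
  orthogonal complement.\<close>

lemma total_symmetry_simplex:
  assumes skew: "\<forall>i\<in>{1..n-1}. skew_hermitian (B i)"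
  shows "std.total_symmetry n (simplex_eitff n B)"
proof -
  define K :: "'a^('r + 'r) \<Rightarrow> 'a^('r + 'r)" where
    "K v = block_vec (\<chi> k. v $ Inr k) (\<chi> k. v $ Inl k)" for v
  have K: "K (block_vec x y) = block_vec y x" for x y
    by (simp add: K_def block_vec_def vec_eq_iff)
  have "Vector_Spaces.linear (*s) (*s) K"
    by (rule std.linearI) (simp_all add: K_def block_vec_def vec_eq_iff split: sum.splits)
  moreover have "K (K v) = v" for v by (cases v rule: block_vec_cases) (simp add: K)
  moreover have "std_ip (K v) w = std_ip v (K w)" for v w
    by (cases v rule: block_vec_cases; cases w rule: block_vec_cases) (simp add: K std_ip_block_vec)
  ultimately have KK: "std.unitary_pair K K" by (simp add: std.unitary_pair_def)
  have "std.reflection (simplex_eitff n B i) (block_vec x y) = - K (std.reflection (simplex_eitff n B i) (K (block_vec x y)))"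
    if "i \<in> {1..n}" for i x y
    using that
  proof (cases rule: index_cases)
    case 1
    then show ?thesis
      by (simp add: std.reflection_def K proj_block_vec block_vec_add block_vec_diff block_vec_minus)
  next
    case 2
    have skew': "cadjoint (B i) = - B i" using skew 2 by (auto simp: skew_hermitian_def)
    \<comment> \<open>The diagonal blocks 2 \<alpha>^2 - 1 and 2 \<beta>^2 - 1 of the reflection are
      negatives of each other, so swapping negates them; skewness does the same for the off-diagonal
      blocks.\<close>
    have \<beta>: "\<beta> * \<beta> = 1 - \<alpha> * \<alpha>" using \<alpha>_\<beta>_square by simp
    show ?thesis using 2
      by (simp add: std.reflection_def K proj_block_vec block_vec_add block_vec_diff block_vec_minus
          skew' matrix_vector_minus_left \<beta> scaleR_diff_left algebra_simps)
  qed
  then have refl: "K (std.reflection (simplex_eitff n B i) (K v)) = - std.reflection (simplex_eitff n B i) v"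
    if "i \<in> {1..n}" for i v
    using that by (cases v rule: block_vec_cases) simp
  show ?thesis
  proof (rule std.eitff_cases[OF eitff_simplex zero_less_card_finite])
    show ?thesis if "clifford_family (*s) std_ip {1..n} (\<lambda>i. std.reflection (simplex_eitff n B i)) c" for c
      by (rule std.total_symmetryI[OF that KK refl])
  qed (rule std.constant_total_symmetry)
qed

end

section \<open>Traces of Hermitian idempotents\<close>

definition hermitian_idempotent :: "'a::rc_field^'n^'n \<Rightarrow> bool" where
  "hermitian_idempotent P \<longleftrightarrow> cadjoint P = P \<and> P ** P = P"

lemma trace_scaleR: "trace (k *\<^sub>R A) = of_real k * trace (A :: 'a::rc_field^'n^'n)"
  by (simp add: trace_def sum_distrib_left scaleR_conv_of_real[where 'a='a])

text \<open>P is its adjoint times itself, so the trace is the squared Frobenius norm. That it is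
  real and nonnegative bounds the number of peeling steps in the next lemma.\<close>

lemma trace_hermitian_idempotent:
  assumes "hermitian_idempotent P"
  shows "trace P = of_real (\<Sum>i\<in>UNIV. \<Sum>j\<in>UNIV. (norm (P $ i $ j))\<^sup>2)"
proof -
  have "trace P = trace (cadjoint P ** P)"
    using assms by (simp add: hermitian_idempotent_def)
  also have "\<dots> = (\<Sum>i\<in>UNIV. \<Sum>j\<in>UNIV. of_real ((norm (P $ j $ i))\<^sup>2))"
    by (simp only: trace_def matrix_matrix_mult_def vec_lambda_beta cadjoint_nth conjugate_mult_self)
  also have "\<dots> = of_real (\<Sum>i\<in>UNIV. \<Sum>j\<in>UNIV. (norm (P $ i $ j))\<^sup>2)"
    by (subst sum.swap) simp
  finally show ?thesis .
qed

text \<open>Replaces rank by descent: pieces of trace k are split off inside the class Q until P =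
  0. The induction is on a natural number N above the trace; for N = 0 the trace would be
  negative.\<close>

lemma hermitian_idempotent_trace_multiple:
  fixes P :: "'a::rc_field^'n^'n"
  assumes "Q P" and k: "0 < k"
    and herm: "\<And>P. Q P \<Longrightarrow> hermitian_idempotent P"
    and step: "\<And>P. Q P \<Longrightarrow> P \<noteq> 0 \<Longrightarrow> \<exists>P'. Q P' \<and> trace P = trace P' + of_nat k"
  shows "\<exists>m. trace P = of_nat (k * m)"
proof -
  have "\<exists>m. trace P = of_nat (k * m)" if "trace P = of_real t" "t < real N" "Q P" for t N P
    using that
  proof (induction N arbitrary: P t)
    case 0
    have "of_real t = (of_real (\<Sum>i\<in>UNIV. \<Sum>j\<in>UNIV. (norm (P $ i $ j))\<^sup>2) :: 'a)"
      using trace_hermitian_idempotent[OF herm[OF 0(3)]] 0(1) by (simp only:)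
    then have "0 \<le> t" unfolding of_real_eq_iff by (simp add: sum_nonneg)
    with 0 show ?case by simp
  next
    case (Suc N)
    show ?case
    proof (cases "P = 0")
      case True
      then show ?thesis by (intro exI[of _ 0]) (simp add: trace_def)
    next
      case False
      obtain P' where P': "Q P'" "trace P = trace P' + of_nat k" using step[OF Suc.prems(3) False] by blast
      then have "trace P' = of_real (t - real k)" using Suc.prems(1) by simp
      moreover have "t - real k < real N" using Suc.prems(2) k by (simp add: of_nat_Suc)
      ultimately obtain m where "trace P' = of_nat (k * m)" using Suc.IH P'(1) by blast
      then have "trace P = of_nat (k * Suc m)" by (simp add: P'(2))
      then show ?thesis by blast
    qed
  qed
  moreover obtain t where "trace P = of_real t"
    using trace_hermitian_idempotent[OF herm[OF assms(1)]] by blast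
  ultimately show ?thesis using assms(1) reals_Archimedean2[of t] by blast
qed

text \<open>Q is the sum of the matrices v v* over V. For the last property, invariance of V up to
  sign gives Q A Q = A Q, and taking adjoints with A skew gives Q A Q = Q A.\<close>

lemma orthonormal_projection:
  fixes V :: "('a::rc_field^'n) set"
  assumes "finite V" and orth: "\<And>u v. u \<in> V \<Longrightarrow> v \<in> V \<Longrightarrow> std_ip u v = (if u = v then 1 else 0)"
  obtains Q where "hermitian_idempotent Q" "trace Q = of_nat (card V)" "\<And>v. v \<in> V \<Longrightarrow> Q *v v = v"
    "\<And>A. (\<And>v. v \<in> V \<Longrightarrow> A *v v = v) \<Longrightarrow> A ** Q = Q"
    "\<And>A. cadjoint A = - A \<Longrightarrow> (\<And>v. v \<in> V \<Longrightarrow> A *v v \<in> V \<or> - (A *v v) \<in> V) \<Longrightarrow> A ** Q = Q ** A"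
proof -
  define Q :: "'a^'n^'n" where "Q = (\<chi> i j. \<Sum>v\<in>V. v $ i * conjugate (v $ j))"
  have Q: "Q *v w = (\<Sum>v\<in>V. std_ip v w *s v)" for w
    by (simp add: vec_eq_iff Q_def matrix_vector_mult_def std_ip_def sum_distrib_right sum_distrib_left ac_simps)
      (subst sum.swap, simp)
  have QV: "Q *v w = w" if "w \<in> V" for w
  proof -
    have "Q *v w = (\<Sum>v\<in>V. if v = w then w else 0)"
      unfolding Q by (rule sum.cong) (use orth that in auto)
    then show ?thesis using that assms(1) by simp
  qed
  have AQ: "A ** Q = B ** Q" if "\<And>v. v \<in> V \<Longrightarrow> A *v v = B *v v" for A B
    unfolding matrix_eq
    by (simp add: Q that vec.linear_sum[OF matrix_vector_mul_linear_gen] vector_scalar_commute flip: matrix_vector_mul_assoc)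
  have adj: "cadjoint Q = Q"
    by (simp add: vec_eq_iff Q_def sum_conjugate assms(1) conjugate_dist_mul mult.commute)
  have QQ: "Q ** Q = Q" using AQ[of Q "mat 1"] QV by simp
  show thesis
  proof (rule that)
    show "hermitian_idempotent Q" using adj QQ by (simp add: hermitian_idempotent_def)
    have "trace Q = (\<Sum>v\<in>V. std_ip v v)"
      unfolding trace_def Q_def std_ip_def by (simp add: mult.commute) (rule sum.swap)
    then show "trace Q = of_nat (card V)" using orth by simp
    show "Q *v v = v" if "v \<in> V" for v by (rule QV[OF that])
    show "A ** Q = Q" if "\<And>v. v \<in> V \<Longrightarrow> A *v v = v" for A using AQ[of A "mat 1"] that by simp
    show "A ** Q = Q ** A" if skew: "cadjoint A = - A" and inv: "\<And>v. v \<in> V \<Longrightarrow> A *v v \<in> V \<or> - (A *v v) \<in> V" for A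
    proof -
      have "Q *v (A *v v) = A *v v" if "v \<in> V" for v
        using inv[OF that] QV matrix_vector_minus_right[of Q] by (metis add.inverse_inverse)
      then have QAQ: "Q ** A ** Q = A ** Q"
        using AQ[of "Q ** A" A] by (simp add: matrix_vector_mul_assoc)
      then have "cadjoint (Q ** A ** Q) = cadjoint (A ** Q)" by simp
      then have "Q ** A ** Q = Q ** A"
        by (simp add: cadjoint_mult adj skew matrix_ring matrix_mul_assoc)
      with QAQ show ?thesis by simp
    qed
  qed
qed

definition commutes_up_to :: "real \<Rightarrow> 'a::rc_field^'n^'n \<Rightarrow> 'a^'n^'n \<Rightarrow> bool" where
  "commutes_up_to e A B \<longleftrightarrow> A ** B = e *\<^sub>R (B ** A)"

lemma commutes_up_to_mult_left:
  assumes "commutes_up_to e A X" "commutes_up_to f B X" shows "commutes_up_to (e * f) (A ** B) X"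
proof -
  have "A ** B ** X = A ** (B ** X)" by (simp add: matrix_mul_assoc)
  also have "\<dots> = f *\<^sub>R (A ** X ** B)" using assms(2) by (simp add: commutes_up_to_def matrix_ring matrix_mul_assoc)
  also have "\<dots> = (e * f) *\<^sub>R (X ** (A ** B))" using assms(1) by (simp add: commutes_up_to_def matrix_ring matrix_mul_assoc mult.commute)
  finally show ?thesis by (simp add: commutes_up_to_def)
qed

lemma commutes_up_to_sym: "commutes_up_to e A B \<Longrightarrow> e * e = 1 \<Longrightarrow> commutes_up_to e B A"
  by (simp add: commutes_up_to_def)

lemma commutes_up_to_mult_right:
  assumes "commutes_up_to e X A" "commutes_up_to f X B" shows "commutes_up_to (e * f) X (A ** B)"
proof -
  have "X ** (A ** B) = e *\<^sub>R (A ** (X ** B))" using assms(1) by (simp add: commutes_up_to_def matrix_ring matrix_mul_assoc)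
  also have "\<dots> = (e * f) *\<^sub>R ((A ** B) ** X)" using assms(2) by (simp add: commutes_up_to_def matrix_ring matrix_mul_assoc)
  finally show ?thesis by (simp add: commutes_up_to_def)
qed

text \<open>For a = 1 a Hermitian involution, for a = -1 a skew-Hermitian unitary such as a Clifford
  generator.\<close>

definition signed_involution :: "real \<Rightarrow> 'a::rc_field^'n^'n \<Rightarrow> bool" where
  "signed_involution a A \<longleftrightarrow> cadjoint A = a *\<^sub>R A \<and> A ** A = a *\<^sub>R mat 1"

text \<open>P' = P (1 + T) / 2. Moving one factor of S^2 = s around the trace changes the sign of P
  T, because S commutes with P and anticommutes with T; hence trace (P T) = 0 and P' has half the
  trace of P.\<close>

lemma halve_idempotent:
  fixes P T S :: "'a::rc_field^'n^'n"
  assumes P: "hermitian_idempotent P" and T: "signed_involution 1 T" "commutes_up_to 1 T P"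
    and S: "commutes_up_to (-1) S T" "commutes_up_to 1 S P" "signed_involution s S" "s \<noteq> 0"
  obtains P' where "hermitian_idempotent P'" "trace P = 2 * trace P'"
    "\<And>X. commutes_up_to 1 X P \<Longrightarrow> commutes_up_to 1 X T \<Longrightarrow> commutes_up_to 1 X P'"
proof -
  have PT: "T ** P = P ** T" using T(2) by (simp add: commutes_up_to_def)
  have PP: "P ** P = P" and TT: "T ** T = mat 1" and adj: "cadjoint P = P" "cadjoint T = T"
    using P T by (auto simp: hermitian_idempotent_def signed_involution_def)
  define P' where "P' = (1/2) *\<^sub>R (P + P ** T)"
  have "P ** T ** (P ** T) = P" "P ** (P ** T) = P ** T" "P ** T ** P = P ** T"
    by (metis matrix_mul_assoc matrix_mul_rid PT PP TT)+
  then have "(P + P ** T) ** (P + P ** T) = 2 *\<^sub>R (P + P ** T)"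
    by (simp add: matrix_ring PP scaleR_2)
  then have "P' ** P' = P'" by (simp add: P'_def matrix_scaleR_left matrix_scaleR_right)
  moreover have "cadjoint P' = P'" by (simp add: P'_def cadjoint_simps adj PT)
  moreover have "trace (P ** T) = 0"
  proof -
    have ST: "S ** T = - (T ** S)" and SP: "S ** P = P ** S" using S by (auto simp: commutes_up_to_def)
    have SS: "S ** S = s *\<^sub>R mat 1" using S(3) by (simp add: signed_involution_def)
    have "s *\<^sub>R (P ** T) = P ** T ** (S ** S)" using SS by (simp add: matrix_ring)
    then have "of_real s * trace (P ** T) = trace (P ** T ** S ** S)"
      by (simp add: matrix_mul_assoc flip: trace_scaleR)
    also have "\<dots> = trace (S ** (P ** T ** S))" by (rule trace_mul_sym)
    also have "S ** (P ** T ** S) = (S ** P) ** T ** S" by (simp only: matrix_mul_assoc)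
    also have "\<dots> = P ** (S ** T) ** S" by (simp only: SP matrix_mul_assoc)
    also have "\<dots> = - (P ** T ** (S ** S))"
      by (simp only: ST matrix_minus_left matrix_minus_right matrix_mul_assoc)
    also have "trace \<dots> = - (of_real s * trace (P ** T))"
      using SS by (simp add: matrix_ring trace_scaleR flip: scaleR_minus_left)
    finally show ?thesis using S(4) by (simp add: eq_neg_iff_add_eq_0)
  qed
  then have "trace P = 2 * trace P'" by (simp add: P'_def trace_scaleR trace_add)
  moreover have "commutes_up_to 1 X P'" if "commutes_up_to 1 X P" "commutes_up_to 1 X T" for X
    using that commutes_up_to_mult_right[OF that]
    by (simp add: P'_def commutes_up_to_def matrix_ring)
  ultimately show thesis using that by (auto simp: hermitian_idempotent_def)
qed

lemma signed_involution_mult: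
  assumes "commutes_up_to e A B" "e * e = 1" "signed_involution a A" "signed_involution b B"
  shows "signed_involution (a * b * e) (A ** B)"
proof -
  have A: "cadjoint A = a *\<^sub>R A" "A ** A = a *\<^sub>R mat 1" and B: "cadjoint B = b *\<^sub>R B" "B ** B = b *\<^sub>R mat 1"
    using assms(3,4) by (auto simp: signed_involution_def)
  have BA: "B ** A = e *\<^sub>R (A ** B)" using commutes_up_to_sym[OF assms(1,2)] by (simp add: commutes_up_to_def)
  have "(A ** B) ** (A ** B) = A ** (B ** A) ** B" by (simp add: matrix_mul_assoc)
  also have "\<dots> = e *\<^sub>R ((A ** A) ** (B ** B))" by (simp add: BA matrix_scaleR_left matrix_scaleR_right matrix_mul_assoc)
  also have "\<dots> = (a * b * e) *\<^sub>R mat 1" by (simp add: A B matrix_ring ac_simps)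
  finally show ?thesis
    by (simp add: signed_involution_def cadjoint_mult A B matrix_ring BA ac_simps)
qed

lemma hermitian_idempotent_diff:
  assumes "hermitian_idempotent P" "hermitian_idempotent Q" "P ** Q = Q"
  shows "hermitian_idempotent (P - Q)"
proof -
  have "cadjoint (P ** Q) = cadjoint Q" using assms(3) by simp
  then have "Q ** P = Q" using assms(1,2) by (simp add: cadjoint_mult hermitian_idempotent_def)
  then show ?thesis using assms by (simp add: hermitian_idempotent_def cadjoint_diff matrix_ring)
qed

lemma hermitian_idempotent_unit_vector:
  fixes P :: "'a::rc_field^'n^'n"
  assumes "hermitian_idempotent P" "P \<noteq> 0"
  obtains v where "P *v v = v" "std_ip v v = 1"
proof -
  obtain x where x: "P *v x \<noteq> 0" using assms(2) by (auto simp: matrix_eq)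
  define w where "w = P *v x"
  have w: "P *v w = w" "w \<noteq> 0" using assms(1) x by (simp_all add: w_def hermitian_idempotent_def matrix_vector_mul_assoc)
  define t where "t = norm (std_ip w w)"
  have t: "std_ip w w = of_real t" using nonneg_eq_norm[OF std.ip_nonneg] by (simp add: t_def of_real_def)
  have "t > 0" using w(2) std.ip_definite by (auto simp: t_def)
  show thesis
  proof
    let ?v = "of_real (1 / sqrt t) *s w"
    show "P *v ?v = ?v" by (simp add: vector_scalar_commute w(1))
    have "std_ip ?v ?v = of_real (1 / sqrt t * (1 / sqrt t * t))"
      by (simp only: std.ip_scale std.ip_scale_left t conjugate_of_real of_real_mult)
    also have "1 / sqrt t * (1 / sqrt t * t) = 1" using \<open>t > 0\<close> by simp
    finally show "std_ip ?v ?v = 1" by simp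
  qed
qed

text \<open>For a unit vector v fixed by P, the vectors \<open>E i *v v\<close> are orthonormal,
  fixed by P and permuted up to sign by all \<open>E j\<close>. Subtracting the projection to their
  span stays in the class and lowers the trace by m. It is applied to the families 1; 1, I; and 1,
  I, J, IJ.\<close>

lemma invariant_idempotent_trace:
  fixes P :: "'a::rc_field^'n^'n" and E :: "nat \<Rightarrow> 'a^'n^'n"
  assumes m: "0 < m"
    and E: "\<And>i. i < m \<Longrightarrow> cadjoint (E i) ** E i = mat 1"
    and orth: "\<And>i j v. i < m \<Longrightarrow> j < m \<Longrightarrow> i \<noteq> j \<Longrightarrow> std_ip (E i *v v) (E j *v v) = 0"
    and skew: "\<And>i. i < m \<Longrightarrow> E i = mat 1 \<or> cadjoint (E i) = - E i"
    and closed: "\<And>i j. i < m \<Longrightarrow> j < m \<Longrightarrow> \<exists>k<m. E i ** E j = E k \<or> E i ** E j = - E k"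
    and P: "hermitian_idempotent P" "\<And>i. i < m \<Longrightarrow> E i ** P = P ** E i"
  shows "\<exists>k. trace P = of_nat (m * k)"
proof (rule hermitian_idempotent_trace_multiple[where Q = "\<lambda>P. hermitian_idempotent P \<and> (\<forall>i<m. E i ** P = P ** E i)"])
  fix P :: "'a^'n^'n" assume P: "hermitian_idempotent P \<and> (\<forall>i<m. E i ** P = P ** E i)" "P \<noteq> 0"
  obtain v where v: "P *v v = v" "std_ip v v = 1"
    using hermitian_idempotent_unit_vector P by blast
  define V where "V = (\<lambda>i. E i *v v) ` {..<m}"
  have ip: "std_ip (E i *v v) (E j *v v) = (if i = j then 1 else 0)" if "i < m" "j < m" for i j
    using orth that E[OF that(1)] v(2) by (auto simp: std_ip_adjoint matrix_vector_mul_assoc)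
  have inj: "inj_on (\<lambda>i. E i *v v) {..<m}"
    by (rule inj_onI) (metis ip lessThan_iff zero_neq_one)
  obtain Q where Q: "hermitian_idempotent Q" "trace Q = of_nat (card V)"
    "\<And>A. (\<And>v. v \<in> V \<Longrightarrow> A *v v = v) \<Longrightarrow> A ** Q = Q"
    "\<And>A. cadjoint A = - A \<Longrightarrow> (\<And>v. v \<in> V \<Longrightarrow> A *v v \<in> V \<or> - (A *v v) \<in> V) \<Longrightarrow> A ** Q = Q ** A"
  proof (rule orthonormal_projection[of V])
    show "finite V" by (simp add: V_def)
    show "std_ip u w = (if u = w then 1 else 0)" if "u \<in> V" "w \<in> V" for u w
      using that ip inj by (auto simp: V_def inj_on_def)
  qed (use that in blast)
  have "P ** Q = Q"
  proof (rule Q(3))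
    fix w assume "w \<in> V"
    then show "P *v w = w" using P v(1)
      by (auto simp: V_def matrix_vector_mul_assoc) (metis matrix_vector_mul_assoc)
  qed
  then have herm: "hermitian_idempotent (P - Q)" using hermitian_idempotent_diff P Q(1) by blast
  have "E i ** Q = Q ** E i" if i: "i < m" for i
  proof (cases "E i = mat 1")
    case False
    have "E i *v w \<in> V \<or> - (E i *v w) \<in> V" if w: "w \<in> V" for w
    proof -
      obtain j where j: "j < m" "w = E j *v v" using w by (auto simp: V_def)
      obtain k where "k < m" "E i ** E j = E k \<or> E i ** E j = - E k" using closed[OF i j(1)] by blast
      then show ?thesis by (auto simp: j(2) matrix_vector_mul_assoc V_def matrix_vector_minus_left)
    qed
    with skew[OF i] False show ?thesis by (blast intro: Q(4))
  qed simp
  then have "\<forall>i<m. E i ** (P - Q) = (P - Q) ** E i"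
    using P by (simp add: matrix_ring)
  moreover have "trace P = trace (P - Q) + of_nat m"
    using Q(2) inj by (simp add: trace_sub V_def card_image)
  ultimately show "\<exists>P'. (hermitian_idempotent P' \<and> (\<forall>i<m. E i ** P' = P' ** E i)) \<and> trace P = trace P' + of_nat m"
    using herm by blast
qed (use assms in auto)

lemma hermitian_idempotent_trace_nat:
  assumes "hermitian_idempotent (P :: 'a::rc_field^'n^'n)" shows "\<exists>k. trace P = of_nat k"
  using invariant_idempotent_trace[of 1 "\<lambda>_. mat 1" P] assms by simp

text \<open>Symmetry of the real inner product is essential: over the complex numbers the scalar i
  is skew and maps no nonzero vector to an orthogonal one.\<close>

lemma real_skew_ip:
  assumes "cadjoint A = - (A :: real^'n^'n)" shows "std_ip v (A *v v) = 0"
proof -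
  have "std_ip (A *v v) v = - std_ip v (A *v v)"
    by (simp add: std_ip_adjoint assms matrix_vector_minus_left std.ip_minus)
  moreover have "std_ip (A *v v) v = std_ip v (A *v v)" by (simp add: std_ip_def mult.commute)
  ultimately show ?thesis by simp
qed

definition clifford :: "nat \<Rightarrow> (nat \<Rightarrow> 'a::rc_field^'n^'n) \<Rightarrow> bool" where
  "clifford K D \<longleftrightarrow> (\<forall>j<K. skew_hermitian (D j) \<and> D j ** D j = - mat 1) \<and>
     (\<forall>i<K. \<forall>j<K. i \<noteq> j \<longrightarrow> D i ** D j = - (D j ** D i))"

lemma clifford_mono: "clifford K D \<Longrightarrow> L \<le> K \<Longrightarrow> clifford L D"
  unfolding clifford_def by (meson order_less_le_trans)

lemma cliffordD:
  assumes "clifford K D"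
  shows "i < K \<Longrightarrow> cadjoint (D i) = - D i" "i < K \<Longrightarrow> D i ** D i = - mat 1"
    "i < K \<Longrightarrow> j < K \<Longrightarrow> i \<noteq> j \<Longrightarrow> D i ** D j = - (D j ** D i)"
  using assms unfolding clifford_def skew_hermitian_def by metis+

lemma real_trace_one:
  fixes D :: "nat \<Rightarrow> real^'n^'n"
  assumes "clifford 1 D" "hermitian_idempotent P" "commutes_up_to 1 (D 0) P"
  shows "\<exists>k. trace P = of_nat (2 * k)"
proof -
  have adj: "cadjoint (D 0) = - D 0" and sq: "D 0 ** D 0 = - mat 1"
    using cliffordD(1,2)[OF assms(1), of 0] by simp_all
  show ?thesis
  proof (rule invariant_idempotent_trace[where E = "\<lambda>i. [mat 1, D 0] ! i"])
    show "std_ip (([mat 1, D 0] ! i) *v v) (([mat 1, D 0] ! j) *v v) = 0" if "i < 2" "j < 2" "i \<noteq> j" for i j v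
      using that real_skew_ip[OF adj, of v] std.ip_eq_0_commute[of v "D 0 *v v"] by (auto simp: less_2_cases_iff)
    show "\<exists>k<2. ([mat 1, D 0] ! i) ** ([mat 1, D 0] ! j) = [mat 1, D 0] ! k \<or>
        ([mat 1, D 0] ! i) ** ([mat 1, D 0] ! j) = - [mat 1, D 0] ! k" if "i < 2" "j < 2" for i j
      using that sq by (auto simp: less_2_cases_iff ex_disj_distrib conj_disj_distribR)
  qed (use assms in \<open>auto simp: less_2_cases_iff adj sq matrix_ring commutes_up_to_def\<close>)
qed

lemma less_4_iff: "i < 4 \<longleftrightarrow> i = 0 \<or> i = 1 \<or> i = 2 \<or> i = (3::nat)"
  by auto

text \<open>The product of the anticommuting I and J is again skew, so 1, I, J, IJ are the
  quaternion units up to sign and send a vector to four mutually orthogonal ones.\<close>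

lemma real_trace_two:
  fixes D :: "nat \<Rightarrow> real^'n^'n"
  assumes "clifford 2 D" "hermitian_idempotent P" "commutes_up_to 1 (D 0) P" "commutes_up_to 1 (D 1) P"
  shows "\<exists>k. trace P = of_nat (4 * k)"
proof -
  define I where "I = D 0"
  define J where "J = D 1"
  have adj: "cadjoint I = - I" "cadjoint J = - J" and sq: "I ** I = - mat 1" "J ** J = - mat 1"
    unfolding I_def J_def using cliffordD(1,2)[OF assms(1)] by simp_all
  have JI: "J ** I = - (I ** J)"
    unfolding I_def J_def by (rule cliffordD(3)[OF assms(1)]) simp_all
  have sq': "X ** I ** I = - X" "X ** J ** J = - X" "X ** J ** I = - (X ** I ** J)" for X
    by (simp_all add: sq JI matrix_minus_right flip: matrix_mul_assoc)
  have adj': "cadjoint (I ** J) = - (I ** J)" by (simp add: cadjoint_mult adj JI matrix_ring)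
  note [simp] = adj adj' sq JI sq' matrix_minus_left matrix_minus_right matrix_mul_assoc
  note ip = real_skew_ip[OF adj(1)] real_skew_ip[OF adj(2)] real_skew_ip[OF adj']
  let ?E = "[mat 1, I, J, I ** J]"
  show ?thesis
  proof (rule invariant_idempotent_trace[where E = "\<lambda>i. ?E ! i"])
    show "std_ip ((?E ! i) *v v) ((?E ! j) *v v) = 0" if "i < 4" "j < 4" "i \<noteq> j" for i j v
      using that ip[of v]
      by (auto simp: less_4_iff std_ip_adjoint matrix_vector_mul_assoc matrix_vector_minus_left std.ip_minus)
    show "\<exists>k<4. (?E ! i) ** (?E ! j) = ?E ! k \<or> (?E ! i) ** (?E ! j) = - ?E ! k" if "i < 4" "j < 4" for i j
      using that by (auto simp: less_4_iff ex_disj_distrib conj_disj_distribR)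
    have "I ** P = P ** I" "J ** P = P ** J" using assms(3,4) by (auto simp: commutes_up_to_def I_def J_def)
    then show "(?E ! i) ** P = P ** (?E ! i)" if "i < 4" for i
      using that by (auto simp: less_4_iff) (metis matrix_mul_assoc)
  qed (use assms(2) in \<open>auto simp: less_4_iff\<close>)
qed

section \<open>Words in anticommuting matrices\<close>

fun clifford_word :: "(nat \<Rightarrow> 'a::rc_field^'n^'n) \<Rightarrow> nat list \<Rightarrow> 'a^'n^'n" where
  "clifford_word D [] = mat 1"
| "clifford_word D (i # w) = D i ** clifford_word D w"

text \<open>The sign from moving a generator past a word: one factor -1 for every letter different
  from it. With \<open>word_sign\<close> and \<open>square_sign\<close>, commutation and squares of
  explicit words become evaluations that simp performs, also with letters such as
  \<open>K + 3\<close>.\<close>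

fun letter_sign :: "nat \<Rightarrow> nat list \<Rightarrow> real" where
  "letter_sign i [] = 1"
| "letter_sign i (j # w) = (if i = j then 1 else - 1) * letter_sign i w"

fun word_sign :: "nat list \<Rightarrow> nat list \<Rightarrow> real" where
  "word_sign [] w = 1"
| "word_sign (i # v) w = letter_sign i w * word_sign v w"

fun square_sign :: "nat list \<Rightarrow> real" where
  "square_sign [] = 1"
| "square_sign (i # w) = - 1 * square_sign w * letter_sign i w"

lemma letter_sign_square: "letter_sign i w * letter_sign i w = 1"
  by (induction w) (auto simp: algebra_simps)

lemma square_sign_nonzero: "square_sign w \<noteq> 0"
  using letter_sign_square by (induction w) (auto, metis mult_zero_left zero_neq_one)

lemma commutes_up_to_one: "commutes_up_to 1 X (mat 1)" "commutes_up_to 1 (mat 1) X"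
  by (simp_all add: commutes_up_to_def)

context
  fixes K :: nat and D :: "nat \<Rightarrow> 'a::rc_field^'n^'n"
  assumes D: "clifford K D"
begin

lemma letters_commute: "i < K \<Longrightarrow> j < K \<Longrightarrow> commutes_up_to (if i = j then 1 else - 1) (D i) (D j)"
  using cliffordD(3)[OF D, of i j] by (simp add: commutes_up_to_def)

lemma letter_word_commute:
  assumes "i < K" "set w \<subseteq> {..<K}" shows "commutes_up_to (letter_sign i w) (D i) (clifford_word D w)"
  using assms(2)
proof (induction w)
  case (Cons j w)
  then show ?case
    unfolding letter_sign.simps clifford_word.simps
    by (intro commutes_up_to_mult_right letters_commute) (use assms in auto)
qed (simp add: commutes_up_to_one)

lemma words_commute:
  assumes "set w \<subseteq> {..<K}" "set v \<subseteq> {..<K}"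
  shows "commutes_up_to (word_sign v w) (clifford_word D v) (clifford_word D w)"
  using assms(2)
proof (induction v)
  case (Cons j v)
  then show ?case
    unfolding word_sign.simps clifford_word.simps
    by (intro commutes_up_to_mult_left letter_word_commute) (use assms in auto)
qed (simp add: commutes_up_to_one)

lemma word_commute:
  assumes "\<And>i. i \<in> set w \<Longrightarrow> commutes_up_to 1 (D i) X" shows "commutes_up_to 1 (clifford_word D w) X"
  using assms
proof (induction w)
  case (Cons j w)
  then show ?case
    using commutes_up_to_mult_left[of 1 "D j" X 1] by simp
qed (simp add: commutes_up_to_one)

lemma letter_signed_involution: "i < K \<Longrightarrow> signed_involution (- 1) (D i)"
  using cliffordD(1,2)[OF D] by (simp add: signed_involution_def)

lemma word_signed_involution:
  assumes "set w \<subseteq> {..<K}" shows "signed_involution (square_sign w) (clifford_word D w)"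
  using assms
proof (induction w)
  case (Cons i w)
  then show ?case unfolding square_sign.simps clifford_word.simps
    by (intro signed_involution_mult letter_word_commute letter_sign_square letter_signed_involution) auto
qed (simp add: signed_involution_def)

text \<open>v is the involution to project with and w the witness that kills the trace. The last
  conclusion records which words still commute with the new idempotent, so that the step can be
  iterated.\<close>

lemma halve_by_words:
  assumes P: "hermitian_idempotent P"
    and v: "set v \<subseteq> {..<K}" "square_sign v = 1" "commutes_up_to 1 (clifford_word D v) P"
    and w: "set w \<subseteq> {..<K}" "word_sign w v = - 1" "commutes_up_to 1 (clifford_word D w) P"
  obtains P' where "hermitian_idempotent P'" "trace P = 2 * trace P'"
    "\<And>u. set u \<subseteq> {..<K} \<Longrightarrow> word_sign u v = 1 \<Longrightarrow> commutes_up_to 1 (clifford_word D u) P \<Longrightarrow>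
      commutes_up_to 1 (clifford_word D u) P'"
proof (rule halve_idempotent[OF P])
  show "signed_involution 1 (clifford_word D v)" using word_signed_involution[OF v(1)] v(2) by simp
  show "commutes_up_to (-1) (clifford_word D w) (clifford_word D v)"
    using words_commute[OF v(1) w(1)] w(2) by simp
  show "signed_involution (square_sign w) (clifford_word D w)" by (rule word_signed_involution[OF w(1)])
  show "square_sign w \<noteq> 0" by (rule square_sign_nonzero)
  fix P' assume "hermitian_idempotent P'" "trace P = 2 * trace P'" and
    comm: "\<And>X. commutes_up_to 1 X P \<Longrightarrow> commutes_up_to 1 X (clifford_word D v) \<Longrightarrow> commutes_up_to 1 X P'"
  then show thesis
  proof (intro that)
    fix u assume "set u \<subseteq> {..<K}" "word_sign u v = 1" "commutes_up_to 1 (clifford_word D u) P"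
    then show "commutes_up_to 1 (clifford_word D u) P'"
      using comm words_commute[OF v(1), of u] by simp
  qed
qed (use v w in auto)

end

lemma clifford_word_single: "clifford_word D [i] = D i"
  by simp

text \<open>The four words below generate the extended Hamming code of length 8: they have even pairwise overlaps,
  hence commute.\<close>

lemma clifford_reduce_eight:
  fixes D :: "nat \<Rightarrow> 'a::rc_field^'n^'n"
  assumes D: "clifford (K + 8) D" and P: "hermitian_idempotent P" "\<And>i. i < K + 8 \<Longrightarrow> commutes_up_to 1 (D i) P"
  shows "\<exists>P'. hermitian_idempotent P' \<and> trace P = 16 * trace P' \<and> (\<forall>i<K. commutes_up_to 1 (D i) P')"
proof -
  have P_word: "commutes_up_to 1 (clifford_word D w) P" if "set w \<subseteq> {..<K+8}" for w
    by (rule word_commute[OF D]) (use that P(2) in auto)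
  define v where "v = [[K, K+1, K+2, K+3], [K, K+1, K+4, K+5], [K, K+1, K+6, K+7], [K, K+2, K+4, K+6]]"
  have v: "set (v ! 0) \<subseteq> {..<K+8}" "set (v ! 1) \<subseteq> {..<K+8}" "set (v ! 2) \<subseteq> {..<K+8}" "set (v ! 3) \<subseteq> {..<K+8}"
    by (auto simp: v_def)
  have i: "word_sign [i] (v ! 0) = 1" "word_sign [i] (v ! 1) = 1" "word_sign [i] (v ! 2) = 1" "word_sign [i] (v ! 3) = 1" if "i < K" for i
    using that by (auto simp: v_def)
  \<comment> \<open>Each halving needs a witness commuting with the earlier words and anticommuting
    with the current one: K, K+4 and K+6 are letters first occurring in the current word, while the
    pair K, K+1 lies in the first three words and meets the fourth only in K. Letters below K
    commute with all four words because these have even length.\<close>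
  obtain P1 where P1: "hermitian_idempotent P1" "trace P = 2 * trace P1"
    "\<And>u. set u \<subseteq> {..<K+8} \<Longrightarrow> word_sign u (v ! 0) = 1 \<Longrightarrow> commutes_up_to 1 (clifford_word D u) P1"
    by (rule halve_by_words[OF D P(1) v(1) _ P_word[OF v(1)] _ _ P_word, of "[K]"]) (auto simp: v_def P_word)
  obtain P2 where P2: "hermitian_idempotent P2" "trace P1 = 2 * trace P2"
    "\<And>u. set u \<subseteq> {..<K+8} \<Longrightarrow> word_sign u (v ! 0) = 1 \<Longrightarrow> word_sign u (v ! 1) = 1 \<Longrightarrow>
      commutes_up_to 1 (clifford_word D u) P2"
    by (rule halve_by_words[OF D P1(1) v(2) _ P1(3)[OF v(2)] _ _ P1(3), of "[K+4]"]) (auto simp: v_def P1(3))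
  obtain P3 where P3: "hermitian_idempotent P3" "trace P2 = 2 * trace P3"
    "\<And>u. set u \<subseteq> {..<K+8} \<Longrightarrow> word_sign u (v ! 0) = 1 \<Longrightarrow> word_sign u (v ! 1) = 1 \<Longrightarrow> word_sign u (v ! 2) = 1 \<Longrightarrow>
      commutes_up_to 1 (clifford_word D u) P3"
    by (rule halve_by_words[OF D P2(1) v(3) _ P2(3)[OF v(3)] _ _ P2(3), of "[K+6]"]) (auto simp: v_def P2(3))
  obtain P4 where P4: "hermitian_idempotent P4" "trace P3 = 2 * trace P4"
    "\<And>u. set u \<subseteq> {..<K+8} \<Longrightarrow> word_sign u (v ! 0) = 1 \<Longrightarrow> word_sign u (v ! 1) = 1 \<Longrightarrow> word_sign u (v ! 2) = 1 \<Longrightarrow>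
      word_sign u (v ! 3) = 1 \<Longrightarrow> commutes_up_to 1 (clifford_word D u) P4"
    by (rule halve_by_words[OF D P3(1) v(4) _ P3(3)[OF v(4)] _ _ P3(3), of "[K, K+1]"]) (auto simp: v_def P3(3))
  show ?thesis
  proof (intro exI conjI allI impI)
    show "hermitian_idempotent P4" by (rule P4(1))
    show "trace P = 16 * trace P4" by (simp add: P1(2) P2(2) P3(2) P4(2))
    show "commutes_up_to 1 (D i) P4" if "i < K" for i
      unfolding clifford_word_single[symmetric] by (rule P4(3)) (use i[OF that] that in auto)
  qed
qed

text \<open>With 1, 2, 4 and 8 generators the trace is a multiple of 2 (complex structure), 4
  (quaternionic structure), 8 (one halving, then quaternionic) and 16 (four halvings). Each further
  eight generators contribute a factor 16.\<close>

lemma real_clifford_trace: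
  fixes D :: "nat \<Rightarrow> real^'n^'n"
  assumes "clifford (8 * b + 2 ^ c) D" "c \<le> 3" "hermitian_idempotent P"
    "\<And>i. i < 8 * b + 2 ^ c \<Longrightarrow> commutes_up_to 1 (D i) P"
  shows "\<exists>k. trace P = of_nat (2 ^ (4 * b + c + 1) * k)"
  using assms
proof (induction b arbitrary: P)
  case 0
  consider "c = 0" | "c = 1" | "c = 2" | "c = 3" using 0(2) by linarith
  then show ?case
  proof cases
    case 1
    then show ?thesis using real_trace_one[of D P] 0 by simp
  next
    case 2
    then show ?thesis using real_trace_two[of D P] 0 by (simp add: numeral_2_eq_2)
  next
    case 3
    then have D: "clifford 4 D" and P: "hermitian_idempotent P" "\<And>i. i < 4 \<Longrightarrow> commutes_up_to 1 (D i) P"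
      using 0 by auto
    have P_word: "commutes_up_to 1 (clifford_word D w) P" if "set w \<subseteq> {..<4}" for w
      by (rule word_commute[OF D]) (use that P(2) in auto)
    \<comment> \<open>The word 0, 1, 2 is a Hermitian involution commuting with its own letters and
      anticommuting with \<open>D 3\<close>, so \<open>D 0\<close> and \<open>D 1\<close> still act
      quaternionically on P1.\<close>
    obtain P1 where P1: "hermitian_idempotent P1" "trace P = 2 * trace P1"
      "\<And>u. set u \<subseteq> {..<4} \<Longrightarrow> word_sign u [0,1,2] = 1 \<Longrightarrow> commutes_up_to 1 (clifford_word D u) P1"
      by (rule halve_by_words[OF D P(1) _ _ P_word _ _ P_word, of "[0,1,2]" "[3]"]) (auto simp: P_word)
    have "commutes_up_to 1 (D 0) P1" "commutes_up_to 1 (D 1) P1"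
      using P1(3)[of "[0]"] P1(3)[of "[1]"] by auto
    then obtain k where "trace P1 = of_nat (4 * k)"
      using real_trace_two[OF clifford_mono[OF D] P1(1)] by auto
    then show ?thesis using 3 P1(2) by auto
  next
    case 4
    then have D: "clifford (0 + 8) D" and P: "\<And>i. i < 0 + 8 \<Longrightarrow> commutes_up_to 1 (D i) P" using 0(1,4) by auto
    obtain P1 :: "real^'n^'n" where P1: "hermitian_idempotent P1" "trace P = 16 * trace P1"
      using clifford_reduce_eight[OF D 0(3) P] by blast
    obtain k where "trace P1 = of_nat k" using hermitian_idempotent_trace_nat[OF P1(1)] by blast
    then show ?thesis using 4 P1(2) by auto
  qed
next
  case (Suc b)
  have eq: "8 * Suc b + 2 ^ c = (8 * b + 2 ^ c) + 8" by simp
  obtain P1 where P1: "hermitian_idempotent P1" "trace P = 16 * trace P1"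
      "\<And>i. i < 8 * b + 2 ^ c \<Longrightarrow> commutes_up_to 1 (D i) P1"
    using clifford_reduce_eight[OF Suc.prems(1)[unfolded eq] Suc.prems(3) Suc.prems(4)[unfolded eq]] by blast
  obtain k where "trace P1 = of_nat (2 ^ (4 * b + c + 1) * k)"
    using Suc.IH[OF clifford_mono[OF Suc.prems(1)] Suc.prems(2) P1(1,3)] by auto
  then have "trace P = of_nat (2 ^ (4 * Suc b + c + 1) * k)"
    by (simp add: P1(2) power_add)
  then show ?case by blast
qed

text \<open>The last two generators are spent on T = i D(2k) D(2k+1), a Hermitian involution that
  commutes with all earlier generators and anticommutes with D(2k).\<close>

lemma complex_clifford_trace:
  fixes D :: "nat \<Rightarrow> complex^'n^'n"
  assumes "clifford (2 * k) D" "hermitian_idempotent P"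
    "\<And>i. i < 2 * k \<Longrightarrow> commutes_up_to 1 (D i) P"
  shows "\<exists>m. trace P = of_nat (2 ^ k * m)"
  using assms
proof (induction k arbitrary: P)
  case 0
  then show ?case using hermitian_idempotent_trace_nat by auto
next
  case (Suc k)
  note D = Suc.prems(1)
  define A where "A = mat \<i> ** D (2 * k)"
  have mat_comm: "mat \<i> ** X = X ** mat \<i>" for X :: "complex^'n^'n"
    by (simp add: vec_eq_iff matrix_matrix_mult_def mat_def if_distrib[of "\<lambda>x. x * _"] if_distrib[of "\<lambda>x. _ * x"] cong: if_cong)
  have comm_i: "commutes_up_to 1 (mat \<i>) X" for X :: "complex^'n^'n"
    using mat_comm by (simp add: commutes_up_to_def)
  have ii: "mat \<i> ** mat \<i> = (- mat 1 :: complex^'n^'n)" "cadjoint (mat \<i>) = (- mat \<i> :: complex^'n^'n)"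
    by (auto simp add: vec_eq_iff matrix_matrix_mult_def mat_def if_distrib[of "\<lambda>x. x * _"] cong: if_cong)
  have ii': "signed_involution (-1) (mat \<i> :: complex^'n^'n)" by (simp add: signed_involution_def ii)
  have inv: "signed_involution (-1) (D (2 * k))" "signed_involution (-1) (D (2 * k + 1))"
    by (rule letter_signed_involution[OF D], simp)+
  have invA: "signed_involution 1 A"
    using signed_involution_mult[OF comm_i _ ii' inv(1)] by (simp add: A_def)
  have anti: "commutes_up_to (-1) (D (2 * k)) (D (2 * k + 1))"
    using letters_commute[OF D, of "2*k" "2*k+1"] by simp
  have invT: "signed_involution 1 (A ** D (2 * k + 1))"
    using signed_involution_mult[OF commutes_up_to_mult_left[OF comm_i anti] _ invA[unfolded A_def] inv(2)]
    by (simp add: A_def)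
  have commD: "commutes_up_to 1 (A ** D (2 * k + 1)) P"
    using commutes_up_to_mult_left[OF commutes_up_to_mult_left[OF comm_i] ] Suc.prems(3)[of "2*k"] Suc.prems(3)[of "2*k+1"]
    by (fastforce simp: A_def)
  have "commutes_up_to (1 * 1 * - 1) (D (2 * k)) (A ** D (2 * k + 1))"
    unfolding A_def by (intro commutes_up_to_mult_right anti commutes_up_to_sym[OF comm_i])
     (auto simp: commutes_up_to_def)
  then have S: "commutes_up_to (-1) (D (2 * k)) (A ** D (2 * k + 1))" by simp
  obtain P1 where P1: "hermitian_idempotent P1" "trace P = 2 * trace P1"
    "\<And>X. commutes_up_to 1 X P \<Longrightarrow> commutes_up_to 1 X (A ** D (2 * k + 1)) \<Longrightarrow> commutes_up_to 1 X P1"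
    using halve_idempotent[OF Suc.prems(2) invT commD S Suc.prems(3) inv(1)] by auto
  have "commutes_up_to 1 (D i) P1" if "i < 2 * k" for i
  proof (rule P1(3))
    have "commutes_up_to (1 * - 1 * - 1) (D i) (A ** D (2 * k + 1))"
      unfolding A_def
      by (intro commutes_up_to_mult_right commutes_up_to_sym[OF comm_i])
       (use letters_commute[OF D, of i "2*k"] letters_commute[OF D, of i "2*k+1"] that in auto)
    then show "commutes_up_to 1 (D i) (A ** D (2 * k + 1))" by simp
  qed (use that Suc.prems(3) in auto)
  then obtain m where "trace P1 = of_nat (2 ^ k * m)"
    using Suc.IH[OF clifford_mono[OF D] P1(1)] by auto
  then have "trace P = of_nat (2 ^ Suc k * m)" by (simp add: P1(2))
  then show ?case by blast
qed

lemma hermitian_idempotent_one: "hermitian_idempotent (mat 1)"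
  by (simp add: hermitian_idempotent_def)

lemma real_clifford_dvd:
  fixes D :: "nat \<Rightarrow> real^'n^'n"
  assumes "clifford (8 * b + 2 ^ c) D" "c \<le> 3"
  shows "2 ^ (4 * b + c + 1) dvd CARD('n)"
proof -
  obtain k where "trace (mat 1 :: real^'n^'n) = of_nat (2 ^ (4 * b + c + 1) * k)"
    using real_clifford_trace[OF assms hermitian_idempotent_one] commutes_up_to_one by blast
  then have "CARD('n) = 2 ^ (4 * b + c + 1) * k" unfolding trace_I of_nat_eq_iff .
  then show ?thesis by simp
qed

lemma complex_clifford_dvd:
  fixes D :: "nat \<Rightarrow> complex^'n^'n"
  assumes "clifford (2 * k) D"
  shows "2 ^ k dvd CARD('n)"
proof -
  obtain m where "trace (mat 1 :: complex^'n^'n) = of_nat (2 ^ k * m)"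
    using complex_clifford_trace[OF assms hermitian_idempotent_one] commutes_up_to_one by blast
  then have "CARD('n) = 2 ^ k * m" unfolding trace_I of_nat_eq_iff .
  then show ?thesis by simp
qed

section \<open>Anticommuting monomial matrices\<close>

text \<open>A family of anticommuting monomial matrices on the index set \<open>X\<close>: the \<open>i\<close>-th one maps the basis
  vector \<open>x\<close> to \<open>s i x\<close> times the basis vector \<open>p i x\<close>.\<close>

definition clifford_monomials ::
    "nat \<Rightarrow> 'x set \<Rightarrow> (nat \<Rightarrow> 'x \<Rightarrow> 'x) \<Rightarrow> (nat \<Rightarrow> 'x \<Rightarrow> 'a::rc_field) \<Rightarrow> bool" where
  "clifford_monomials K X p s \<longleftrightarrow>
     (\<forall>i<K. \<forall>x\<in>X. p i x \<in> X \<and> p i (p i x) = x \<and> s i (p i x) * s i x = - 1 \<and> conjugate (s i x) * s i x = 1) \<and>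
     (\<forall>i<K. \<forall>j<K. i \<noteq> j \<longrightarrow> (\<forall>x\<in>X. p i (p j x) = p j (p i x) \<and> s i (p j x) * s j x = - (s j (p i x) * s i x)))"

lemma clifford_monomialsI:
  assumes "\<And>i x. i < K \<Longrightarrow> x \<in> X \<Longrightarrow>
      p i x \<in> X \<and> p i (p i x) = x \<and> s i (p i x) * s i x = - 1 \<and> conjugate (s i x) * s i x = 1"
    and "\<And>i j x. i < K \<Longrightarrow> j < K \<Longrightarrow> i \<noteq> j \<Longrightarrow> x \<in> X \<Longrightarrow>
      p i (p j x) = p j (p i x) \<and> s i (p j x) * s j x = - (s j (p i x) * s i x)"
  shows "clifford_monomials K X p s"
  unfolding clifford_monomials_def using assms by blast

lemma clifford_monomialsD:
  assumes "clifford_monomials K X p s"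
  shows "i < K \<Longrightarrow> x \<in> X \<Longrightarrow> p i x \<in> X" "i < K \<Longrightarrow> x \<in> X \<Longrightarrow> p i (p i x) = x"
    "i < K \<Longrightarrow> x \<in> X \<Longrightarrow> s i (p i x) * s i x = - 1" "i < K \<Longrightarrow> x \<in> X \<Longrightarrow> conjugate (s i x) * s i x = 1"
    "i < K \<Longrightarrow> j < K \<Longrightarrow> i \<noteq> j \<Longrightarrow> x \<in> X \<Longrightarrow> p i (p j x) = p j (p i x)"
    "i < K \<Longrightarrow> j < K \<Longrightarrow> i \<noteq> j \<Longrightarrow> x \<in> X \<Longrightarrow> s i (p j x) * s j x = - (s j (p i x) * s i x)"
  using assms unfolding clifford_monomials_def by blast+

lemma clifford_monomials_transport:
  assumes "clifford_monomials K X p s" "bij_betw h Y X"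
  shows "clifford_monomials K Y (\<lambda>i y. inv_into Y h (p i (h y))) (\<lambda>i y. s i (h y))"
proof -
  note D = clifford_monomialsD[OF assms(1)]
  have h: "h y \<in> X" "inv_into Y h (h y) = y" if "y \<in> Y" for y
    using that assms(2) bij_betw_inv_into_left bij_betwE by metis+
  have g: "inv_into Y h x \<in> Y" "h (inv_into Y h x) = x" if "x \<in> X" for x
    using that assms(2) bij_betw_inv_into_right bij_betw_inv_into bij_betwE by metis+
  have hg: "h (inv_into Y h (p i (h y))) = p i (h y)" if "i < K" "y \<in> Y" for i y
    using g(2) D(1) h(1) that by simp
  show ?thesis
  proof (rule clifford_monomialsI, goal_cases)
    case (1 i y)
    then show ?case using D(1-4)[OF 1(1) h(1)[OF 1(2)]] g(1) h(2) by (simp add: hg)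
  next
    case (2 i j y)
    show ?case
      unfolding hg[OF 2(1,4)] hg[OF 2(2,4)] using D(5,6)[OF 2(1-3) h(1)[OF 2(4)]] by simp
  qed
qed

lemma clifford_monomials_matrices:
  assumes "clifford_monomials K (UNIV :: 'r::finite set) p (s :: nat \<Rightarrow> 'r \<Rightarrow> 'a::rc_field)"
  shows "\<exists>D :: nat \<Rightarrow> 'a^'r^'r. clifford K D"
proof -
  define D :: "nat \<Rightarrow> 'a^'r^'r" where "D i = (\<chi> a b. if a = p i b then s i b else 0)" for i
  have pp: "p i (p i x) = x" and sp: "s i (p i x) * s i x = - 1" and unit: "conjugate (s i x) * s i x = 1" if "i < K" for i x
    using clifford_monomialsD(2-4)[OF assms that] by simp_all
  have comm: "p i (p j x) = p j (p i x)" and anti: "s i (p j x) * s j x = - (s j (p i x) * s i x)"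
    if "i < K" "j < K" "i \<noteq> j" for i j x
    using assms that unfolding clifford_monomials_def by blast+
  have DD: "D i ** D j = (\<chi> a b. if a = p i (p j b) then s i (p j b) * s j b else 0)" for i j
    by (simp add: vec_eq_iff matrix_matrix_mult_def D_def if_distrib[of "\<lambda>x. _ * x"] cong: if_cong)
  have "D i ** D i = - mat 1" if "i < K" for i
    by (simp add: DD pp sp that vec_eq_iff mat_def)
  moreover have "D i ** D j = - (D j ** D i)" if "i < K" "j < K" "i \<noteq> j" for i j
    unfolding DD using comm[OF that] anti[OF that] by (simp add: vec_eq_iff)
  moreover have "cadjoint (D i) = - D i" if i: "i < K" for i
  proof -
    have "conjugate (s i x) = - s i (p i x)" for x
    proof -
      have "s i x \<noteq> 0" using unit[OF i, of x] by auto
      moreover have "conjugate (s i x) * s i x = - s i (p i x) * s i x" using unit[OF i, of x] sp[OF i, of x] by simp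
      ultimately show ?thesis by (metis mult_right_cancel)
    qed
    moreover have "b = p i a \<longleftrightarrow> a = p i b" for a b using pp[OF i] by metis
    ultimately show ?thesis by (auto simp: vec_eq_iff D_def pp[OF i])
  qed
  ultimately have "clifford K D" unfolding clifford_def skew_hermitian_def by blast
  then show ?thesis by blast
qed

text \<open>Using initial segments of the naturals as index sets makes the size a number rather than
  a type, so that it can vary in an induction; \<open>has_clifford_matrices\<close> returns to
  types.\<close>

definition has_clifford :: "'a::rc_field itself \<Rightarrow> nat \<Rightarrow> nat \<Rightarrow> bool" where
  "has_clifford _ K n \<longleftrightarrow> (\<exists>p s. clifford_monomials K {..<n} p (s :: nat \<Rightarrow> nat \<Rightarrow> 'a))"

lemma has_cliffordI:
  assumes "clifford_monomials K X p (s :: nat \<Rightarrow> 'x \<Rightarrow> 'a::rc_field)" "finite X" "card X = n"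
  shows "has_clifford TYPE('a) K n"
proof -
  obtain h where "bij_betw h {..<n} X"
    using assms(2,3) finite_same_card_bij[of "{..<n}" X] by auto
  then show ?thesis using clifford_monomials_transport[OF assms(1)] unfolding has_clifford_def by blast
qed

lemma has_clifford_matrices:
  assumes "has_clifford TYPE('a::rc_field) K CARD('r::finite)"
  shows "\<exists>D :: nat \<Rightarrow> 'a^'r^'r. clifford K D"
proof -
  obtain h where "bij_betw h (UNIV :: 'r set) {..<CARD('r)}"
    using finite_same_card_bij[of "UNIV :: 'r set" "{..<CARD('r)}"] by auto
  then show ?thesis
    using assms clifford_monomials_transport clifford_monomials_matrices unfolding has_clifford_def by blast
qed

text \<open>Block-diagonal repetition, which accounts for the odd factor of r.\<close>

lemma has_clifford_copies:
  assumes "has_clifford TYPE('a::rc_field) K n" shows "has_clifford TYPE('a) K (q * n)"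
proof -
  obtain p and s :: "nat \<Rightarrow> nat \<Rightarrow> 'a" where p: "clifford_monomials K {..<n} p s"
    using assms unfolding has_clifford_def by blast
  have "clifford_monomials K ({..<q} \<times> {..<n}) (\<lambda>i z. (fst z, p i (snd z))) (\<lambda>i z. s i (snd z))"
  proof (rule clifford_monomialsI, goal_cases)
    case (1 i z)
    then have "snd z \<in> {..<n}" by auto
    from clifford_monomialsD(1-4)[OF p 1(1) this] show ?case using 1 by (auto simp: prod_eq_iff)
  next
    case (2 i j z)
    then have "snd z \<in> {..<n}" by auto
    from clifford_monomialsD(5,6)[OF p 2(1-3) this] show ?case by simp
  qed
  then show ?thesis by (rule has_cliffordI) auto
qed

text \<open>With \<open>g\<close> and \<open>g'\<close> ranging over the two given families, and with the real \<open>2 \<times> 2\<close> matrices \<open>z\<close> (diagonal),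
  \<open>e\<close> (skew) and \<open>x = \<plusminus> z e\<close>, the new family consists of the tensor products \<open>g \<otimes> z \<otimes> 1\<close>, \<open>1 \<otimes> e \<otimes> 1\<close>
  and \<open>1 \<otimes> x \<otimes> g'\<close>.\<close>

lemma has_clifford_product:
  assumes "has_clifford TYPE('a::rc_field) K n" "has_clifford TYPE('a) L m"
  shows "has_clifford TYPE('a) (K + 1 + L) (2 * n * m)"
proof -
  obtain p and s :: "nat \<Rightarrow> nat \<Rightarrow> 'a" where p: "clifford_monomials K {..<n} p s"
    using assms unfolding has_clifford_def by blast
  obtain q and t :: "nat \<Rightarrow> nat \<Rightarrow> 'a" where q: "clifford_monomials L {..<m} q t"
    using assms unfolding has_clifford_def by blast
  define sg :: "bool \<Rightarrow> 'a" where "sg b = (if b then - 1 else 1)" for b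
  define P where "P i = (\<lambda>(x, b, y). if i < K then (p i x, b, y) else if i = K then (x, \<not> b, y)
    else (x, \<not> b, q (i - K - 1) y))" for i
  define S where "S i = (\<lambda>(x, b, y). if i < K then s i x * sg b else if i = K then sg b else t (i - K - 1) y)" for i
  have sg: "sg (\<not> b) = - sg b" "sg b * sg b = 1" "conjugate (sg b) = sg b" for b by (auto simp: sg_def)
  have p': "p i x < n" "p i (p i x) = x" "s i (p i x) * s i x = - 1" "conjugate (s i x) * s i x = 1"
    if "i < K" "x < n" for i x using clifford_monomialsD(1-4)[OF p] that by auto
  have q': "q i x < m" "q i (q i x) = x" "t i (q i x) * t i x = - 1" "conjugate (t i x) * t i x = 1"
    if "i < L" "x < m" for i x using clifford_monomialsD(1-4)[OF q] that by auto
  have pc: "p i (p j x) = p j (p i x)" "s i (p j x) * s j x = - (s j (p i x) * s i x)"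
    if "i < K" "j < K" "i \<noteq> j" "x < n" for i j x using p that unfolding clifford_monomials_def by blast+
  have qc: "q i (q j x) = q j (q i x)" "t i (q j x) * t j x = - (t j (q i x) * t i x)"
    if "i < L" "j < L" "i \<noteq> j" "x < m" for i j x using q that unfolding clifford_monomials_def by blast+
  have sg4: "(u * sg b) * (v * sg b) = u * v" for u v b by (metis sg(2) mult.assoc mult.left_commute mult.right_neutral)
  have ex: "\<exists>k. i = K + 1 + k \<and> k < L" if "K < i" "i < K + 1 + L" for i
    using that by (intro exI[of _ "i - K - 1"]) arith
  have "clifford_monomials (K + 1 + L) ({..<n} \<times> UNIV \<times> {..<m}) P S"
    unfolding clifford_monomials_def
  proof (intro conjI allI ballI impI)
    fix i z assume i: "i < K + 1 + L" and z: "z \<in> {..<n} \<times> (UNIV :: bool set) \<times> {..<m}"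
    obtain x b y where xy: "z = (x, b, y)" "x < n" "y < m" using z by auto
    consider "i < K" | "i = K" | k where "i = K + 1 + k" "k < L"
      using ex[of i] i by (meson linorder_cases)
    then have "P i z \<in> {..<n} \<times> UNIV \<times> {..<m} \<and> P i (P i z) = z \<and> S i (P i z) * S i z = - 1 \<and> conjugate (S i z) * S i z = 1"
    proof cases
      case 1
      then show ?thesis using p' xy by (simp add: P_def S_def sg4 sg conjugate_dist_mul)
    next
      case 2
      then show ?thesis using xy by (simp add: P_def S_def sg)
    next
      case 3
      then show ?thesis using q' xy by (simp add: P_def S_def)
    qed
    then show "P i z \<in> {..<n} \<times> UNIV \<times> {..<m}" "P i (P i z) = z" "S i (P i z) * S i z = - 1" "conjugate (S i z) * S i z = 1"
      by auto
  next
    fix i j z assume i: "i < K + 1 + L" and j: "j < K + 1 + L" and ij: "i \<noteq> j" and z: "z \<in> {..<n} \<times> (UNIV :: bool set) \<times> {..<m}"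
    obtain x b y where xy: "z = (x, b, y)" "x < n" "y < m" using z by auto
    \<comment> \<open>Pairs from different groups anticommute because z, e and x do; within one
      group the sign comes from the given family. The relation is symmetric, so i < j
      suffices.\<close>
    have *: "P i (P j z) = P j (P i z) \<and> S i (P j z) * S j z = - (S j (P i z) * S i z)" if "i < j" "j < K + 1 + L" for i j
    proof -
      consider "i < K" "j < K" | "i < K" "j = K" | l where "i < K" "j = K + 1 + l" "l < L"
        | l where "i = K" "j = K + 1 + l" "l < L" | k l where "i = K + 1 + k" "k < L" "j = K + 1 + l" "l < L"
      proof -
        have "i < K \<or> i = K \<or> (\<exists>k. i = K + 1 + k \<and> k < L)" "j < K \<or> j = K \<or> (\<exists>l. j = K + 1 + l \<and> l < L)"
          using ex[of i] ex[of j] less_linear[of i K] less_linear[of j K] less_trans[OF \<open>i < j\<close> \<open>j < K + 1 + L\<close>] \<open>j < K + 1 + L\<close>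
          by blast+
        then show thesis using \<open>i < j\<close> by (elim disjE exE conjE) (linarith | rule that; assumption)+
      qed
      then show ?thesis
      proof cases
        case 1
        then show ?thesis using pc[of i j x] xy \<open>i < j\<close> by (simp add: P_def S_def sg4)
      next
        case 2
        then show ?thesis using xy by (simp add: P_def S_def sg)
      next
        case 3
        then show ?thesis using xy by (simp add: P_def S_def sg)
      next
        case 4
        then show ?thesis using xy by (simp add: P_def S_def sg)
      next
        case 5
        then show ?thesis using qc[of k l y] xy \<open>i < j\<close> by (simp add: P_def S_def)
      qed
    qed
    show "P i (P j z) = P j (P i z)" "S i (P j z) * S j z = - (S j (P i z) * S i z)"
      using *[of i j] *[of j i] i j ij by (metis nat_neq_iff minus_minus)+
  qed
  then show ?thesis by (rule has_cliffordI) (auto simp: card_cartesian_product)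
qed

lemma has_clifford_zero: "has_clifford TYPE('a::rc_field) 0 1"
  unfolding has_clifford_def clifford_monomials_def by auto

lemma has_clifford_complex_one: "has_clifford TYPE(complex) 1 1"
  unfolding has_clifford_def clifford_monomials_def by (intro exI[of _ "\<lambda>_ x. x"] exI[of _ "\<lambda>_ _. \<i>"]) auto

text \<open>Integer tables and bounded quantifiers over lists make the relations executable;
  integers are fixed by conjugation.\<close>

lemma has_clifford_table:
  assumes "\<forall>i\<in>set [0..<K]. \<forall>x\<in>set [0..<n]. p ! i ! x < n \<and> p ! i ! (p ! i ! x) = x \<and>
      s ! i ! (p ! i ! x) * s ! i ! x = - 1 \<and> s ! i ! x * s ! i ! x = (1::int)"
    and "\<forall>i\<in>set [0..<K]. \<forall>j\<in>set [0..<K]. i \<noteq> j \<longrightarrow> (\<forall>x\<in>set [0..<n]. p ! i ! (p ! j ! x) = p ! j ! (p ! i ! x) \<and>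
      s ! i ! (p ! j ! x) * s ! j ! x = - (s ! j ! (p ! i ! x) * s ! i ! x))"
  shows "has_clifford TYPE('a::rc_field) K n"
proof -
  have conj: "conjugate (of_int k :: 'a) = of_int k" for k
    using conjugate_of_real[of "of_int k", where 'a='a] by simp
  have "clifford_monomials K {..<n} (\<lambda>i x. p ! i ! x) (\<lambda>i x. of_int (s ! i ! x) :: 'a)"
  proof (rule clifford_monomialsI, goal_cases)
    case (1 i x)
    then show ?case using assms(1)
      unfolding conj of_int_mult[symmetric] by (metis atLeast0LessThan lessThan_iff of_int_1 of_int_minus set_upt)
  next
    case (2 i j x)
    then show ?case using assms(2)
      unfolding of_int_mult[symmetric] of_int_minus[symmetric] of_int_eq_iff
      by (metis atLeast0LessThan lessThan_iff set_upt)
  qed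
  then show ?thesis unfolding has_clifford_def by blast
qed

text \<open>Left multiplication by the imaginary units of the quaternions and of the octonions.\<close>

lemma has_clifford_quaternion: "has_clifford TYPE('a::rc_field) 3 4"
  by (rule has_clifford_table[where p = "[[1, 0, 3, 2], [2, 3, 0, 1], [3, 2, 1, 0]]" and s = "[[1, -1, 1, -1], [1, -1, -1, 1], [1, 1, -1, -1]]"]; code_simp)

lemma has_clifford_octonion: "has_clifford TYPE('a::rc_field) 7 8"
  by (rule has_clifford_table[where p = "[[1, 0, 3, 2, 5, 4, 7, 6], [2, 3, 0, 1, 6, 7, 4, 5], [3, 2, 1, 0, 7, 6, 5, 4], [4, 5, 6, 7, 0, 1, 2, 3], [5, 4, 7, 6, 1, 0, 3, 2], [6, 7, 4, 5, 2, 3, 0, 1], [7, 6, 5, 4, 3, 2, 1, 0]]" and s = "[[1, -1, 1, -1, 1, -1, -1, 1], [1, -1, -1, 1, 1, 1, -1, -1], [1, 1, -1, -1, 1, -1, 1, -1], [1, -1, -1, -1, -1, 1, 1, 1], [1, 1, -1, 1, -1, -1, -1, 1], [1, 1, 1, -1, -1, 1, -1, -1], [1, -1, 1, 1, -1, -1, 1, -1]]"]; code_simp)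

lemma has_clifford_base:
  assumes "c \<le> 3" shows "has_clifford TYPE('a::rc_field) (2 ^ c - 1) (2 ^ c)"
proof -
  consider "c = 0" | "c = 1" | "c = 2" | "c = 3" using assms by linarith
  then show ?thesis
    using has_clifford_zero has_clifford_product[OF has_clifford_zero has_clifford_zero]
      has_clifford_quaternion has_clifford_octonion
    by cases auto
qed

text \<open>A product with the octonion family adds 7 + 1 generators and multiplies the size by 2 *
  8, matching the period of the trace bound.\<close>

lemma has_clifford_real:
  assumes "c \<le> 3" shows "has_clifford TYPE('a::rc_field) (8 * b + 2 ^ c - 1) (2 ^ (4 * b + c))"
proof (induction b)
  case 0
  then show ?case using has_clifford_base[OF assms] by simp
next
  case (Suc b)
  have "7 + 1 + (8 * b + 2 ^ c - 1) = 8 * Suc b + 2 ^ c - (1::nat)"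
    by (simp add: Suc_diff_le[symmetric])
  moreover have "2 * 8 * 2 ^ (4 * b + c) = (2 ^ (4 * Suc b + c) :: nat)" by (simp add: power_add)
  ultimately show ?case using has_clifford_product[OF has_clifford_octonion Suc] by metis
qed

text \<open>The scalar i is already one generator in size 1; each product with it adds two
  generators and doubles the size.\<close>

lemma has_clifford_complex: "has_clifford TYPE(complex) (2 * k + 1) (2 ^ k)"
proof (induction k)
  case 0
  then show ?case using has_clifford_complex_one by simp
next
  case (Suc k)
  then show ?case using has_clifford_product[OF has_clifford_complex_one Suc] by simp
qed

section \<open>Skew-Hermitian simplices\<close>

text \<open>Where anticommutators are scalar, -1/2 times them is an inner product in which Clifford
  generators are orthonormal. Passing between simplices and generators is then a Gram matrix
  computation in Euclidean space.\<close>

definition anticommutator :: "'a::rc_field^'n^'n \<Rightarrow> 'a^'n^'n \<Rightarrow> 'a^'n^'n" where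
  "anticommutator A B = A ** B + B ** A"

lemma anticommutator_commute: "anticommutator A B = anticommutator B A"
  by (simp add: anticommutator_def add.commute)

lemma anticommutator_self: "anticommutator A A = (2 * k) *\<^sub>R mat 1 \<longleftrightarrow> A ** A = k *\<^sub>R mat 1"
  by (simp add: anticommutator_def flip: scaleR_2 scaleR_scaleR)

lemma anticommutator_combination:
  assumes "anticommutator A A' = p *\<^sub>R mat 1" "anticommutator A C = q *\<^sub>R mat 1"
    "anticommutator A' C = q' *\<^sub>R mat 1" "anticommutator C C = w *\<^sub>R mat 1"
  shows "anticommutator (x *\<^sub>R A + y *\<^sub>R C) (x' *\<^sub>R A' + y' *\<^sub>R C) =
    (x * x' * p + x * y' * q + y * x' * q' + y * y' * w) *\<^sub>R mat 1"
proof -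
  have "anticommutator (x *\<^sub>R A + y *\<^sub>R C) (x' *\<^sub>R A' + y' *\<^sub>R C) =
    (x * x') *\<^sub>R anticommutator A A' + (x * y') *\<^sub>R anticommutator A C +
    (y * x') *\<^sub>R anticommutator A' C + (y * y') *\<^sub>R anticommutator C C"
    by (simp add: anticommutator_def matrix_ring scaleR_add_right ac_simps)
  then show ?thesis by (simp add: assms scaleR_add_left)
qed

lemma anticommutator_sum: "anticommutator (\<Sum>i\<in>S. f i) B = (\<Sum>i\<in>S. anticommutator (f i) B)"
  by (simp add: anticommutator_def matrix_sum_left matrix_sum_right sum.distrib)

lemma clifford_anticommutator_iff:
  "clifford K D \<longleftrightarrow> (\<forall>i<K. cadjoint (D i) = - D i) \<and>
    (\<forall>i<K. \<forall>j<K. anticommutator (D i) (D j) = (if i = j then - 2 else 0) *\<^sub>R mat 1)"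
proof -
  have "D i ** D i = - mat 1 \<longleftrightarrow> anticommutator (D i) (D i) = (- 2) *\<^sub>R mat 1" for i
    using anticommutator_self[of "D i" "-1"] by simp
  moreover have "D i ** D j = - (D j ** D i) \<longleftrightarrow> anticommutator (D i) (D j) = 0" for i j
    by (simp add: anticommutator_def eq_neg_iff_add_eq_0)
  ultimately show ?thesis unfolding clifford_def skew_hermitian_def
    by (smt (verit) scale_zero_left)
qed

lemma rho_simplex_skew_iff:
  assumes "\<forall>i\<in>{1..n-1}. cadjoint (B i) = - (B i :: 'a::rc_field^'r^'r)"
  shows "rho_simplex n B \<longleftrightarrow> 3 \<le> n \<and> (\<forall>i\<in>{1..n-1}. \<forall>j\<in>{1..n-1}.
    anticommutator (B i) (B j) = (if i = j then - 2 else 2 / (real n - 2)) *\<^sub>R mat 1)"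
proof -
  have "unitary_mat (B i) \<longleftrightarrow> anticommutator (B i) (B i) = (- 2) *\<^sub>R mat 1" if "i \<in> {1..n-1}" for i
    using anticommutator_self[of "B i" "-1"] assms that
    by (simp add: unitary_mat_def matrix_ring minus_equation_iff[of _ "mat 1"]) (metis)
  moreover have "cadjoint (B i) ** B j + cadjoint (B j) ** B i = - (2 / (real n - 2)) *\<^sub>R mat 1 \<longleftrightarrow>
      anticommutator (B i) (B j) = (2 / (real n - 2)) *\<^sub>R mat 1" if "i \<in> {1..n-1}" "j \<in> {1..n-1}" for i j
  proof -
    have "cadjoint (B i) ** B j + cadjoint (B j) ** B i = - anticommutator (B i) (B j)"
      using assms that by (simp add: anticommutator_def matrix_ring)
    then show ?thesis by simp
  qed
  ultimately show ?thesis unfolding rho_simplex_def by (smt (verit))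
qed

text \<open>The first m = n - 2 vertices are made orthonormal by one common shift along the last
  vertex and one scaling: D i = x (B (i + 1) - g B (n - 1)).\<close>

lemma clifford_of_simplex:
  fixes B :: "nat \<Rightarrow> 'a::rc_field^'r^'r"
  assumes "rho_simplex n B" and skew: "\<forall>i\<in>{1..n-1}. cadjoint (B i) = - B i"
  shows "\<exists>D :: nat \<Rightarrow> 'a^'r^'r. clifford (n - 2) D"
proof -
  have n: "3 \<le> n" using assms(1) by (simp add: rho_simplex_def)
  define m where "m = real n - 2"
  have m: "m > 0" using n by (simp add: m_def)
  define s where "s = sqrt (m + 1)"
  have s: "s * s = m + 1" "s > 0" using m by (simp_all add: s_def)
  define x where "x = sqrt m / s"
  have xx: "x * x = m / (m + 1)" using m s(1) by (simp add: x_def flip: s(1))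
  \<comment> \<open>The positive root of g^2 + 2 g / m = 1 / m, the condition that the shifted
    vertices be orthogonal. Their squared length is then 1 + 1 / m, which x normalises.\<close>
  define g where "g = (s - 1) / m"
  define y where "y = - g * x"
  have B: "anticommutator (B i) (B j) = (if i = j then - 2 else 2 / m) *\<^sub>R mat 1"
    if "i \<in> {1..n-1}" "j \<in> {1..n-1}" for i j
    using assms that rho_simplex_skew_iff[OF skew] by (auto simp: m_def)
  define D where "D i = x *\<^sub>R B (Suc i) + y *\<^sub>R B (n - 1)" for i
  have "clifford (n - 2) D"
    unfolding clifford_anticommutator_iff
  proof (intro conjI allI impI)
    fix i j assume ij: "i < n - 2" "j < n - 2"
    show "cadjoint (D i) = - D i" using ij skew by (simp add: D_def cadjoint_simps)
    define p where "p = (if i = j then - 2 else 2 / m)"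
    have "anticommutator (D i) (D j) =
      (x * x * p + x * y * (2 / m) + y * x * (2 / m) + y * y * (- 2)) *\<^sub>R mat 1"
      unfolding D_def by (rule anticommutator_combination) (use ij B in \<open>auto simp: p_def\<close>)
    also have "x * x * p + x * y * (2 / m) + y * x * (2 / m) + y * y * (- 2) = (x * x) * (p - (4 * g / m + 2 * g * g))"
      unfolding y_def by (simp add: right_diff_distrib distrib_left)
    also have "4 * g / m + 2 * g * g = 2 * (s * s - 1) / (m * m)"
      unfolding g_def using m by (simp add: divide_simps) (simp add: algebra_simps)
    also have "\<dots> = 2 / m"
      unfolding s(1) using m by (simp add: field_simps)
    also have "(x * x) * (p - 2 / m) = (if i = j then - 2 else 0)"
    proof -
      define u where "u = (m + 1) / m"
      have "p - 2 / m = (if i = j then - 2 * u else 0)" using m by (simp add: p_def u_def field_simps)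
      then have "(x * x) * (p - 2 / m) = (if i = j then - 2 * (x * x * u) else 0)" by simp
      moreover have "x * x * u = 1" using m by (simp add: xx u_def)
      ultimately show ?thesis by (simp only: mult_1_right)
    qed
    finally show "anticommutator (D i) (D j) = (if i = j then - 2 else 0) *\<^sub>R mat 1" .
  qed
  then show ?thesis by blast
qed

text \<open>A regular simplex in an m-dimensional space with orthonormal basis D and Z the sum of
  the basis: one vertex is c Z, the others are a D i + b Z. Unit length and mutual products -1 / m
  amount to c^2 m = 1, a^2 = 1 + 1 / m, 2 a b + m b^2 = -1 / m and c a + c b m = -1 / m.\<close>

lemma simplex_of_clifford:
  fixes D :: "nat \<Rightarrow> 'a::rc_field^'r^'r"
  assumes "clifford (n - 2) D" and n: "3 \<le> n"
  shows "\<exists>B :: nat \<Rightarrow> 'a^'r^'r. rho_simplex n B \<and> (\<forall>i\<in>{1..n-1}. skew_hermitian (B i))"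
proof -
  define m where "m = real n - 2"
  have m: "m > 0" "real (n - 2) = m" using n by (simp_all add: m_def)
  define s where "s = sqrt (m + 1)"
  have s: "s * s = m + 1" using m by (simp add: s_def)
  define t where "t = sqrt m"
  have t: "t * t = m" "t > 0" using m by (simp_all add: t_def)
  define a where "a = s / t"
  define b where "b = (1 - s) / (t * m)"
  define c where "c = - 1 / t"
  have D: "anticommutator (D i) (D j) = (if i = j then - 2 else 0) *\<^sub>R mat 1" if "i < n - 2" "j < n - 2" for i j
    using assms that unfolding clifford_anticommutator_iff by blast
  have skew: "cadjoint (D i) = - D i" if "i < n - 2" for i
    using assms that unfolding clifford_anticommutator_iff by blast
  define Z where "Z = (\<Sum>k<n-2. D k)"
  have DZ: "anticommutator (D i) Z = (- 2) *\<^sub>R mat 1" if "i < n - 2" for i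
  proof -
    have "anticommutator (D i) Z = (\<Sum>k<n-2. anticommutator (D i) (D k))"
      unfolding Z_def anticommutator_commute[of "D i"] by (rule anticommutator_sum)
    also have "\<dots> = (\<Sum>k<n-2. if k = i then (- 2) *\<^sub>R mat 1 else 0)"
      by (rule sum.cong) (use D that in auto)
    finally show ?thesis using that by simp
  qed
  have "anticommutator Z Z = (\<Sum>k<n-2. anticommutator (D k) Z)"
    using anticommutator_sum[of D "{..<n-2}" Z] by (simp only: Z_def)
  also have "\<dots> = (\<Sum>k<n-2. (- 2) *\<^sub>R mat 1)" by (rule sum.cong) (use DZ in auto)
  also have "\<dots> = (- 2 * m) *\<^sub>R mat 1"
    by (simp only: sum_constant_scaleR card_lessThan m(2) scaleR_scaleR mult.commute)
  finally have ZZ: "anticommutator Z Z = (- 2 * m) *\<^sub>R mat 1" .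
  \<comment> \<open>The zero multiple of \<open>D 0\<close> gives the last vertex the shape expected
    by \<open>anticommutator_combination\<close>. Vertices count from 1 and generators from 0, hence
    \<open>D (i - 1)\<close>.\<close>
  define B where "B i = (if i = n - 1 then 0 *\<^sub>R D 0 + c *\<^sub>R Z else a *\<^sub>R D (i - 1) + b *\<^sub>R Z)" for i
  have Z_skew: "cadjoint Z = - Z"
    unfolding Z_def cadjoint_sum sum_negf[symmetric] by (rule sum.cong) (use skew in auto)
  have B_skew: "\<forall>i\<in>{1..n-1}. cadjoint (B i) = - B i"
    using skew by (auto simp: B_def cadjoint_simps Z_skew)
  have ab: "4 * (a * b) + 2 * m * (b * b) = - 2 / m"
  proof -
    have "4 * (a * b) + 2 * m * (b * b) = (4 * s * (1 - s) + 2 * (1 - s) * (1 - s)) / ((t * t) * m)"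
      using m t(2) unfolding a_def b_def by (simp add: divide_simps)
    also have "4 * s * (1 - s) + 2 * (1 - s) * (1 - s) = 2 - 2 * (s * s)" by (simp add: algebra_simps)
    also have "(2 - 2 * (s * s)) / ((t * t) * m) = - 2 / m" unfolding s t using m by (simp add: field_simps)
    finally show ?thesis .
  qed
  have aa: "a * a = (m + 1) / m" using m by (simp add: a_def t s)
  have ac: "c * a + c * b * m = - 1 / m"
  proof -
    have "c * a = - s / (t * t)" by (simp add: a_def c_def)
    moreover have "c * b * m = (s - 1) / (t * t)" using m(1) t(2) by (simp add: b_def c_def field_simps)
    ultimately have "c * a + c * b * m = - s / (t * t) + (s - 1) / (t * t)" by simp
    also have "\<dots> = - 1 / m" by (simp add: t(1) flip: add_divide_distrib diff_divide_distrib)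
    finally show ?thesis .
  qed
  have cc: "c * c * m = 1"
  proof -
    have "c * c = 1 / (t * t)" by (simp add: c_def)
    then show ?thesis using m(1) by (simp add: t(1))
  qed
  have "anticommutator (B i) (B j) = (if i = j then - 2 else 2 / m) *\<^sub>R mat 1"
    if ij: "i \<in> {1..n-1}" "j \<in> {1..n-1}" for i j
  proof -
    have 0: "0 < n - 2" using n by simp
    have DD: "anticommutator (D i) (D j) = (if i = j then - 2 else 0) *\<^sub>R mat 1" if "i < n - 2" "j < n - 2" for i j
      by (rule D[OF that])
    note comb = anticommutator_combination[OF DD DZ DZ ZZ]
    consider "i = n - 1" "j = n - 1" | "i = n - 1" "j \<noteq> n - 1" | "i \<noteq> n - 1" "j = n - 1" | "i \<noteq> n - 1" "j \<noteq> n - 1"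
      by blast
    then show ?thesis
    proof cases
      case 1
      then show ?thesis using comb[OF 0 0 0 0, of 0 c 0 c] cc by (simp add: B_def mult.assoc)
    next
      case 2
      then have "j - 1 < n - 2" using ij by auto
      moreover have "0 * a * (if 0 = j - 1 then - 2 else 0) + 0 * b * (- 2) + c * a * (- 2) + c * b * (- 2 * m) = 2 / m"
        using ac by (simp add: algebra_simps)
      ultimately show ?thesis using comb[of 0 "j - 1" 0 c a b] 0 2 by (simp add: B_def)
    next
      case 3
      then have "i - 1 < n - 2" using ij by auto
      moreover have "a * 0 * (if i - 1 = 0 then - 2 else 0) + a * c * (- 2) + b * 0 * (- 2) + b * c * (- 2 * m) = 2 / m"
        using ac by (simp add: algebra_simps)
      ultimately show ?thesis using comb[of "i - 1" 0 a b 0 c] 0 3 by (simp add: B_def)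
    next
      case 4
      then have i: "i - 1 < n - 2" "j - 1 < n - 2" "i - 1 = j - 1 \<longleftrightarrow> i = j" using ij by auto
      have "anticommutator (B i) (B j) = (a * a * (if i - 1 = j - 1 then - 2 else 0) + a * b * (- 2) + b * a * (- 2) + b * b * (- 2 * m)) *\<^sub>R mat 1"
        using comb[of "i - 1" "j - 1" a b a b] i(1,2) 4 by (simp add: B_def)
      also have "a * a * (if i - 1 = j - 1 then - 2 else 0) + a * b * (- 2) + b * a * (- 2) + b * b * (- 2 * m) =
         a * a * (if i = j then - 2 else 0) - (4 * (a * b) + 2 * m * (b * b))"
        unfolding i(3) by (simp add: algebra_simps)
      also have "\<dots> = (if i = j then - 2 else 2 / m)"
        unfolding ab aa using m(1) by (simp add: field_simps)
      finally show ?thesis .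
    qed
  qed
  then have "rho_simplex n B" unfolding rho_simplex_skew_iff[OF B_skew] using n by (simp add: m_def)
  with B_skew show ?thesis unfolding skew_hermitian_def by blast
qed

lemma skew_simplex_iff_clifford:
  assumes "3 \<le> n"
  shows "(\<exists>B :: nat \<Rightarrow> 'a::rc_field^'r^'r. rho_simplex n B \<and> (\<forall>i\<in>{1..n-1}. skew_hermitian (B i))) \<longleftrightarrow>
    (\<exists>D :: nat \<Rightarrow> 'a^'r^'r. clifford (n - 2) D)"
  using clifford_of_simplex simplex_of_clifford assms unfolding skew_hermitian_def by blast

section \<open>Radon-Hurwitz numbers\<close>

definition similarity_space :: "('a::rc_field^'r^'r) set \<Rightarrow> bool" where
  "similarity_space S \<longleftrightarrow> subspace S \<and> (\<forall>A\<in>S. \<exists>c V. unitary_mat V \<and> A = (\<chi> i j. c * V $ i $ j))"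

text \<open>Links matrix products to the Euclidean structure of the matrix space, from which
  orthonormal bases and real dimensions are taken.\<close>

lemma trace_adjoint_mult:
  "trace (cadjoint A ** B + cadjoint B ** A) = of_real (2 * (A \<bullet> B))" for A B :: "'a::rc_field^'r^'r"
proof -
  have "trace (cadjoint A ** B + cadjoint B ** A) =
      (\<Sum>i\<in>UNIV. \<Sum>k\<in>UNIV. conjugate (A $ k $ i) * B $ k $ i + conjugate (B $ k $ i) * A $ k $ i)"
    by (simp add: trace_def matrix_matrix_mult_def sum.distrib)
  also have "\<dots> = (\<Sum>i\<in>UNIV. \<Sum>k\<in>UNIV. of_real (2 * (A $ k $ i \<bullet> B $ k $ i)))"
    by (simp only: conjugate_mult_add of_real_def)
  also have "\<dots> = of_real (2 * (A \<bullet> B))"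
    by (subst sum.swap) (simp add: inner_vec_def sum_distrib_left)
  finally show ?thesis .
qed

lemma inner_of_adjoint_mult:
  fixes A B :: "'a::rc_field^'r^'r"
  assumes "cadjoint A ** B + cadjoint B ** A = t *\<^sub>R mat 1"
  shows "2 * (A \<bullet> B) = t * real CARD('r)"
proof -
  have "(of_real (2 * (A \<bullet> B)) :: 'a) = of_real (t * real CARD('r))"
    using trace_adjoint_mult[of A B] by (simp add: assms trace_scaleR trace_I)
  then show ?thesis by (simp only: of_real_eq_iff)
qed

text \<open>Polarisation: the adjoint of a multiple of a unitary times itself is scalar, and this
  holds for A, B and A + B. Taking traces identifies the scalar.\<close>

lemma similarity_space_gram:
  assumes S: "similarity_space S" and A: "A \<in> S" and B: "(B :: 'a::rc_field^'r^'r) \<in> S"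
  shows "cadjoint A ** B + cadjoint B ** A = (2 * (A \<bullet> B) / real CARD('r)) *\<^sub>R mat 1"
proof -
  have scalar: "\<exists>t. cadjoint A ** A = t *\<^sub>R mat 1" if A: "A \<in> S" for A
  proof -
    obtain c V where V: "unitary_mat V" and A: "A = (\<chi> i j. c * V $ i $ j)"
      using S A unfolding similarity_space_def by blast
    have "cadjoint A ** A = (\<chi> i j. conjugate c * c * (cadjoint V ** V) $ i $ j)"
      by (simp add: A vec_eq_iff matrix_matrix_mult_def sum_distrib_left conjugate_dist_mul ac_simps)
    then have "cadjoint A ** A = (norm c)\<^sup>2 *\<^sub>R mat 1"
      using V by (simp add: unitary_mat_def conjugate_mult_self vec_eq_iff mat_def scaleR_conv_of_real[where 'a='a])
    then show ?thesis by blast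
  qed
  have "A + B \<in> S" using S A B unfolding similarity_space_def by (blast intro: subspace_add)
  then obtain t u v where t: "cadjoint A ** A = t *\<^sub>R mat 1" "cadjoint B ** B = u *\<^sub>R mat 1"
    "cadjoint (A + B) ** (A + B) = v *\<^sub>R mat 1"
    using scalar A B by meson
  have "cadjoint A ** B + cadjoint B ** A = cadjoint (A + B) ** (A + B) - cadjoint A ** A - cadjoint B ** B"
    by (simp add: cadjoint_add matrix_ring)
  then have *: "cadjoint A ** B + cadjoint B ** A = (v - t - u) *\<^sub>R mat 1"
    by (simp add: t scaleR_diff_left)
  then show ?thesis using inner_of_adjoint_mult[OF *] by simp
qed

text \<open>An orthonormal basis, rescaled, consists of unitaries C i. Multiplying all of them on
  the left by the adjoint of C 0 turns C 0 into the identity and the others into anticommuting skew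
  matrices, which costs one member.\<close>

lemma clifford_of_similarity_space:
  fixes S :: "('a::rc_field^'r^'r) set"
  assumes S: "similarity_space S" and m: "1 \<le> m" "m \<le> dim S"
  shows "\<exists>D :: nat \<Rightarrow> 'a^'r^'r. clifford (m - 1) D"
proof -
  obtain E where E: "E \<subseteq> S" "pairwise orthogonal E" "\<And>x. x \<in> E \<Longrightarrow> norm x = 1" "independent E" "card E = dim S"
    using orthonormal_basis_subspace[of S] S unfolding similarity_space_def by metis
  have "finite E" by (rule independent_imp_finite[OF E(4)])
  then obtain h where h: "bij_betw h {0..<card E} E" using ex_bij_betw_nat_finite by blast
  \<comment> \<open>A member of S of Frobenius norm 1 is 1 / sqrt r times a unitary, where r is the
    matrix size.\<close>
  define C where "C i = sqrt (real CARD('r)) *\<^sub>R h i" for i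
  have hE: "h i \<in> E" if "i < m" for i using bij_betwE[OF h] that m(2) E(5) by auto
  have C: "cadjoint (C i) ** C j + cadjoint (C j) ** C i = (if i = j then 2 else 0) *\<^sub>R mat 1" if "i < m" "j < m" for i j
  proof -
    have "cadjoint (h i) ** h j + cadjoint (h j) ** h i = (2 * (h i \<bullet> h j) / real CARD('r)) *\<^sub>R mat 1"
      by (rule similarity_space_gram[OF S]) (use hE E(1) that in auto)
    moreover have "h i \<bullet> h j = (if i = j then 1 else 0)"
    proof (cases "i = j")
      case False
      then have "h i \<noteq> h j" using h that m(2) E(5) by (auto simp: bij_betw_def inj_on_def)
      then show ?thesis using E(2) hE that False by (simp add: pairwise_def orthogonal_def)
    qed (use E(3)[OF hE[OF that(1)]] in \<open>simp add: norm_eq_1\<close>)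
    ultimately have "real CARD('r) *\<^sub>R (cadjoint (h i) ** h j + cadjoint (h j) ** h i) = (if i = j then 2 else 0) *\<^sub>R mat 1"
      by simp
    then show ?thesis by (simp add: C_def cadjoint_simps matrix_ring scaleR_add_right)
  qed
  have unit: "cadjoint (C i) ** C i = mat 1" if "i < m" for i
    using C[OF that that] by (simp flip: scaleR_2)
  have C0: "C 0 ** cadjoint (C 0) = mat 1"
    using unit[of 0] m(1) matrix_left_right_inverse by auto
  have skew: "cadjoint (C i) ** C j = - (cadjoint (C j) ** C i)" if "i < m" "j < m" "i \<noteq> j" for i j
    using C[OF that(1,2)] that(3) by (simp add: eq_neg_iff_add_eq_0)
  define D where "D i = cadjoint (C 0) ** C (Suc i)" for i
  have D_skew: "cadjoint (D i) = - D i" if "i < m - 1" for i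
    unfolding D_def cadjoint_mult cadjoint_cadjoint by (rule skew) (use that in auto)
  have DD: "D i ** D j = - (cadjoint (C (Suc i)) ** C (Suc j))" if "i < m - 1" for i j
  proof -
    have "cadjoint (D i) ** D j = cadjoint (C (Suc i)) ** (C 0 ** cadjoint (C 0)) ** C (Suc j)"
      by (simp add: D_def cadjoint_mult matrix_mul_assoc)
    then have "cadjoint (D i) ** D j = cadjoint (C (Suc i)) ** C (Suc j)" by (simp add: C0)
    then have "- (D i ** D j) = cadjoint (C (Suc i)) ** C (Suc j)" by (simp add: D_skew[OF that] matrix_minus_left)
    then show ?thesis by (metis minus_minus)
  qed
  have "clifford (m - 1) D"
    unfolding clifford_def skew_hermitian_def
  proof (intro conjI allI impI)
    fix i assume i: "i < m - 1"
    then show "cadjoint (D i) = - D i" by (rule D_skew)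
    show "D i ** D i = - mat 1" using DD[OF i, of i] unit[of "Suc i"] i by simp
    fix j assume j: "j < m - 1" "i \<noteq> j"
    show "D i ** D j = - (D j ** D i)"
      unfolding DD[OF i] DD[OF j(1)] by (rule arg_cong[where f = uminus], rule skew) (use i j in auto)
  qed
  then show ?thesis by blast
qed

text \<open>Adjoining the identity to D gives F, and in the product of a real combination with its
  adjoint all mixed terms cancel, leaving the sum of the squared coefficients.\<close>

lemma similarity_space_of_clifford:
  fixes D :: "nat \<Rightarrow> 'a::rc_field^'r^'r"
  assumes D: "clifford (m - 1) D" and m: "1 \<le> m"
  shows "\<exists>S :: ('a^'r^'r) set. similarity_space S \<and> dim S = m"
proof -
  define F where "F i = (if i = 0 then mat 1 else D (i - 1))" for i
  have F: "cadjoint (F i) ** F j + cadjoint (F j) ** F i = (if i = j then 2 else 0) *\<^sub>R mat 1" if "i < m" "j < m" for i j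
  proof -
    have adj: "cadjoint (D (k - 1)) = - D (k - 1)" if "k < m" "k \<noteq> 0" for k
      using D that unfolding clifford_anticommutator_iff by auto
    have anti: "D (i - 1) ** D (j - 1) + D (j - 1) ** D (i - 1) = (if i = j then - 2 else 0) *\<^sub>R mat 1" if "i \<noteq> 0" "j \<noteq> 0"
      using D that \<open>i < m\<close> \<open>j < m\<close> unfolding clifford_anticommutator_iff anticommutator_def by auto
    have "cadjoint (F i) ** F j + cadjoint (F j) ** F i = - (D (i - 1) ** D (j - 1) + D (j - 1) ** D (i - 1))" if "i \<noteq> 0" "j \<noteq> 0"
      using that adj \<open>i < m\<close> \<open>j < m\<close> by (simp add: F_def matrix_ring)
    then show ?thesis using anti adj that by (cases "i = 0"; cases "j = 0") (auto simp: F_def scaleR_2)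
  qed
  have inner: "F i \<bullet> F j = (if i = j then real CARD('r) else 0)" if "i < m" "j < m" for i j
    using inner_of_adjoint_mult[OF F[OF that]] by auto
  have inj: "inj_on F {..<m}"
    by (rule inj_onI) (metis inner lessThan_iff of_nat_eq_0_iff zero_less_card_finite less_irrefl)
  define S where "S = span (F ` {..<m})"
  have "pairwise orthogonal (F ` {..<m})" "0 \<notin> F ` {..<m}"
    using inner by (auto simp: pairwise_def orthogonal_def) (metis inner_zero_left of_nat_eq_0_iff zero_less_card_finite less_irrefl)
  then have "independent (F ` {..<m})" by (rule pairwise_orthogonal_independent)
  then have dim: "dim S = m" by (simp add: S_def dim_eq_card_independent card_image inj)
  have "\<exists>c V. unitary_mat V \<and> A = (\<chi> i j. c * V $ i $ j)" if A: "A \<in> S" for A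
  proof -
    obtain u where "A = (\<Sum>v\<in>F ` {..<m}. u v *\<^sub>R v)"
      using A unfolding S_def by (subst (asm) span_finite) auto
    then have A: "A = (\<Sum>i<m. u (F i) *\<^sub>R F i)" by (simp add: sum.reindex inj)
    define x where "x i = u (F i)" for i
    define t where "t = (\<Sum>i<m. x i * x i)"
    have AA: "cadjoint A ** A = (\<Sum>i<m. \<Sum>j<m. (x i * x j) *\<^sub>R (cadjoint (F i) ** F j))"
      unfolding A x_def cadjoint_sum matrix_sum_left
      by (simp only: matrix_sum_right cadjoint_scaleR matrix_scaleR_left matrix_scaleR_right scaleR_scaleR mult.commute)
    also have "\<dots> = (\<Sum>i<m. \<Sum>j<m. (x i * x j) *\<^sub>R (cadjoint (F j) ** F i))"
      by (subst sum.swap) (simp only: mult.commute)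
    finally have "cadjoint A ** A + cadjoint A ** A =
        (\<Sum>i<m. \<Sum>j<m. (x i * x j) *\<^sub>R (cadjoint (F i) ** F j + cadjoint (F j) ** F i))"
      using AA by (simp only: scaleR_add_right sum.distrib)
    also have "\<dots> = (\<Sum>i<m. \<Sum>j<m. if j = i then (2 * (x i * x i)) *\<^sub>R mat 1 else 0)"
      by (intro sum.cong refl) (use F in auto)
    also have "\<dots> = (2 * t) *\<^sub>R mat 1"
      by (simp add: t_def sum_distrib_left scaleR_sum_left)
    finally have AA: "cadjoint A ** A = t *\<^sub>R mat 1"
      by (simp flip: scaleR_2 scaleR_scaleR)
    have "0 \<le> t" by (simp add: t_def sum_nonneg)
    show ?thesis
    proof (cases "t = 0")
      case True
      then have "A = 0" using cadjoint_mult_self_eq_0[of A] AA by simp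
      then show ?thesis by (intro exI[of _ 0] exI[of _ "mat 1"]) (simp add: unitary_mat_def vec_eq_iff)
    next
      case False
      define V where "V = (1 / sqrt t) *\<^sub>R A"
      have "cadjoint V ** V = mat 1"
        using False \<open>0 \<le> t\<close> by (simp add: V_def cadjoint_simps matrix_ring AA flip: real_sqrt_mult)
      then have "unitary_mat V" unfolding unitary_mat_def using matrix_left_right_inverse by blast
      moreover have "A = (\<chi> i j. of_real (sqrt t) * V $ i $ j)"
        using False \<open>0 \<le> t\<close> by (simp add: V_def vec_eq_iff scaleR_conv_of_real[where 'a='a])
      ultimately show ?thesis by blast
    qed
  qed
  then have "similarity_space S" by (simp add: similarity_space_def S_def)
  with dim show ?thesis by blast
qed

text \<open>The \<open>Max\<close> is meaningful since dimensions are bounded by that of the matrix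
  space and the empty family yields dimension 1. For m below the maximum, m members of an
  orthonormal basis of a maximal space suffice.\<close>

lemma le_radon_hurwitz_iff:
  assumes "1 \<le> m"
  shows "m \<le> radon_hurwitz TYPE('a::rc_field) TYPE('r::finite) \<longleftrightarrow> (\<exists>D :: nat \<Rightarrow> 'a^'r^'r. clifford (m - 1) D)"
proof -
  define dims where "dims = {dim S |S :: ('a^'r^'r) set. similarity_space S}"
  have rh: "radon_hurwitz TYPE('a) TYPE('r) = Max dims"
    by (simp add: radon_hurwitz_def dims_def similarity_space_def)
  have "dims \<subseteq> {..DIM('a^'r^'r)}" unfolding dims_def atMost_def using dim_subset_UNIV by blast
  then have fin: "finite dims" using finite_subset by blast
  have "clifford (1 - 1) (\<lambda>_. 0 :: 'a^'r^'r)" by (simp add: clifford_def)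
  then have "dims \<noteq> {}" using similarity_space_of_clifford[of 1] by (auto simp: dims_def)
  then have "Max dims \<in> dims" using fin by (rule Max_in[rotated])
  then obtain S :: "('a^'r^'r) set" where S: "similarity_space S" "dim S = Max dims" by (auto simp: dims_def)
  show ?thesis unfolding rh
  proof
    assume "m \<le> Max dims"
    then show "\<exists>D :: nat \<Rightarrow> 'a^'r^'r. clifford (m - 1) D"
      using clifford_of_similarity_space[OF S(1) assms] S(2) by simp
  next
    assume "\<exists>D :: nat \<Rightarrow> 'a^'r^'r. clifford (m - 1) D"
    then have "m \<in> dims" using similarity_space_of_clifford assms unfolding dims_def by blast
    then show "m \<le> Max dims" by (rule Max_ge[OF fin])
  qed
qed

lemma radon_hurwitz_eqI:
  assumes "has_clifford TYPE('a::rc_field) K CARD('r::finite)" and "\<not> (\<exists>D :: nat \<Rightarrow> 'a^'r^'r. clifford (K + 1) D)"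
  shows "radon_hurwitz TYPE('a) TYPE('r) = K + 1"
proof (rule antisym)
  show "K + 1 \<le> radon_hurwitz TYPE('a) TYPE('r)"
    using has_clifford_matrices[OF assms(1)] by (subst le_radon_hurwitz_iff) auto
  show "radon_hurwitz TYPE('a) TYPE('r) \<le> K + 1"
    using assms(2) le_radon_hurwitz_iff[of "K + 2", where 'a='a and 'r='r] by simp
qed

lemma not_power_Suc_dvd: "\<not> 2 ^ Suc k dvd (2 * a + 1) * (2 ^ k :: nat)"
proof
  assume "2 ^ Suc k dvd (2 * a + 1) * (2 ^ k :: nat)"
  then obtain q where "(2 * a + 1) * 2 ^ k = 2 * q * (2 ^ k :: nat)" by (auto simp: dvd_def ac_simps)
  then have "2 * a + 1 = 2 * q" by (metis mult_right_cancel power_not_zero zero_neq_numeral)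
  then show False by presburger
qed

text \<open>One generator more than the construction provides would force 2^(4b+c+1) to divide
  (2a+1) 2^(4b+c).\<close>

lemma radon_hurwitz_real:
  assumes "CARD('r::finite) = (2 * a + 1) * 2 ^ (4 * b + c)" "c \<le> 3"
  shows "radon_hurwitz TYPE(real) TYPE('r) = 8 * b + 2 ^ c"
proof -
  have "radon_hurwitz TYPE(real) TYPE('r) = (8 * b + 2 ^ c - 1) + 1"
  proof (rule radon_hurwitz_eqI)
    show "has_clifford TYPE(real) (8 * b + 2 ^ c - 1) CARD('r)"
      unfolding assms(1) by (rule has_clifford_copies[OF has_clifford_real[OF assms(2)]])
    have "8 * b + 2 ^ c - 1 + 1 = 8 * b + 2 ^ c" by simp
    then show "\<not> (\<exists>D :: nat \<Rightarrow> real^'r^'r. clifford (8 * b + 2 ^ c - 1 + 1) D)"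
      using real_clifford_dvd[of b c, where 'n='r] assms not_power_Suc_dvd[of "4 * b + c" a] by auto
  qed
  then show ?thesis by simp
qed

lemma radon_hurwitz_complex:
  assumes "CARD('r::finite) = (2 * a + 1) * 2 ^ k"
  shows "radon_hurwitz TYPE(complex) TYPE('r) = 2 * k + 2"
proof -
  have "radon_hurwitz TYPE(complex) TYPE('r) = (2 * k + 1) + 1"
  proof (rule radon_hurwitz_eqI)
    show "has_clifford TYPE(complex) (2 * k + 1) CARD('r)"
      unfolding assms(1) by (rule has_clifford_copies[OF has_clifford_complex])
    show "\<not> (\<exists>D :: nat \<Rightarrow> complex^'r^'r. clifford (2 * k + 1 + 1) D)"
      using complex_clifford_dvd[of "Suc k", where 'n='r] assms not_power_Suc_dvd[of k a] by auto
  qed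
  then show ?thesis by simp
qed

lemma skew_simplex_iff:
  assumes "3 \<le> n"
  shows "(\<exists>B :: nat \<Rightarrow> 'a::rc_field^'r^'r. rho_simplex n B \<and> (\<forall>i\<in>{1..n-1}. skew_hermitian (B i))) \<longleftrightarrow>
    n \<le> radon_hurwitz TYPE('a) TYPE('r) + 1"
proof -
  have "n \<le> radon_hurwitz TYPE('a) TYPE('r) + 1 \<longleftrightarrow> n - 1 \<le> radon_hurwitz TYPE('a) TYPE('r)" by auto
  also have "\<dots> \<longleftrightarrow> (\<exists>D :: nat \<Rightarrow> 'a^'r^'r. clifford (n - 1 - 1) D)"
    by (rule le_radon_hurwitz_iff) (use assms in simp)
  also have "n - 1 - 1 = n - 2" by simp
  finally show ?thesis unfolding skew_simplex_iff_clifford[OF assms] by (rule sym)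
qed

lemma skew_simplex_eitff:
  assumes "rho_simplex n (B :: nat \<Rightarrow> 'a::rc_field^'r^'r) \<and> (\<forall>i\<in>{1..n-1}. skew_hermitian (B i))"
  shows "std.eitff (2 * CARD('r)) CARD('r) n (simplex_eitff n B) \<and> std.total_symmetry n (simplex_eitff n B)"
  using unitary_simplex.eitff_simplex unitary_simplex.total_symmetry_simplex assms
  by (metis unitary_simplex.intro)

theorem theorem4p1:
  fixes r :: nat
  assumes card_r: "CARD('r::finite) = r"
  shows
    "(\<forall>n\<ge>3. \<forall>B :: nat \<Rightarrow> real^'r^'r.
        rho_simplex n B \<and> (\<forall>i\<in>{1..n-1}. skew_hermitian (B i)) \<longrightarrow>
        fd_hilbert_space.eitff (*s) std_ip (2 * r) r n (simplex_eitff n B) \<and>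
        fd_hilbert_space.total_symmetry (*s) std_ip n (simplex_eitff n B)) \<and>
     (\<forall>n\<ge>3. \<forall>B :: nat \<Rightarrow> complex^'r^'r.
        rho_simplex n B \<and> (\<forall>i\<in>{1..n-1}. skew_hermitian (B i)) \<longrightarrow>
        fd_hilbert_space.eitff (*s) std_ip (2 * r) r n (simplex_eitff n B) \<and>
        fd_hilbert_space.total_symmetry (*s) std_ip n (simplex_eitff n B)) \<and>
     (\<forall>n\<ge>3. (\<exists>B :: nat \<Rightarrow> real^'r^'r. rho_simplex n B \<and> (\<forall>i\<in>{1..n-1}. skew_hermitian (B i)))
        \<longleftrightarrow> n \<le> radon_hurwitz TYPE(real) TYPE('r) + 1) \<and>
     (\<forall>n\<ge>3. (\<exists>B :: nat \<Rightarrow> complex^'r^'r. rho_simplex n B \<and> (\<forall>i\<in>{1..n-1}. skew_hermitian (B i)))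
        \<longleftrightarrow> n \<le> radon_hurwitz TYPE(complex) TYPE('r) + 1) \<and>
     (\<forall>a b c. c \<le> 3 \<and> r = (2 * a + 1) * 2 ^ (4 * b + c) \<longrightarrow>
        radon_hurwitz TYPE(real) TYPE('r) = 8 * b + 2 ^ c \<and>
        radon_hurwitz TYPE(complex) TYPE('r) = 8 * b + 2 * c + 2) \<and>
     (\<forall>n\<ge>2. \<forall>(scale :: real \<Rightarrow> 'e::ab_group_add \<Rightarrow> 'e) ip U.
        fd_hilbert_space scale ip \<and> fd_hilbert_space.eitff scale ip (2 * r) r n U \<longrightarrow>
        fd_hilbert_space.alternating_symmetry scale ip n U \<or>
        fd_hilbert_space.total_symmetry scale ip n U) \<and>
     (\<forall>n\<ge>2. \<forall>(scale :: complex \<Rightarrow> 'f::ab_group_add \<Rightarrow> 'f) ip U.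
        fd_hilbert_space scale ip \<and> fd_hilbert_space.eitff scale ip (2 * r) r n U \<longrightarrow>
        fd_hilbert_space.alternating_symmetry scale ip n U \<or>
        fd_hilbert_space.total_symmetry scale ip n U)"
proof (intro conjI allI impI)
  have "r > 0" using card_r zero_less_card_finite[where 'a='r] by simp
  note sym = rc_hilbert_space.eitff_symmetry[OF rc_hilbert_space.intro _ \<open>r > 0\<close>]
  show "fd_hilbert_space.alternating_symmetry scale ip n U \<or> fd_hilbert_space.total_symmetry scale ip n U"
    if "fd_hilbert_space scale ip \<and> fd_hilbert_space.eitff scale ip (2 * r) r n U"
    for n and scale :: "real \<Rightarrow> 'e \<Rightarrow> 'e" and ip U
    using sym that by blast
  show "fd_hilbert_space.alternating_symmetry scale ip n U \<or> fd_hilbert_space.total_symmetry scale ip n U"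
    if "fd_hilbert_space scale ip \<and> fd_hilbert_space.eitff scale ip (2 * r) r n U"
    for n and scale :: "complex \<Rightarrow> 'f \<Rightarrow> 'f" and ip U
    using sym that by blast
  fix a b c assume "c \<le> 3 \<and> r = (2 * a + 1) * 2 ^ (4 * b + c)"
  then show "radon_hurwitz TYPE(real) TYPE('r) = 8 * b + 2 ^ c"
    "radon_hurwitz TYPE(complex) TYPE('r) = 8 * b + 2 * c + 2"
    using radon_hurwitz_real[of a b c, where 'r='r] radon_hurwitz_complex[of a "4 * b + c", where 'r='r] card_r
    by simp_all
qed (use skew_simplex_iff skew_simplex_eitff card_r in blast)+

end
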